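(* Let $U\le Sp_{2n}(q)$, let $\Gamma=\{2\varepsilon_i:1\le i\le n\}\cup\{\varepsilon_i+\varepsilon_{i+1}:1\le i<n\}\subseteq\Phi$, and let $\chi$ be an irreducible character of $U$. Then $\chi$ has maximum degree (among the irreducible characters of $U$) if and only if $\chi=\xi_{D,\phi}$ for some basic subset $D\subseteq\Gamma$ such that either $D$ or $D\cup\{2\varepsilon_n\}$ is a maximal basic subset of $\Gamma$, and some map $\phi\colon D\to\mathbb{F}_q^\times$.
   Context: Let $p\ge 3$ be a prime, $q=p^e$ ($e\ge 1$), $\mathbb{F}_q$ the field with $q$ elements, and $n\ge 1$. Let $U_k(q)$ be the group of unipotent upper-triangular $k\times k$ matrices over $\mathbb{F}_q$, and $U=Sp_{2n}(q)\cap U_{2n}(q)$, a Sylow $p$-subgroup of $Sp_{2n}(q)$. Explicitly, with $J$ the $n\times n$ matrix with 1's on the anti-diagonal and 0's elsewhere, $U$ consists of all block matrices $\begin{pmatrix} x & xz \\ 0 & Jx^{-T}J\end{pmatrix}$ with $x\in U_n(q)$ and $z$ an $n\times n$ matrix over $\mathbb{F}_q$ with $Jz^T-zJ=0$. Rows and columns of $2n\times 2n$ matrices are indexed, in order, by $1,\dots,n,-n,\dots,-1$; this order is denoted $\prec$. Roots: $\Phi=\{\varepsilon_i\pm\varepsilon_j:1\le i<j\le n\}\cup\{2\varepsilon_i:1\le i\le n\}$, where $\varepsilon_1,\dots,\varepsilon_n$ are the coordinate functions on the diagonal torus. Entries: for $i<j$, $\mathcal{E}(\varepsilon_i-\varepsilon_j)=\{(i,j),(-j,-i)\}$,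 $\mathcal{E}(\varepsilon_i+\varepsilon_j)=\{(i,-j),(j,-i)\}$; $\mathcal{E}(2\varepsilon_i)=\{(i,-i)\}$. For $D\subseteq\Phi$, $\mathcal{E}(D)=\bigcup_{\alpha\in D}\mathcal{E}(\alpha)$. For each $\alpha\in\Phi$ there is exactly one $(i,j)\in\mathcal{E}(\alpha)$ with $1\le i\le n$ and $i\prec j\preceq -i$. A subset $D\subseteq\Phi$ is basic if $\mathcal{E}(D)$ contains at most one entry from each row and at most one entry from each column. A maximal basic subset of $\Gamma$ is a basic subset contained in $\Gamma$ that is maximal with respect to inclusion among these. Supercharacters: for $i<j$, $U_{\varepsilon_i-\varepsilon_j}=\{x\in U: x_{i,k}=0,\ i<k<j\}$; $U_{\varepsilon_i+\varepsilon_j}=\{x\in U:x_{i,k}=x_{j,l}=0,\ i<k\le n,\ j<l\le n\}$; $U_{2\varepsilon_i}=\{x\in U:x_{i,k}=0,\ i<k\le n\}$. Fix a nontrivial linear character $\vartheta\colon\mathbb{F}_q^+\to\mathbb{C}^\times$. For $\alpha\in\Phi$, $r\in\mathbb{F}_q^\times$, $\lambda_{\alpha,r}(x)=\vartheta(rx_{i,j})$ (with $(i,j)$ the distinguished entry of $\mathcal{E}(\alpha)$ above) is a linear character of $U_\alpha$, and $\xi_{\alpha,r}=(\lambda_{\alpha,r})^U$ (induced character). For a basic $D\subseteq\Phi$ and $\phi\colon D\to\mathbb{F}_q^\times$, $\xi_{D,\phi}=\prod_{\alpha\in D}\xi_{\alpha,\phi(\alpha)}$ (the trivial character $1_U$ if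 $D=\emptyset$). *)

theory Defs
  imports
    "HOL-Library.Cardinality"
    "HOL-Computational_Algebra.Primes"
    "Jordan_Normal_Form.VS_Connect"
begin

section \<open>Complex characters of finite groups\<close>

definition mat_trace :: "'a::comm_monoid_add mat \<Rightarrow> 'a" where
  "mat_trace A = (\<Sum>i<dim_row A. A $$ (i, i))"

definition representation :: "('g, 'b) monoid_scheme \<Rightarrow> nat \<Rightarrow> ('g \<Rightarrow> complex mat) \<Rightarrow> bool" where
  "representation G d \<rho> \<longleftrightarrow> \<rho> \<in> hom G (units_of (ring_mat TYPE(complex) d ()))"

definition irreducible_representation ::
    "('g, 'b) monoid_scheme \<Rightarrow> nat \<Rightarrow> ('g \<Rightarrow> complex mat) \<Rightarrow> bool" where
  "irreducible_representation G d \<rho> \<longleftrightarrow>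
     representation G d \<rho> \<and> d \<noteq> 0 \<and>
     (\<forall>W. VectorSpace.subspace class_ring W (module_vec TYPE(complex) d) \<longrightarrow>
          (\<forall>g\<in>carrier G. \<forall>w\<in>W. \<rho> g *\<^sub>v w \<in> W) \<longrightarrow>
          W = {0\<^sub>v d} \<or> W = carrier_vec d)"

text \<open>Characters and class functions are total functions on the type of group elements; only
  their values on \<^term>\<open>carrier G\<close> matter, so they are compared on the carrier only.\<close>

definition irreducible_character :: "('g, 'b) monoid_scheme \<Rightarrow> ('g \<Rightarrow> complex) \<Rightarrow> bool" where
  "irreducible_character G \<chi> \<longleftrightarrow>
     (\<exists>d \<rho>. irreducible_representation G d \<rho> \<and> (\<forall>g\<in>carrier G. \<chi> g = mat_trace (\<rho> g)))"

text \<open>The degree of a character is its value at the identity, a natural number;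
  the real part is taken only so that degrees can be compared.\<close>

definition character_degree :: "('g, 'b) monoid_scheme \<Rightarrow> ('g \<Rightarrow> complex) \<Rightarrow> real" where
  "character_degree G \<chi> = Re (\<chi> \<one>\<^bsub>G\<^esub>)"

lemma character_degree_eq_dim:
  assumes "group G" and "representation G d \<rho>" and "\<forall>g\<in>carrier G. \<chi> g = mat_trace (\<rho> g)"
  shows "\<chi> \<one>\<^bsub>G\<^esub> = of_nat d"
proof -
  interpret R: ring "ring_mat TYPE(complex) d ()"
    by (rule ring_mat)
  have "\<rho> \<one>\<^bsub>G\<^esub> = \<one>\<^bsub>units_of (ring_mat TYPE(complex) d ())\<^esub>"
    using assms(1,2) R.units_group by (auto simp: representation_def intro: hom_one)
  then have "\<rho> \<one>\<^bsub>G\<^esub> = 1\<^sub>m d"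
    by (simp add: units_of_one ring_mat_simps)
  then show ?thesis
    using assms(1,3) by (simp add: mat_trace_def group.is_monoid monoid.one_closed)
qed

definition induced_character ::
    "('g, 'b) monoid_scheme \<Rightarrow> 'g set \<Rightarrow> ('g \<Rightarrow> complex) \<Rightarrow> 'g \<Rightarrow> complex" where
  "induced_character G H \<psi> g =
     (\<Sum>x\<in>carrier G. if x \<otimes>\<^bsub>G\<^esub> g \<otimes>\<^bsub>G\<^esub> inv\<^bsub>G\<^esub> x \<in> H then \<psi> (x \<otimes>\<^bsub>G\<^esub> g \<otimes>\<^bsub>G\<^esub> inv\<^bsub>G\<^esub> x) else 0)
       / of_nat (card H)"

definition nontrivial_additive_character :: "('a::field \<Rightarrow> complex) \<Rightarrow> bool" where
  "nontrivial_additive_character \<theta> \<longleftrightarrow>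
     (\<forall>a. \<theta> a \<noteq> 0) \<and> (\<forall>a b. \<theta> (a + b) = \<theta> a * \<theta> b) \<and> (\<exists>a. \<theta> a \<noteq> 1)"


section \<open>The Sylow subgroup of the symplectic group\<close>

definition antidiag_mat :: "nat \<Rightarrow> 'a::{zero,one} mat" where
  "antidiag_mat n = mat n n (\<lambda>(i, j). if i + j + 1 = n then 1 else 0)"

definition unitriangular :: "nat \<Rightarrow> 'a::{zero,one} mat set" where
  "unitriangular k = {x \<in> carrier_mat k k. upper_triangular x \<and> (\<forall>i<k. x $$ (i, i) = 1)}"

definition symplectic_form :: "nat \<Rightarrow> 'a::field mat" where
  "symplectic_form n =
     four_block_mat (0\<^sub>m n n) (antidiag_mat n) (- antidiag_mat n) (0\<^sub>m n n)"

definition Sp :: "nat \<Rightarrow> 'a::field mat set" where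
  "Sp n = {g \<in> carrier_mat (2*n) (2*n).
     transpose_mat g * symplectic_form n * g = symplectic_form n}"

definition USp :: "nat \<Rightarrow> 'a::field mat monoid" where
  "USp n = \<lparr>carrier = Sp n \<inter> unitriangular (2*n), monoid.mult = (*), one = 1\<^sub>m (2*n)\<rparr>"

lemma antidiag_mat_carrier [simp]: "antidiag_mat n \<in> carrier_mat n n"
  by (simp add: antidiag_mat_def)

lemma antidiag_mat_transpose [simp]: "transpose_mat (antidiag_mat n) = antidiag_mat n"
  by (rule eq_matI) (auto simp: antidiag_mat_def)

lemma antidiag_mat_square [simp]: "antidiag_mat n * antidiag_mat n = (1\<^sub>m n :: 'a::field mat)"
proof (rule eq_matI)
  fix i j assume "i < dim_row (1\<^sub>m n)" "j < dim_col (1\<^sub>m n)"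
  then have ij: "i < n" "j < n" by auto
  have "(antidiag_mat n * antidiag_mat n) $$ (i, j) =
      (\<Sum>k<n. (if k = n - 1 - i then (if i = j then 1 else 0) else 0) :: 'a)"
  proof -
    have "(antidiag_mat n * antidiag_mat n) $$ (i, j) =
        (\<Sum>k<n. antidiag_mat n $$ (i, k) * antidiag_mat n $$ (k, j) :: 'a)"
      using ij by (simp add: antidiag_mat_def scalar_prod_def atLeast0LessThan)
    also have "\<dots> = (\<Sum>k<n. (if k = n - 1 - i then (if i = j then 1 else 0) else 0))"
      by (rule sum.cong) (use ij in \<open>auto simp: antidiag_mat_def\<close>)
    finally show ?thesis .
  qed
  also have "\<dots> = 1\<^sub>m n $$ (i, j)"
    using ij by simp
  finally show "(antidiag_mat n * antidiag_mat n) $$ (i, j) = (1\<^sub>m n :: 'a mat) $$ (i, j)" .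
qed (auto simp: antidiag_mat_def)

lemma minus_mat_eq_zero_iff:
  fixes A B :: "'a::ab_group_add mat"
  assumes "A \<in> carrier_mat n n" "B \<in> carrier_mat n n"
  shows "A - B = 0\<^sub>m n n \<longleftrightarrow> A = B" and "- B + A = 0\<^sub>m n n \<longleftrightarrow> A = B"
  using assms by (auto simp: mat_eq_iff)

lemma unitriangular_inverse:
  fixes x y :: "'a::field mat"
  assumes x: "x \<in> unitriangular n" and y: "y \<in> carrier_mat n n" and xy: "x * y = 1\<^sub>m n"
  shows "y \<in> unitriangular n"
proof -
  have "\<forall>j\<le>i. y $$ (i, j) = (if i = j then 1 else 0)" if "i < n" for i
    using that
  proof (induction "n - i" arbitrary: i rule: less_induct)
    case less
    show ?case
    proof (intro allI impI)
      fix j assume j: "j \<le> i"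
      have xc: "x \<in> carrier_mat n n" using x by (simp add: unitriangular_def)
      have "(x * y) $$ (i, j) = (\<Sum>k<n. x $$ (i, k) * y $$ (k, j))"
        using less.prems j xc y by (simp add: scalar_prod_def atLeast0LessThan)
      also have "\<dots> = (\<Sum>k<n. if k = i then y $$ (i, j) else 0)"
      proof (rule sum.cong)
        fix k assume "k \<in> {..<n}"
        then have k: "k < n" by simp
        consider "k < i" | "k = i" | "k > i" by linarith
        then show "x $$ (i, k) * y $$ (k, j) = (if k = i then y $$ (i, j) else 0)"
        proof cases
          case 1
          then show ?thesis using x less.prems xc by (auto simp: unitriangular_def)
        next
          case 2
          then show ?thesis using x less.prems by (auto simp: unitriangular_def)
        next
          case 3
          then have "y $$ (k, j) = 0" using less.hyps[of k] k j by auto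
          then show ?thesis using 3 by auto
        qed
      qed simp
      also have "\<dots> = y $$ (i, j)" using less.prems by simp
      finally show "y $$ (i, j) = (if i = j then 1 else 0)"
        using xy less.prems j by simp
    qed
  qed
  then show ?thesis using y by (auto simp: unitriangular_def)
qed

lemma four_block_mat_eq_iff:
  assumes "A \<in> carrier_mat n n" "B \<in> carrier_mat n n" "C \<in> carrier_mat n n" "D \<in> carrier_mat n n"
    "A' \<in> carrier_mat n n" "B' \<in> carrier_mat n n" "C' \<in> carrier_mat n n" "D' \<in> carrier_mat n n"
  shows "four_block_mat A B C D = four_block_mat A' B' C' D' \<longleftrightarrow> A = A' \<and> B = B' \<and> C = C' \<and> D = D'"
proof
  assume eq: "four_block_mat A B C D = four_block_mat A' B' C' D'"
  have *: "four_block_mat A B C D $$ (i, j) = four_block_mat A' B' C' D' $$ (i, j)" for i j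
    using eq by simp
  show "A = A' \<and> B = B' \<and> C = C' \<and> D = D'"
  proof (intro conjI; rule eq_matI)
    fix i j
    show "i < dim_row A' \<Longrightarrow> j < dim_col A' \<Longrightarrow> A $$ (i, j) = A' $$ (i, j)"
      using *[of i j] assms by auto
    show "i < dim_row B' \<Longrightarrow> j < dim_col B' \<Longrightarrow> B $$ (i, j) = B' $$ (i, j)"
      using *[of i "j + n"] assms by auto
    show "i < dim_row C' \<Longrightarrow> j < dim_col C' \<Longrightarrow> C $$ (i, j) = C' $$ (i, j)"
      using *[of "i + n" j] assms by auto
    show "i < dim_row D' \<Longrightarrow> j < dim_col D' \<Longrightarrow> D $$ (i, j) = D' $$ (i, j)"
      using *[of "i + n" "j + n"] assms by auto
  qed (use assms in auto)
qed simp

lemma block_mem_Sp_iff: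
  fixes A B D :: "'a::field mat"
  assumes c: "A \<in> carrier_mat n n" "B \<in> carrier_mat n n" "D \<in> carrier_mat n n"
  defines "J \<equiv> antidiag_mat n"
  shows "four_block_mat A B (0\<^sub>m n n) D \<in> Sp n \<longleftrightarrow>
    transpose_mat A * J * D = J \<and> transpose_mat B * J * D = transpose_mat D * J * B"
proof -
  let ?g = "four_block_mat A B (0\<^sub>m n n) D"
  let ?T = transpose_mat
  have J: "J \<in> carrier_mat n n" "?T J = J" by (simp_all add: J_def)
  have g: "?g \<in> carrier_mat (2*n) (2*n)" using c by (auto simp: mult_2)
  have "?T ?g = four_block_mat (?T A) (0\<^sub>m n n) (?T B) (?T D)"
    by (subst transpose_four_block_mat) (use c in auto)
  moreover have "\<dots> * symplectic_form n =
      four_block_mat (0\<^sub>m n n) (?T A * J) (- (?T D * J)) (?T B * J)"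
    unfolding symplectic_form_def J_def[symmetric]
    by (subst mult_four_block_mat[where ?nr1.0=n and ?n1.0=n and ?n2.0=n and ?nr2.0=n and ?nc1.0=n and ?nc2.0=n])
       (use c J in auto)
  moreover have "\<dots> * ?g = four_block_mat (0\<^sub>m n n) (?T A * J * D)
      (- (?T D * J * A)) (- (?T D * J * B) + ?T B * J * D)"
    by (subst mult_four_block_mat[where ?nr1.0=n and ?n1.0=n and ?n2.0=n and ?nr2.0=n and ?nc1.0=n and ?nc2.0=n])
       (use c J in auto)
  ultimately have "?g \<in> Sp n \<longleftrightarrow>
      ?T A * J * D = J \<and> - (?T D * J * A) = - J \<and> - (?T D * J * B) + ?T B * J * D = 0\<^sub>m n n"
    unfolding Sp_def symplectic_form_def J_def[symmetric] using c J g
    by (simp add: four_block_mat_eq_iff[where n=n])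
  moreover have "?T (?T A * J * D) = ?T D * J * A"
    using c J by (simp add: transpose_mult[where n=n and nr=n and nc=n] assoc_mult_mat[where n\<^sub>1=n and n\<^sub>2=n and n\<^sub>3=n and n\<^sub>4=n])
  moreover have "- (?T D * J * B) + ?T B * J * D = 0\<^sub>m n n \<longleftrightarrow> ?T B * J * D = ?T D * J * B"
    by (rule minus_mat_eq_zero_iff) (use c J in auto)
  ultimately show ?thesis using J(2) by auto
qed

text \<open>The alternating form above is the one for which the block matrices
  \<open>(x, xz; 0, J x\<^sup>-\<^sup>T J)\<close> with \<open>J z\<^sup>T = z J\<close> make up the unitriangular part of the
  symplectic group; \<open>y\<close> is the inverse of \<open>x\<close>.\<close>

lemma carrier_USp:
  fixes n :: nat
  defines "J \<equiv> antidiag_mat n :: 'a::field mat"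
  shows "carrier (USp n) =
    {four_block_mat x (x * z) (0\<^sub>m n n) (J * transpose_mat y * J) | x y z :: 'a mat.
       x \<in> unitriangular n \<and> y \<in> carrier_mat n n \<and> x * y = 1\<^sub>m n \<and>
       z \<in> carrier_mat n n \<and> J * transpose_mat z - z * J = 0\<^sub>m n n}"
  (is "_ = ?R")
proof -
  let ?T = transpose_mat
  have J: "J \<in> carrier_mat n n" "?T J = J" "J * J = 1\<^sub>m n" by (simp_all add: J_def)
  note assoc = assoc_mult_mat[where n\<^sub>1=n and n\<^sub>2=n and n\<^sub>3=n and n\<^sub>4=n]
  note tmult = transpose_mult[where n=n and nr=n and nc=n]
  have JJ: "J * (J * M) = M" if "M \<in> carrier_mat n n" for M
    using that J by (simp add: assoc[symmetric] del: assoc_mult_mat)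
  have cancel: "x * (y * M) = M \<and> ?T y * (?T x * M) = M \<and> y * (x * M) = M \<and> ?T x * (?T y * M) = M"
    if "x \<in> carrier_mat n n" "y \<in> carrier_mat n n" "x * y = 1\<^sub>m n" "M \<in> carrier_mat n n"
    for x y M :: "'a mat"
  proof -
    have "y * x = 1\<^sub>m n" using that by (metis mat_mult_left_right_inverse)
    moreover have "?T y * ?T x = 1\<^sub>m n" "?T x * ?T y = 1\<^sub>m n"
      using that calculation by (metis tmult transpose_one)+
    ultimately show ?thesis using that by (simp add: assoc[symmetric] del: assoc_mult_mat)
  qed
  have zJ: "J * ?T z - z * J = 0\<^sub>m n n \<longleftrightarrow> ?T z * J = J * z" if z: "z \<in> carrier_mat n n" for z
  proof -
    have "J * ?T z - z * J = 0\<^sub>m n n \<longleftrightarrow> J * ?T z = z * J"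
      by (rule minus_mat_eq_zero_iff) (use z J in auto)
    also have "\<dots> \<longleftrightarrow> ?T z * J = J * z"
    proof
      assume "J * ?T z = z * J"
      then have "J * (J * ?T z) * J = J * (z * J) * J" by simp
      then show "?T z * J = J * z" using J z JJ by (simp add: assoc)
    next
      assume "?T z * J = J * z"
      then have "J * (?T z * J) * J = J * (J * z) * J" by simp
      then show "J * ?T z = z * J" using J z JJ by (simp add: assoc)
    qed
    finally show ?thesis .
  qed
  have key: "four_block_mat x (x * z) (0\<^sub>m n n) (J * ?T y * J) \<in> Sp n \<longleftrightarrow> J * ?T z - z * J = 0\<^sub>m n n"
    if "x \<in> carrier_mat n n" "y \<in> carrier_mat n n" "x * y = 1\<^sub>m n" "z \<in> carrier_mat n n"
    for x y z :: "'a mat"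
    using that J cancel[OF that(1-3)] JJ
    by (simp add: block_mem_Sp_iff J_def[symmetric] tmult assoc zJ)
  have sub: "?R \<subseteq> carrier (USp n)"
  proof
    fix g assume "g \<in> ?R"
    then obtain x y z where g: "g = four_block_mat x (x * z) (0\<^sub>m n n) (J * ?T y * J)"
      and x: "x \<in> unitriangular n" and y: "y \<in> carrier_mat n n" "x * y = 1\<^sub>m n"
      and z: "z \<in> carrier_mat n n" "J * ?T z - z * J = 0\<^sub>m n n" by auto
    have yu: "y \<in> unitriangular n" by (rule unitriangular_inverse[OF x y])
    have xc: "x \<in> carrier_mat n n" using x by (simp add: unitriangular_def)
    have JM: "(J * M * J) $$ (i, j) = M $$ (n - 1 - i, n - 1 - j)"
      if M: "M \<in> carrier_mat n n" and ij: "i < n" "j < n" for M i j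
    proof -
      have 1: "(J * M) $$ (i, k) = M $$ (n - 1 - i, k)" if "k < n" for k
      proof -
        have "(J * M) $$ (i, k) = (\<Sum>l<n. J $$ (i, l) * M $$ (l, k))"
          using that ij M J(1) by (simp add: scalar_prod_def atLeast0LessThan)
        also have "\<dots> = (\<Sum>l<n. if l = n - 1 - i then M $$ (l, k) else 0)"
          by (rule sum.cong) (use ij in \<open>auto simp: J_def antidiag_mat_def\<close>)
        finally show ?thesis using ij by simp
      qed
      have "(J * M * J) $$ (i, j) = (\<Sum>l<n. (J * M) $$ (i, l) * J $$ (l, j))"
        using ij M J(1) by (simp add: scalar_prod_def atLeast0LessThan del: assoc_mult_mat)
      also have "\<dots> = (\<Sum>l<n. if l = n - 1 - j then M $$ (n - 1 - i, l) else 0)"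
        by (rule sum.cong) (use ij 1 in \<open>auto simp: J_def antidiag_mat_def simp del: index_mult_mat(1)\<close>)
      finally show ?thesis using ij by simp
    qed
    have "J * ?T y * J \<in> unitriangular n"
      using J y(1) yu by (auto simp: unitriangular_def upper_triangular_def JM simp del: index_mult_mat(1) assoc_mult_mat)
    moreover have "four_block_mat a b (0\<^sub>m n n) d \<in> unitriangular (2*n)"
      if "a \<in> unitriangular n" "d \<in> unitriangular n" for a b d :: "'a mat"
    proof -
      have "a \<in> carrier_mat n n" "d \<in> carrier_mat n n" using that by (auto simp: unitriangular_def)
      then show ?thesis
        using that by (auto simp: unitriangular_def mult_2 intro!: upper_triangular_four_block)
    qed
    ultimately have "g \<in> unitriangular (2*n)" using x unfolding g by blast
    moreover have "g \<in> Sp n" unfolding g using key xc y z by simp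
    ultimately show "g \<in> carrier (USp n)" by (simp add: USp_def)
  qed
  have sup: "carrier (USp n) \<subseteq> ?R"
  proof
    fix g :: "'a mat" assume "g \<in> carrier (USp n)"
    then have gS: "g \<in> Sp n" and gu: "g \<in> unitriangular (2*n)" by (auto simp: USp_def)
    obtain A B C D where sp: "split_block g n n = (A, B, C, D)" by (metis prod_cases4)
    have gc: "dim_row g = n + n" "dim_col g = n + n" using gu by (auto simp: unitriangular_def)
    note blk = split_block[OF sp gc]
    have C: "C = 0\<^sub>m n n"
      by (rule eq_matI)
         (use sp gu in \<open>auto simp: split_block_def Let_def unitriangular_def upper_triangular_def\<close>)
    have A: "A \<in> unitriangular n"
      using sp gu by (auto simp: split_block_def Let_def unitriangular_def upper_triangular_def)
    have g: "g = four_block_mat A B (0\<^sub>m n n) D" using blk C by simp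
    have c: "A \<in> carrier_mat n n" "B \<in> carrier_mat n n" "D \<in> carrier_mat n n" using blk by auto
    have AD: "?T A * J * D = J"
      using gS block_mem_Sp_iff[OF c] by (simp add: g J_def)
    define y where "y = J * ?T D * J"
    have y: "y \<in> carrier_mat n n" using c J by (simp add: y_def)
    have "J * ?T (?T A * J * D) = 1\<^sub>m n" using AD J by simp
    then have "(J * ?T D * J) * A = 1\<^sub>m n" using c J by (simp add: tmult assoc)
    then have yA: "A * y = 1\<^sub>m n"
      using c y by (metis mat_mult_left_right_inverse y_def)
    have D: "D = J * ?T y * J" using c J JJ by (simp add: y_def tmult assoc)
    define z where "z = y * B"
    have z: "z \<in> carrier_mat n n" using y c by (simp add: z_def)
    have B: "B = A * z" using cancel[OF c(1) y yA c(2)] by (simp add: z_def)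
    have "J * ?T z - z * J = 0\<^sub>m n n" using key[OF c(1) y yA z] gS g B D by simp
    then show "g \<in> ?R" using g B D A y yA z by blast
  qed
  show ?thesis using sub sup by blast
qed

lemma group_USp: "group (USp n :: 'a::field mat monoid)"
proof -
  let ?\<Omega> = "symplectic_form n :: 'a mat" and ?N = "2 * n"
  have \<Omega>: "?\<Omega> \<in> carrier_mat ?N ?N" by (simp add: symplectic_form_def mult_2)
  note assoc = assoc_mult_mat[where n\<^sub>1="?N" and n\<^sub>2="?N" and n\<^sub>3="?N" and n\<^sub>4="?N"]
  note tmult = transpose_mult[where n="?N" and nr="?N" and nc="?N"]
  have mult: "x * y \<in> carrier (USp n)" if "x \<in> carrier (USp n)" "y \<in> carrier (USp n)" for x y :: "'a mat"
  proof -
    have c: "x \<in> carrier_mat ?N ?N" "y \<in> carrier_mat ?N ?N"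
      and s: "transpose_mat x * ?\<Omega> * x = ?\<Omega>" "transpose_mat y * ?\<Omega> * y = ?\<Omega>"
      and u: "x \<in> unitriangular ?N" "y \<in> unitriangular ?N"
      using that by (auto simp: USp_def Sp_def)
    have "transpose_mat (x * y) * ?\<Omega> * (x * y) = transpose_mat y * (transpose_mat x * ?\<Omega> * x) * y"
      using c \<Omega> by (simp add: tmult assoc)
    then have "x * y \<in> Sp n" using c s by (simp add: Sp_def)
    moreover have "(x * y) $$ (i, j) = (if i = j then 1 else 0)" if "j \<le> i" "i < ?N" for i j
    proof -
      have "(x * y) $$ (i, j) = (\<Sum>k<?N. x $$ (i, k) * y $$ (k, j))"
        using c that by (simp add: scalar_prod_def atLeast0LessThan)
      also have "\<dots> = (\<Sum>k<?N. if k = i then (if i = j then 1 else 0) else 0)"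
      proof (rule sum.cong)
        fix k assume k: "k \<in> {..<?N}"
        consider "k < i" | "k = i" | "k > i" by linarith
        then show "x $$ (i, k) * y $$ (k, j) = (if k = i then (if i = j then 1 else 0) else 0)"
          using k u c that by cases (auto simp: unitriangular_def upper_triangular_def)
      qed simp
      finally show ?thesis using that by simp
    qed
    ultimately show ?thesis using c
      by (auto simp: USp_def unitriangular_def simp del: index_mult_mat(1))
  qed
  have inv: "\<exists>y\<in>carrier (USp n). y * x = 1\<^sub>m ?N" if "x \<in> carrier (USp n)" for x :: "'a mat"
  proof -
    have c: "x \<in> carrier_mat ?N ?N" and s: "transpose_mat x * ?\<Omega> * x = ?\<Omega>"
      and u: "x \<in> unitriangular ?N"
      using that by (auto simp: USp_def Sp_def)
    have \<Omega>2: "(- ?\<Omega>) * ?\<Omega> = 1\<^sub>m ?N"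
    proof -
      have "?\<Omega> * ?\<Omega> = - (1\<^sub>m ?N)"
        unfolding symplectic_form_def
        by (subst mult_four_block_mat[where ?nr1.0=n and ?n1.0=n and ?n2.0=n and ?nr2.0=n and ?nc1.0=n and ?nc2.0=n])
           (auto intro!: eq_matI simp: carrier_matD[OF antidiag_mat_carrier])
      then show ?thesis using \<Omega> by simp
    qed
    define y where "y = - ?\<Omega> * transpose_mat x * ?\<Omega>"
    have y: "y \<in> carrier_mat ?N ?N" using c \<Omega> by (simp add: y_def)
    have "y * x = - ?\<Omega> * (transpose_mat x * ?\<Omega> * x)"
      using c \<Omega> unfolding y_def by (simp add: assoc)
    then have yx: "y * x = 1\<^sub>m ?N" using s \<Omega>2 by simp
    then have xy: "x * y = 1\<^sub>m ?N" using c y by (metis mat_mult_left_right_inverse)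
    have "transpose_mat y * transpose_mat x = 1\<^sub>m ?N"
      using c y xy by (metis tmult transpose_one)
    then have "transpose_mat y * (transpose_mat x * ?\<Omega> * x) * y = ?\<Omega> * (x * y)"
      using c y \<Omega> by (simp add: assoc[symmetric] del: assoc_mult_mat)
    then have "transpose_mat y * ?\<Omega> * y = ?\<Omega>" using s xy \<Omega> by simp
    moreover have "y \<in> unitriangular ?N" by (rule unitriangular_inverse[OF u y xy])
    ultimately show ?thesis using y yx by (auto simp: USp_def Sp_def)
  qed
  have one: "1\<^sub>m ?N \<in> carrier (USp n :: 'a mat monoid)"
    using \<Omega> by (auto simp: USp_def Sp_def unitriangular_def)
  have carr: "x \<in> carrier_mat ?N ?N" if "x \<in> carrier (USp n)" for x :: "'a mat"
    using that by (auto simp: USp_def Sp_def)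
  have simps: "x \<otimes>\<^bsub>USp n\<^esub> y = x * y" "\<one>\<^bsub>USp n\<^esub> = 1\<^sub>m ?N" for x y :: "'a mat"
    by (simp_all add: USp_def)
  show ?thesis
    by (rule groupI) (use mult one inv carr in \<open>auto simp: simps assoc left_mult_one_mat[OF carr]\<close>)
qed


section \<open>Roots and their entries\<close>

text \<open>The positive roots \<open>\<epsilon>\<^sub>i - \<epsilon>\<^sub>j\<close>, \<open>\<epsilon>\<^sub>i + \<epsilon>\<^sub>j\<close> (with \<open>i < j\<close>) and \<open>2\<epsilon>\<^sub>i\<close> are pairwise
  distinct and serve only as labels, so they are represented as a free datatype.\<close>

datatype root =
    Eps_Diff nat nat
  | Eps_Sum nat nat
  | Eps_Double nat

definition Phi :: "nat \<Rightarrow> root set" where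
  "Phi n = {Eps_Diff i j | i j. 1 \<le> i \<and> i < j \<and> j \<le> n}
         \<union> {Eps_Sum i j | i j. 1 \<le> i \<and> i < j \<and> j \<le> n}
         \<union> {Eps_Double i | i. 1 \<le> i \<and> i \<le> n}"

fun entries :: "root \<Rightarrow> (int \<times> int) set" where
  "entries (Eps_Diff i j) = {(int i, int j), (- int j, - int i)}"
| "entries (Eps_Sum i j) = {(int i, - int j), (int j, - int i)}"
| "entries (Eps_Double i) = {(int i, - int i)}"

text \<open>Rows and columns carry the labels \<open>1, \<dots>, n, -n, \<dots>, -1\<close> in this order; \<open>pos n k\<close> is the
  zero-based position of the label \<open>k\<close>. The order \<open>i \<prec> j\<close> on labels is \<open>pos n i < pos n j\<close>.\<close>

definition pos :: "nat \<Rightarrow> int \<Rightarrow> nat" where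
  "pos n k = nat (if k > 0 then k - 1 else 2 * int n + k)"

definition entry :: "nat \<Rightarrow> 'a mat \<Rightarrow> int \<Rightarrow> int \<Rightarrow> 'a" where
  "entry n x i j = x $$ (pos n i, pos n j)"

definition main_entry :: "nat \<Rightarrow> root \<Rightarrow> int \<times> int" where
  "main_entry n \<alpha> = (THE e. e \<in> entries \<alpha> \<and>
     (case e of (i, j) \<Rightarrow> 1 \<le> i \<and> i \<le> int n \<and> pos n i < pos n j \<and> pos n j \<le> pos n (- i)))"

lemma main_entry_simps:
  "Eps_Diff i j \<in> Phi n \<Longrightarrow> main_entry n (Eps_Diff i j) = (int i, int j)"
  "Eps_Sum i j \<in> Phi n \<Longrightarrow> main_entry n (Eps_Sum i j) = (int i, - int j)"
  "Eps_Double i \<in> Phi n \<Longrightarrow> main_entry n (Eps_Double i) = (int i, - int i)"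
  unfolding main_entry_def by (rule the_equality; force simp: Phi_def pos_def)+

definition basic :: "root set \<Rightarrow> bool" where
  "basic D \<longleftrightarrow> inj_on fst (\<Union>\<alpha>\<in>D. entries \<alpha>) \<and> inj_on snd (\<Union>\<alpha>\<in>D. entries \<alpha>)"

definition maximal_basic :: "root set \<Rightarrow> root set \<Rightarrow> bool" where
  "maximal_basic \<Gamma> D \<longleftrightarrow>
     D \<subseteq> \<Gamma> \<and> basic D \<and> (\<forall>D'. D' \<subseteq> \<Gamma> \<and> basic D' \<and> D \<subseteq> D' \<longrightarrow> D' = D)"

definition Gamma :: "nat \<Rightarrow> root set" where
  "Gamma n = {Eps_Double i | i. 1 \<le> i \<and> i \<le> n} \<union> {Eps_Sum i (i + 1) | i. 1 \<le> i \<and> i < n}"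


section \<open>Supercharacters\<close>

fun root_subgroup :: "nat \<Rightarrow> root \<Rightarrow> 'a::field mat set" where
  "root_subgroup n (Eps_Diff i j) =
     {x \<in> carrier (USp n). \<forall>k. i < k \<and> k < j \<longrightarrow> entry n x (int i) (int k) = 0}"
| "root_subgroup n (Eps_Sum i j) =
     {x \<in> carrier (USp n).
        (\<forall>k. i < k \<and> k \<le> n \<longrightarrow> entry n x (int i) (int k) = 0) \<and>
        (\<forall>l. j < l \<and> l \<le> n \<longrightarrow> entry n x (int j) (int l) = 0)}"
| "root_subgroup n (Eps_Double i) =
     {x \<in> carrier (USp n). \<forall>k. i < k \<and> k \<le> n \<longrightarrow> entry n x (int i) (int k) = 0}"

definition root_character ::
    "('a::field \<Rightarrow> complex) \<Rightarrow> nat \<Rightarrow> root \<Rightarrow> 'a \<Rightarrow> 'a mat \<Rightarrow> complex" where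
  "root_character \<theta> n \<alpha> r x = (case main_entry n \<alpha> of (i, j) \<Rightarrow> \<theta> (r * entry n x i j))"

definition elementary_supercharacter ::
    "('a::field \<Rightarrow> complex) \<Rightarrow> nat \<Rightarrow> root \<Rightarrow> 'a \<Rightarrow> 'a mat \<Rightarrow> complex" where
  "elementary_supercharacter \<theta> n \<alpha> r =
     induced_character (USp n) (root_subgroup n \<alpha>) (root_character \<theta> n \<alpha> r)"

definition supercharacter ::
    "('a::field \<Rightarrow> complex) \<Rightarrow> nat \<Rightarrow> root set \<Rightarrow> (root \<Rightarrow> 'a) \<Rightarrow> 'a mat \<Rightarrow> complex" where
  "supercharacter \<theta> n D \<phi> x = (\<Prod>\<alpha>\<in>D. elementary_supercharacter \<theta> n \<alpha> (\<phi> \<alpha>) x)"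

end

theory Submission
  imports Defs "Jordan_Normal_Form.Spectral_Radius"
begin

text \<open>The elements of \<open>U\<close> with \<open>x = 1\<close> form an abelian normal subgroup \<open>A\<close>, isomorphic to the symmetric
  matrices and of index \<open>N = |U\<^sub>n(q)|\<close>. An irreducible representation contains an \<open>A\<close>-eigenvector, and
  the translates of it by coset representatives span, so every degree is at most \<open>N\<close>; in degree \<open>N\<close>
  they form a basis, and the character is induced from a linear character
  \<open>\<lambda>\<^sub>T(b) = \<theta>(\<Sum>\<^sub>i\<^sub>j T\<^sub>i\<^sub>j b\<^sub>i\<^sub>j)\<close> of \<open>A\<close>, with \<open>T\<close> symmetric. By Schur's lemma, \<open>T\<close> then has trivial
  stabilizer under the congruence action \<open>T \<mapsto> x\<^sup>T T x\<close> of the unitriangular group. Conversely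
  \<open>\<lambda>\<^sub>T\<close> with \<open>T = 1\<close> induces irreducibly, so \<open>N\<close> is attained.

  Symmetric Gaussian elimination with pivots of size one or two, which never breaks down when the stabilizer
  is trivial, moves \<open>T\<close> to a tridiagonal monomial form with at most the last row zero. These forms are the
  pairs \<open>(D, \<phi>)\<close> of the theorem. Finally, the subgroups \<open>U\<^sub>\<alpha>\<close> for \<open>\<alpha> \<in> D\<close> prescribe disjoint sets of rows
  of \<open>x\<close> that together determine \<open>x\<close>, so they meet in \<open>A\<close> and the product of the characters
  induced from them is the character induced from the product of their linear characters on \<open>A\<close>.\<close>

section \<open>Representations and matrices\<close>

text \<open>Only unitriangular congruences are available, so a basis vector may be changed by
  earlier ones but never moved. A pivot therefore has to appear at \<open>(k, k)\<close> or at
  \<open>(k, k + 1)\<close>; a nonzero entry farther to the right cannot be brought there. What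
  rescues the elimination is that failure at both places already produces a nontrivial stabilizer.
  Odd characteristic enters as division by 2. A symmetric pair of off-diagonal entries is counted
  twice by \<open>\<lambda>_T\<close>, so distinct \<open>T\<close> give distinct characters only if
  2 is invertible, and \<phi> takes the value 2 T_{i,i+1} at \<epsilon>_i + \<epsilon>_{i+1}. The
  Eichler transformation and the pivots of size two need a half as well. The last row of a
  unitriangular matrix is trivial anyway, which is why the root 2\<epsilon>_n may be missing from
  \<open>D\<close>. The backward implication compares degrees only: \<chi> is irreducible by
  hypothesis, so irreducibility of the supercharacter is not at issue. The forward one must know
  that \<open>N\<close> is attained, hence the example \<open>T = 1\<close>.\<close>

lemma subspace_module_vec_iff:
  "VectorSpace.subspace class_ring W (module_vec TYPE('a::field) d) \<longleftrightarrow>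
     W \<subseteq> carrier_vec d \<and> 0\<^sub>v d \<in> W \<and> (\<forall>v\<in>W. \<forall>w\<in>W. v + w \<in> W) \<and> (\<forall>c. \<forall>v\<in>W. c \<cdot>\<^sub>v v \<in> W)"
  unfolding VectorSpace.subspace_def LinearCombinations.submodule_def
  using vec_vs[where ?'a='a] vec_module[where ?'a='a]
  by (auto simp: module_vec_simps class_ring_simps)

text \<open>Invertibility of the values comes for free: a multiplicative map that sends the identity
  to the identity matrix makes \<open>\<rho> g\<close> and \<open>\<rho> (inv g)\<close> mutually
  inverse.\<close>

lemma (in group) representation_iff:
  "representation G d \<rho> \<longleftrightarrow>
     (\<forall>g\<in>carrier G. \<rho> g \<in> carrier_mat d d) \<and>
     (\<forall>g\<in>carrier G. \<forall>h\<in>carrier G. \<rho> (g \<otimes> h) = \<rho> g * \<rho> h) \<and> \<rho> \<one> = 1\<^sub>m d"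
  (is "?L \<longleftrightarrow> ?R")
proof
  assume L: ?L
  interpret R: ring "ring_mat TYPE(complex) d ()" by (rule ring_mat)
  have "\<rho> \<one> = \<one>\<^bsub>units_of (ring_mat TYPE(complex) d ())\<^esub>"
    using L R.units_group is_group by (auto simp: representation_def intro: hom_one)
  then have one: "\<rho> \<one> = 1\<^sub>m d" by (simp add: units_of_one ring_mat_simps)
  have "\<rho> g \<in> carrier_mat d d" if "g \<in> carrier G" for g
    using hom_in_carrier[OF L[unfolded representation_def] that]
    by (simp add: units_of_carrier Units_def ring_mat_simps)
  moreover have "\<rho> (g \<otimes> h) = \<rho> g * \<rho> h" if "g \<in> carrier G" "h \<in> carrier G" for g h
    using hom_mult[OF L[unfolded representation_def] that]
    by (simp add: units_of_mult ring_mat_simps)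
  ultimately show ?R using one by blast
next
  assume R: ?R
  have "\<rho> g \<in> Units (ring_mat TYPE(complex) d ())" if g: "g \<in> carrier G" for g
  proof -
    have "\<rho> (inv g) * \<rho> g = 1\<^sub>m d" "\<rho> g * \<rho> (inv g) = 1\<^sub>m d"
      using R g by (metis inv_closed l_inv, metis inv_closed r_inv)
    then show ?thesis
      using R g inv_closed[OF g] unfolding Units_def ring_mat_simps by blast
  qed
  then show ?L
    using R unfolding representation_def
    by (intro homI) (auto simp: units_of_carrier units_of_mult ring_mat_simps)
qed

lemma mat_trace_mult_commute:
  fixes A B :: "'a::comm_semiring_1 mat"
  assumes "A \<in> carrier_mat m n" "B \<in> carrier_mat n m"
  shows "mat_trace (A * B) = mat_trace (B * A)"
proof -
  have "mat_trace (A * B) = (\<Sum>i<m. \<Sum>k<n. A $$ (i, k) * B $$ (k, i))"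
    using assms by (simp add: mat_trace_def scalar_prod_def atLeast0LessThan)
  also have "\<dots> = (\<Sum>k<n. \<Sum>i<m. B $$ (k, i) * A $$ (i, k))"
    by (subst sum.swap) (simp add: mult.commute)
  also have "\<dots> = mat_trace (B * A)"
    using assms by (simp add: mat_trace_def scalar_prod_def atLeast0LessThan)
  finally show ?thesis .
qed

text \<open>Padding \<open>P\<close> with zero columns and \<open>Q\<close> with zero rows to size
  \<open>d\<close> keeps the product. One-sided inverses of square matrices are two-sided, so
  \<open>Q' * P'\<close> would be the identity, although its row \<open>N\<close> is zero.\<close>

lemma right_inverse_imp_dim_le:
  fixes P Q :: "'a::field mat"
  assumes P: "P \<in> carrier_mat d N" and Q: "Q \<in> carrier_mat N d" and PQ: "P * Q = 1\<^sub>m d"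
  shows "d \<le> N"
proof (rule ccontr)
  assume "\<not> d \<le> N"
  then have N: "N < d" by simp
  define P' where "P' = mat d d (\<lambda>(i, j). if j < N then P $$ (i, j) else 0)"
  define Q' where "Q' = mat d d (\<lambda>(i, j). if i < N then Q $$ (i, j) else 0)"
  have c: "P' \<in> carrier_mat d d" "Q' \<in> carrier_mat d d" by (simp_all add: P'_def Q'_def)
  have "P' * Q' = P * Q"
  proof (rule eq_matI)
    fix i j assume "i < dim_row (P * Q)" "j < dim_col (P * Q)"
    then have ij: "i < d" "j < d" using P Q by auto
    have "(P' * Q') $$ (i, j) = (\<Sum>k<d. if k < N then P $$ (i, k) * Q $$ (k, j) else 0)"
      using c ij by (auto simp: scalar_prod_def atLeast0LessThan P'_def Q'_def intro!: sum.cong)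
    also have "\<dots> = (\<Sum>k<N. P $$ (i, k) * Q $$ (k, j))"
      by (rule sum.mono_neutral_cong_right) (use N in auto)
    finally show "(P' * Q') $$ (i, j) = (P * Q) $$ (i, j)"
      using P Q ij by (simp add: scalar_prod_def atLeast0LessThan)
  qed (use P Q c in auto)
  then have "Q' * P' = 1\<^sub>m d" using PQ c by (metis mat_mult_left_right_inverse)
  moreover have "(Q' * P') $$ (N, N) = 0"
    using N c by (simp add: scalar_prod_def P'_def Q'_def)
  ultimately show False using N by simp
qed

lemma surj_mult_mat_vec_right_inverse:
  fixes P :: "'a::field mat"
  assumes P: "P \<in> carrier_mat d N"
    and surj: "\<And>w. w \<in> carrier_vec d \<Longrightarrow> \<exists>c\<in>carrier_vec N. P *\<^sub>v c = w"
  obtains Q where "Q \<in> carrier_mat N d" "P * Q = 1\<^sub>m d"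
proof -
  obtain c where c: "\<And>i. i < d \<Longrightarrow> c i \<in> carrier_vec N \<and> P *\<^sub>v c i = unit_vec d i"
    using surj[OF unit_vec_carrier] by metis
  define Q where "Q = mat_of_cols N (map c [0..<d])"
  have Q: "Q \<in> carrier_mat N d" unfolding Q_def using mat_of_cols_carrier(1)[of N "map c [0..<d]"] by simp
  have "P * Q = 1\<^sub>m d"
  proof (rule eq_matI)
    fix i j assume "i < dim_row (1\<^sub>m d)" "j < dim_col (1\<^sub>m d)"
    then have ij: "i < d" "j < d" by auto
    have "col Q j = c j"
      using c[OF ij(2)] ij col_mat_of_cols[of j "map c [0..<d]" N] by (simp add: Q_def)
    then have "(P * Q) $$ (i, j) = (P *\<^sub>v c j) $ i" using P Q ij by simp
    then show "(P * Q) $$ (i, j) = (1\<^sub>m d :: 'a mat) $$ (i, j)" using c[OF ij(2)] ij by simp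
  qed (use P Q in auto)
  with Q show ?thesis by (rule that)
qed

lemma (in group) inv_mult_cancel:
  assumes "x \<in> carrier G" "y \<in> carrier G"
  shows "inv x \<otimes> (x \<otimes> y) = y" "x \<otimes> (inv x \<otimes> y) = y"
  using assms by (simp_all add: m_assoc[symmetric])

lemma (in group) irreducible_representationD:
  assumes "irreducible_representation G d \<rho>"
  shows "\<And>g. g \<in> carrier G \<Longrightarrow> \<rho> g \<in> carrier_mat d d"
    and "\<And>g h. g \<in> carrier G \<Longrightarrow> h \<in> carrier G \<Longrightarrow> \<rho> (g \<otimes> h) = \<rho> g * \<rho> h"
    and "\<rho> \<one> = 1\<^sub>m d" and "d \<noteq> 0"
  using assms unfolding irreducible_representation_def representation_iff by blast+

section \<open>Inducing a linear character\<close>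

text \<open>The \<open>r i\<close> represent the right cosets of \<open>A\<close>, numbered because
  they index the rows and columns of matrices. \<open>lam\<close> matters on \<open>A\<close>
  only.\<close>

locale linear_induction = group G for G (structure) +
  fixes A :: "'a set" and lam :: "'a \<Rightarrow> complex" and N :: nat and r :: "nat \<Rightarrow> 'a"
  assumes finite_carrier: "finite (carrier G)"
    and subgroup_A: "subgroup A G"
    and lam_mult: "\<And>a b. a \<in> A \<Longrightarrow> b \<in> A \<Longrightarrow> lam (a \<otimes> b) = lam a * lam b"
    and lam_one: "lam \<one> = 1"
    and r_carrier: "\<And>i. i < N \<Longrightarrow> r i \<in> carrier G"
    and transversal: "\<And>g. g \<in> carrier G \<Longrightarrow> \<exists>!i. i < N \<and> g \<otimes> inv (r i) \<in> A"
begin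

definition lam0 :: "'a \<Rightarrow> complex" where
  "lam0 g = (if g \<in> A then lam g else 0)"

text \<open>The induced representation in its monomial basis: if \<open>v\<close> spans the line on
  which \<open>A\<close> acts by \<open>lam\<close>, then \<open>g\<close> sends
  \<open>inv (r i) v\<close> to \<open>lam (r j g inv (r i))\<close> times
  \<open>inv (r j) v\<close>, where \<open>j\<close> is the index that puts the argument of
  \<open>lam\<close> into \<open>A\<close>.\<close>

definition induced_mat :: "'a \<Rightarrow> complex mat" where
  "induced_mat g = mat N N (\<lambda>(j, i). lam0 (r j \<otimes> g \<otimes> inv (r i)))"

lemma A_carrier: "a \<in> A \<Longrightarrow> a \<in> carrier G"
  using subgroup.subset[OF subgroup_A] by auto

lemma A_mult_iff:
  assumes "a \<in> A" "g \<in> carrier G"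
  shows "a \<otimes> g \<in> A \<longleftrightarrow> g \<in> A" "g \<otimes> a \<in> A \<longleftrightarrow> g \<in> A"
proof -
  have ac: "a \<in> carrier G" and ia: "inv a \<in> A"
    using A_carrier assms subgroup.m_inv_closed[OF subgroup_A] by auto
  have "inv a \<otimes> (a \<otimes> g) = g" "g \<otimes> a \<otimes> inv a = g"
    using ac assms by (simp_all add: inv_mult_cancel m_assoc)
  then show "a \<otimes> g \<in> A \<longleftrightarrow> g \<in> A" "g \<otimes> a \<in> A \<longleftrightarrow> g \<in> A"
    using ia assms subgroup.m_closed[OF subgroup_A] by metis+
qed

lemma lam0_mult:
  assumes "a \<in> A" "g \<in> carrier G"
  shows "lam0 (a \<otimes> g) = lam a * lam0 g" "lam0 (g \<otimes> a) = lam0 g * lam a"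
  using assms lam_mult A_mult_iff[OF assms] by (auto simp: lam0_def)

lemma transversal_unique:
  assumes "i < N" "j < N"
  shows "r j \<otimes> inv (r i) \<in> A \<longleftrightarrow> i = j"
proof -
  have "r j \<otimes> inv (r j) \<in> A" using assms r_carrier subgroup.one_closed[OF subgroup_A] by simp
  then show ?thesis using transversal[of "r j"] r_carrier assms by auto
qed

lemma induced_mat_carrier [simp]: "induced_mat g \<in> carrier_mat N N"
  by (simp add: induced_mat_def)

text \<open>Only the coset of \<open>A\<close> that contains \<open>x\<close> contributes, and there
  \<open>lam0\<close> is multiplicative because one factor lies in \<open>A\<close>. This is the
  product rule for the induced matrices.\<close>

lemma lam0_inv_r_sum:
  assumes x: "x \<in> carrier G" and y: "y \<in> carrier G"
  shows "(\<Sum>k<N. lam0 (x \<otimes> inv (r k)) * lam0 (r k \<otimes> y)) = lam0 (x \<otimes> y)"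
proof -
  obtain k where k: "k < N" "x \<otimes> inv (r k) \<in> A"
    and u: "\<And>l. l < N \<Longrightarrow> x \<otimes> inv (r l) \<in> A \<Longrightarrow> l = k"
    using transversal[OF x] by blast
  have "(\<Sum>k<N. lam0 (x \<otimes> inv (r k)) * lam0 (r k \<otimes> y)) = 
      (\<Sum>l<N. if l = k then lam0 (x \<otimes> inv (r k)) * lam0 (r k \<otimes> y) else 0)"
    by (rule sum.cong) (auto simp: lam0_def dest: u)
  also have "\<dots> = lam0 (x \<otimes> inv (r k)) * lam0 (r k \<otimes> y)" using k by simp
  also have "\<dots> = lam0 ((x \<otimes> inv (r k)) \<otimes> (r k \<otimes> y))"
    using k x y r_carrier by (subst lam0_mult) (auto simp: lam0_def)
  also have "(x \<otimes> inv (r k)) \<otimes> (r k \<otimes> y) = x \<otimes> y"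
    using k x y r_carrier by (simp add: m_assoc inv_mult_cancel)
  finally show ?thesis .
qed

lemma representation_induced_mat: "representation G N induced_mat"
  unfolding representation_iff
proof (intro conjI ballI)
  fix g h assume g: "g \<in> carrier G" and h: "h \<in> carrier G"
  show "induced_mat (g \<otimes> h) = induced_mat g * induced_mat h"
  proof (rule eq_matI)
    fix j i assume "j < dim_row (induced_mat g * induced_mat h)"
      "i < dim_col (induced_mat g * induced_mat h)"
    then have ij: "j < N" "i < N" by (auto simp: induced_mat_def)
    have "(induced_mat g * induced_mat h) $$ (j, i) =
        (\<Sum>k<N. lam0 (r j \<otimes> g \<otimes> inv (r k)) * lam0 (r k \<otimes> (h \<otimes> inv (r i))))"
      using ij g h r_carrier
      by (auto simp: induced_mat_def scalar_prod_def atLeast0LessThan m_assoc intro!: sum.cong)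
    also have "\<dots> = lam0 ((r j \<otimes> g) \<otimes> (h \<otimes> inv (r i)))"
      by (rule lam0_inv_r_sum) (use ij g h r_carrier in auto)
    finally show "induced_mat (g \<otimes> h) $$ (j, i) = (induced_mat g * induced_mat h) $$ (j, i)"
      using ij g h r_carrier by (simp add: induced_mat_def m_assoc)
  qed (auto simp: induced_mat_def)
next
  show "induced_mat \<one> = 1\<^sub>m N"
    by (rule eq_matI) (auto simp: induced_mat_def lam0_def transversal_unique r_carrier lam_one
        subgroup.one_closed[OF subgroup_A])
qed simp

lemma bij_betw_transversal: "bij_betw (\<lambda>(a, i). a \<otimes> r i) (A \<times> {..<N}) (carrier G)"
proof (rule bij_betwI')
  fix p q assume p: "p \<in> A \<times> {..<N}" and q: "q \<in> A \<times> {..<N}"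
  obtain a i b j where pq: "p = (a, i)" "q = (b, j)" by fastforce
  have c: "a \<in> A" "b \<in> A" "a \<in> carrier G" "b \<in> carrier G" "r i \<in> carrier G" "r j \<in> carrier G" "i < N" "j < N"
    using p q pq A_carrier r_carrier by auto
  show "((case p of (a, i) \<Rightarrow> a \<otimes> r i) = (case q of (a, i) \<Rightarrow> a \<otimes> r i)) = (p = q)"
  proof
    assume "(case p of (a, i) \<Rightarrow> a \<otimes> r i) = (case q of (a, i) \<Rightarrow> a \<otimes> r i)"
    then have eq: "a \<otimes> r i = b \<otimes> r j" by (simp add: pq)
    have "a \<otimes> r i \<otimes> inv (r i) \<in> A" using c by (simp add: m_assoc)
    moreover have "a \<otimes> r i \<otimes> inv (r j) \<in> A" using c unfolding eq by (simp add: m_assoc)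
    ultimately have "i = j" using transversal[of "a \<otimes> r i"] c by blast
    with eq c show "p = q" by (simp add: pq)
  qed simp
next
  fix p assume "p \<in> A \<times> {..<N}" then show "(case p of (a, i) \<Rightarrow> a \<otimes> r i) \<in> carrier G"
    using A_carrier r_carrier by auto
next
  fix g assume g: "g \<in> carrier G"
  obtain i where i: "i < N" "g \<otimes> inv (r i) \<in> A" using transversal[OF g] by blast
  then have "g = (case (g \<otimes> inv (r i), i) of (a, i) \<Rightarrow> a \<otimes> r i)"
    using g r_carrier by (simp add: m_assoc)
  with i show "\<exists>p\<in>A \<times> {..<N}. g = (case p of (a, i) \<Rightarrow> a \<otimes> r i)" by blast
qed

text \<open>Writing \<open>x = a r_i\<close> with \<open>a\<close> in \<open>A\<close>, the summand
  is independent of \<open>a\<close>, since \<open>lam a * lam (inv a) = 1\<close>. The sum over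
  \<open>A\<close> then cancels the division by \<open>card A\<close>.\<close>

lemma induced_character_eq_trace:
  assumes g: "g \<in> carrier G"
  shows "induced_character G A lam g = mat_trace (induced_mat g)"
proof -
  have finA: "finite A" using finite_carrier subgroup.subset[OF subgroup_A] finite_subset by blast
  then have cA: "card A \<noteq> 0" using subgroup.one_closed[OF subgroup_A] by auto
  have F: "lam0 (a \<otimes> r i \<otimes> g \<otimes> inv (a \<otimes> r i)) = lam0 (r i \<otimes> g \<otimes> inv (r i))"
    if a: "a \<in> A" and i: "i < N" for a i
  proof -
    have c: "a \<in> carrier G" "r i \<in> carrier G" "inv a \<in> A"
      using a i A_carrier r_carrier subgroup.m_inv_closed[OF subgroup_A] by auto
    have "lam0 (a \<otimes> r i \<otimes> g \<otimes> inv (a \<otimes> r i)) = lam0 (a \<otimes> ((r i \<otimes> g \<otimes> inv (r i)) \<otimes> inv a))"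
      using c g by (simp add: m_assoc inv_mult_group)
    also have "\<dots> = lam0 (r i \<otimes> g \<otimes> inv (r i)) * (lam a * lam (inv a))"
      using a c g by (simp add: lam0_mult)
    also have "lam a * lam (inv a) = 1" using a c lam_mult[of a "inv a"] lam_one by simp
    finally show ?thesis by simp
  qed
  have "induced_character G A lam g = (\<Sum>x\<in>carrier G. lam0 (x \<otimes> g \<otimes> inv x)) / card A"
    by (simp add: induced_character_def lam0_def)
  also have "(\<Sum>x\<in>carrier G. lam0 (x \<otimes> g \<otimes> inv x)) =
      (\<Sum>(a, i)\<in>A \<times> {..<N}. lam0 (a \<otimes> r i \<otimes> g \<otimes> inv (a \<otimes> r i)))"
    by (subst sum.reindex_bij_betw[OF bij_betw_transversal, symmetric]) (simp add: case_prod_beta)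
  also have "\<dots> = (\<Sum>(a, i)\<in>A \<times> {..<N}. lam0 (r i \<otimes> g \<otimes> inv (r i)))"
    by (rule sum.cong) (auto simp: F)
  also have "\<dots> = (\<Sum>a\<in>A. \<Sum>i<N. lam0 (r i \<otimes> g \<otimes> inv (r i)))"
    by (simp only: sum.cartesian_product)
  also have "\<dots> / card A = mat_trace (induced_mat g)"
    using cA by (simp add: mat_trace_def induced_mat_def)
  finally show ?thesis .
qed

text \<open>Frobenius reciprocity made explicit: for a weight vector \<open>v\<close> this is the
  matrix of the homomorphism from the induced representation to \<open>\<rho>\<close> that
  \<open>v\<close> determines.\<close>

definition orbit_mat :: "nat \<Rightarrow> ('a \<Rightarrow> complex mat) \<Rightarrow> complex vec \<Rightarrow> complex mat" where
  "orbit_mat d \<rho> v = mat d N (\<lambda>(k, i). (\<rho> (inv (r i)) *\<^sub>v v) $ k)"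

definition weight_vector :: "nat \<Rightarrow> ('a \<Rightarrow> complex mat) \<Rightarrow> complex vec \<Rightarrow> bool" where
  "weight_vector d \<rho> v \<longleftrightarrow> v \<in> carrier_vec d \<and> (\<forall>a\<in>A. \<rho> a *\<^sub>v v = lam a \<cdot>\<^sub>v v)"

lemma orbit_mat_carrier [simp]: "orbit_mat d \<rho> v \<in> carrier_mat d N"
  by (simp add: orbit_mat_def)

lemma dim_orbit_mat [simp]: "dim_row (orbit_mat d \<rho> v) = d" "dim_col (orbit_mat d \<rho> v) = N"
  by (simp_all add: orbit_mat_def)

lemma dim_induced_mat [simp]: "dim_row (induced_mat g) = N" "dim_col (induced_mat g) = N"
  by (simp_all add: induced_mat_def)

text \<open>The transversal property singles out one nonzero entry in each row of an induced matrix;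
  passing to inverses transfers this to the columns.\<close>

lemma ex_column_index:
  assumes g: "g \<in> carrier G" and i: "i < N"
  obtains j where "j < N" "\<And>k. k < N \<Longrightarrow> r k \<otimes> g \<otimes> inv (r i) \<in> A \<longleftrightarrow> k = j"
proof -
  have *: "r i \<otimes> inv g \<otimes> inv (r k) \<in> A \<longleftrightarrow> r k \<otimes> g \<otimes> inv (r i) \<in> A" if "k < N" for k
  proof -
    have c: "r i \<in> carrier G" "r k \<in> carrier G" using that i r_carrier by auto
    have "inv (r i \<otimes> inv g \<otimes> inv (r k)) = r k \<otimes> g \<otimes> inv (r i)"
      "inv (r k \<otimes> g \<otimes> inv (r i)) = r i \<otimes> inv g \<otimes> inv (r k)"
      using c g by (simp_all add: inv_mult_group m_assoc)
    then show ?thesis using subgroup.m_inv_closed[OF subgroup_A] by metis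
  qed
  have "r i \<otimes> inv g \<in> carrier G" using i g r_carrier by simp
  then obtain j where j: "j < N" "r i \<otimes> inv g \<otimes> inv (r j) \<in> A"
    "\<And>k. k < N \<Longrightarrow> r i \<otimes> inv g \<otimes> inv (r k) \<in> A \<Longrightarrow> k = j"
    using transversal by blast
  show ?thesis by (rule that[OF j(1)]) (use j * in blast)
qed

context
  fixes d :: nat and \<rho> :: "'a \<Rightarrow> complex mat"
  assumes irr: "irreducible_representation G d \<rho>"
begin

lemmas rho = irreducible_representationD[OF irr]

lemma rho_vec:
  assumes "g \<in> carrier G" "h \<in> carrier G" "v \<in> carrier_vec d"
  shows "\<rho> (g \<otimes> h) *\<^sub>v v = \<rho> g *\<^sub>v (\<rho> h *\<^sub>v v)"
  using assms rho by (simp add: assoc_mult_mat_vec[of _ d d _ d])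

lemma rho_inv_vec:
  assumes "g \<in> carrier G" "v \<in> carrier_vec d"
  shows "\<rho> (inv g) *\<^sub>v (\<rho> g *\<^sub>v v) = v"
  using assms rho_vec[of "inv g" g v] rho(3) by simp

text \<open>Column \<open>i\<close> is \<open>inv (r i)\<close> applied to \<open>v\<close>. Since
  \<open>g inv (r i) = inv (r j) a\<close> with \<open>a\<close> in \<open>A\<close>, and
  \<open>a\<close> acts on \<open>v\<close> by a scalar, \<open>g\<close> sends it to a multiple of
  column \<open>j\<close>.\<close>

lemma orbit_mat_intertwines:
  assumes v: "weight_vector d \<rho> v" and g: "g \<in> carrier G"
  shows "\<rho> g * orbit_mat d \<rho> v = orbit_mat d \<rho> v * induced_mat g"
proof (rule eq_matI)
  fix k i assume "k < dim_row (orbit_mat d \<rho> v * induced_mat g)"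
    "i < dim_col (orbit_mat d \<rho> v * induced_mat g)"
  then have k: "k < d" and i: "i < N" by (auto simp: orbit_mat_def induced_mat_def)
  have vc: "v \<in> carrier_vec d" using v by (simp add: weight_vector_def)
  obtain j where j: "j < N" and ju: "\<And>l. l < N \<Longrightarrow> r l \<otimes> g \<otimes> inv (r i) \<in> A \<longleftrightarrow> l = j"
    using ex_column_index[OF g i] by metis
  define a where "a = r j \<otimes> g \<otimes> inv (r i)"
  have a: "a \<in> A" using ju[OF j] by (simp add: a_def)
  have c: "r i \<in> carrier G" "r j \<in> carrier G" "a \<in> carrier G"
    using i j r_carrier a A_carrier by auto
  have colP: "col (orbit_mat d \<rho> v) i = \<rho> (inv (r i)) *\<^sub>v v"
    using i c rho(1)[of "inv (r i)"] vc by (intro eq_vecI) (auto simp: orbit_mat_def)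
  have "(\<rho> g * orbit_mat d \<rho> v) $$ (k, i) = (\<rho> g *\<^sub>v (\<rho> (inv (r i)) *\<^sub>v v)) $ k"
    using k i rho(1)[OF g] by (simp add: colP)
  also have "\<rho> g *\<^sub>v (\<rho> (inv (r i)) *\<^sub>v v) = \<rho> (g \<otimes> inv (r i)) *\<^sub>v v"
    using c g vc by (simp add: rho_vec)
  also have "g \<otimes> inv (r i) = inv (r j) \<otimes> a"
    using c g by (simp add: a_def m_assoc inv_mult_cancel)
  also have "\<rho> \<dots> *\<^sub>v v = \<rho> (inv (r j)) *\<^sub>v (lam a \<cdot>\<^sub>v v)"
    using c vc v a by (simp add: rho_vec weight_vector_def)
  also have "\<dots> = lam a \<cdot>\<^sub>v (\<rho> (inv (r j)) *\<^sub>v v)"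
    by (rule mult_mat_vec[of _ d d]) (use c rho vc in auto)
  also have "\<dots> $ k = lam a * orbit_mat d \<rho> v $$ (k, j)"
    using k j c rho(1)[of "inv (r j)"] by (simp add: orbit_mat_def)
  also have "\<dots> = (\<Sum>l<N. if l = j then orbit_mat d \<rho> v $$ (k, j) * lam a else 0)"
    using j by simp
  also have "\<dots> = (\<Sum>l<N. orbit_mat d \<rho> v $$ (k, l) * induced_mat g $$ (l, i))"
    by (rule sum.cong) (use i ju in \<open>auto simp: induced_mat_def lam0_def a_def\<close>)
  also have "\<dots> = (orbit_mat d \<rho> v * induced_mat g) $$ (k, i)"
    using k i carrier_matD[OF orbit_mat_carrier[of d \<rho> v]] carrier_matD[OF induced_mat_carrier[of g]]
    by (simp add: scalar_prod_def atLeast0LessThan)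
  finally show "(\<rho> g * orbit_mat d \<rho> v) $$ (k, i) = (orbit_mat d \<rho> v * induced_mat g) $$ (k, i)" .
qed (use rho g in \<open>auto simp: orbit_mat_def induced_mat_def\<close>)

text \<open>The column space is invariant by the intertwining relation, and nonzero because each
  column is an invertible image of \<open>v\<close>. Irreducibility makes it the whole
  space.\<close>

lemma orbit_mat_right_inverse:
  assumes v: "weight_vector d \<rho> v" and v0: "v \<noteq> 0\<^sub>v d"
  obtains Q where "Q \<in> carrier_mat N d" "orbit_mat d \<rho> v * Q = 1\<^sub>m d"
proof -
  let ?P = "orbit_mat d \<rho> v"
  define W where "W = {?P *\<^sub>v c | c. c \<in> carrier_vec N}"
  have vc: "v \<in> carrier_vec d" using v by (simp add: weight_vector_def)
  have P: "?P \<in> carrier_mat d N" by simp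
  have "VectorSpace.subspace class_ring W (module_vec TYPE(complex) d)"
    unfolding subspace_module_vec_iff
  proof (intro conjI ballI allI)
    show "W \<subseteq> carrier_vec d" using mult_mat_vec_carrier[OF P] by (auto simp: W_def)
    have "?P *\<^sub>v 0\<^sub>v N = 0\<^sub>v d" using P by (intro eq_vecI) auto
    then show "0\<^sub>v d \<in> W" unfolding W_def by (metis (mono_tags, lifting) CollectI zero_carrier_vec)
  next
    fix x y assume "x \<in> W" "y \<in> W"
    then obtain a b where "x = ?P *\<^sub>v a" "y = ?P *\<^sub>v b" "a \<in> carrier_vec N" "b \<in> carrier_vec N"
      by (auto simp: W_def)
    then show "x + y \<in> W" unfolding W_def
      by (auto intro!: exI[of _ "a + b"] simp: mult_add_distrib_mat_vec[OF P])
  next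
    fix x and c :: complex assume "x \<in> W"
    then obtain a where "x = ?P *\<^sub>v a" "a \<in> carrier_vec N" by (auto simp: W_def)
    then show "c \<cdot>\<^sub>v x \<in> W" unfolding W_def
      by (auto intro!: exI[of _ "c \<cdot>\<^sub>v a"] simp: mult_mat_vec[OF P])
  qed
  moreover have "\<rho> g *\<^sub>v w \<in> W" if g: "g \<in> carrier G" and w: "w \<in> W" for g w
  proof -
    obtain a where a: "w = ?P *\<^sub>v a" "a \<in> carrier_vec N" using w by (auto simp: W_def)
    have "\<rho> g *\<^sub>v w = (\<rho> g * ?P) *\<^sub>v a" 
      using a assoc_mult_mat_vec[OF rho(1)[OF g] P] by simp
    also have "\<dots> = ?P *\<^sub>v (induced_mat g *\<^sub>v a)"
      unfolding orbit_mat_intertwines[OF v g]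
      using a assoc_mult_mat_vec[OF P induced_mat_carrier] by simp
    finally show ?thesis
      unfolding W_def using a mult_mat_vec_carrier[OF induced_mat_carrier] by blast
  qed
  moreover have "W \<noteq> {0\<^sub>v d}"
  proof
    assume W: "W = {0\<^sub>v d}"
    obtain i where i: "i < N" using transversal[OF one_closed] by blast
    have "?P *\<^sub>v unit_vec N i = \<rho> (inv (r i)) *\<^sub>v v"
      using i r_carrier[OF i] rho(1)[of "inv (r i)"] vc
      by (intro eq_vecI) (auto simp: orbit_mat_def)
    moreover have "?P *\<^sub>v unit_vec N i \<in> W" unfolding W_def by auto
    ultimately have "\<rho> (inv (r i)) *\<^sub>v v = 0\<^sub>v d" using W by simp
    then have "\<rho> (inv (inv (r i))) *\<^sub>v 0\<^sub>v d = v"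
      using rho_inv_vec[of "inv (r i)" v] r_carrier[OF i] vc by simp
    moreover have "\<rho> (inv (inv (r i))) *\<^sub>v 0\<^sub>v d = 0\<^sub>v d"
      using rho(1)[of "inv (inv (r i))"] r_carrier[OF i] by (intro eq_vecI) auto
    ultimately show False using v0 by simp
  qed
  ultimately have W: "W = carrier_vec d"
    using irr unfolding irreducible_representation_def by blast
  have "\<exists>c\<in>carrier_vec N. ?P *\<^sub>v c = w" if "w \<in> carrier_vec d" for w
  proof -
    have "w \<in> W" using W that by simp
    then show ?thesis by (auto simp: W_def)
  qed
  then show ?thesis using surj_mult_mat_vec_right_inverse[OF P] that by blast
qed

lemma weight_vector_dim_le:
  assumes "weight_vector d \<rho> v" "v \<noteq> 0\<^sub>v d"
  shows "d \<le> N"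
  using orbit_mat_right_inverse[OF assms] right_inverse_imp_dim_le[OF orbit_mat_carrier] by metis

text \<open>In degree \<open>N\<close> the orbit matrix is square, hence invertible, and conjugates
  \<open>induced_mat\<close> into \<open>\<rho>\<close>.\<close>

lemma character_eq_induced:
  assumes v: "weight_vector d \<rho> v" "v \<noteq> 0\<^sub>v d" and d: "d = N" and g: "g \<in> carrier G"
  shows "mat_trace (\<rho> g) = induced_character G A lam g"
proof -
  let ?P = "orbit_mat d \<rho> v"
  obtain Q where Q: "Q \<in> carrier_mat N d" "?P * Q = 1\<^sub>m d" using orbit_mat_right_inverse[OF v] .
  have P: "?P \<in> carrier_mat d N" by simp
  have QP: "Q * ?P = 1\<^sub>m N" using Q P d by (metis mat_mult_left_right_inverse)
  have rg: "\<rho> g \<in> carrier_mat d d" using rho g by auto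
  have "\<rho> g = \<rho> g * (?P * Q)" using Q rg by simp
  also have "\<dots> = (\<rho> g * ?P) * Q" using assoc_mult_mat[OF rg P Q(1)] by simp
  also have "\<dots> = ?P * induced_mat g * Q" by (simp add: orbit_mat_intertwines[OF v(1) g])
  also have "mat_trace \<dots> = mat_trace (Q * (?P * induced_mat g))"
    by (rule mat_trace_mult_commute[OF _ Q(1)]) (use mult_carrier_mat[OF P induced_mat_carrier] in auto)
  also have "Q * (?P * induced_mat g) = induced_mat g"
    using assoc_mult_mat[OF Q(1) P induced_mat_carrier[of g]] QP
      left_mult_one_mat[OF induced_mat_carrier[of g]] by metis
  finally show ?thesis using induced_character_eq_trace[OF g] by simp
qed

text \<open>Schur's argument: an eigenvector, for \<open>\<mu>\<close>, of the transition matrix between the bases of translates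
  of \<open>v\<close> and \<open>w\<close> is a linear dependence between the translates of \<open>w - \<mu> v\<close>.\<close>

lemma weight_vector_unique:
  assumes v: "weight_vector d \<rho> v" "v \<noteq> 0\<^sub>v d" and d: "d = N" and w: "weight_vector d \<rho> w"
  obtains \<mu> where "w = \<mu> \<cdot>\<^sub>v v"
proof -
  let ?P = "orbit_mat d \<rho> v" and ?R = "orbit_mat d \<rho> w"
  obtain Q where Q: "Q \<in> carrier_mat N d" "?P * Q = 1\<^sub>m d" using orbit_mat_right_inverse[OF v] .
  have P: "?P \<in> carrier_mat d N" and R: "?R \<in> carrier_mat d N" by simp_all
  have vc: "v \<in> carrier_vec d" "w \<in> carrier_vec d" using v w by (auto simp: weight_vector_def)
  define E where "E = Q * ?R"
  have E: "E \<in> carrier_mat N N" using mult_carrier_mat[OF Q(1) R] by (simp add: E_def)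
  have PE: "?P * E = ?R" unfolding E_def using assoc_mult_mat[OF P Q(1) R] Q(2) R by simp
  have "spectrum E \<noteq> {}" using spectrum_non_empty[OF E] d rho(4) by simp
  then obtain \<mu> c where c: "c \<in> carrier_vec N" "c \<noteq> 0\<^sub>v N" "E *\<^sub>v c = \<mu> \<cdot>\<^sub>v c"
    using E by (auto simp: spectrum_def eigenvalue_def eigenvector_def)
  define u where "u = w - \<mu> \<cdot>\<^sub>v v"
  have uc: "u \<in> carrier_vec d" using vc by (simp add: u_def)
  have sub: "M *\<^sub>v u = M *\<^sub>v w - \<mu> \<cdot>\<^sub>v (M *\<^sub>v v)" if M: "M \<in> carrier_mat d d" for M
    using M vc by (simp add: u_def mult_minus_distrib_mat_vec[OF M] mult_mat_vec[OF M])
  have u: "weight_vector d \<rho> u"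
    unfolding weight_vector_def
  proof (intro conjI ballI uc)
    fix a assume a: "a \<in> A"
    have "\<rho> a *\<^sub>v u = lam a \<cdot>\<^sub>v w - \<mu> \<cdot>\<^sub>v (lam a \<cdot>\<^sub>v v)"
      using sub[OF rho(1)[OF A_carrier[OF a]]] v w a by (simp add: weight_vector_def)
    also have "\<dots> = lam a \<cdot>\<^sub>v u"
      using vc by (intro eq_vecI) (auto simp: u_def algebra_simps)
    finally show "\<rho> a *\<^sub>v u = lam a \<cdot>\<^sub>v u" .
  qed
  have "orbit_mat d \<rho> u = ?R - \<mu> \<cdot>\<^sub>m ?P"
  proof (rule eq_matI)
    fix k i assume "k < dim_row (?R - \<mu> \<cdot>\<^sub>m ?P)" "i < dim_col (?R - \<mu> \<cdot>\<^sub>m ?P)"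
    then have ki: "k < d" "i < N" by (auto simp: orbit_mat_def)
    have ri: "\<rho> (inv (r i)) \<in> carrier_mat d d" using rho r_carrier ki by auto
    show "orbit_mat d \<rho> u $$ (k, i) = (?R - \<mu> \<cdot>\<^sub>m ?P) $$ (k, i)"
      using ki sub[OF ri] ri by (simp add: orbit_mat_def)
  qed (auto simp: orbit_mat_def)
  moreover have smult_P: "(\<mu> \<cdot>\<^sub>m ?P) *\<^sub>v c = \<mu> \<cdot>\<^sub>v (?P *\<^sub>v c)"
    using c by (intro eq_vecI) (auto simp: scalar_prod_def sum_distrib_left algebra_simps)
  ultimately have "orbit_mat d \<rho> u *\<^sub>v c = ?R *\<^sub>v c - \<mu> \<cdot>\<^sub>v (?P *\<^sub>v c)"
    using minus_mult_distrib_mat_vec[OF R smult_carrier_mat[OF P] c(1)] smult_P by simp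
  also have "?R *\<^sub>v c = \<mu> \<cdot>\<^sub>v (?P *\<^sub>v c)"
    using PE assoc_mult_mat_vec[OF P E c(1)] c mult_mat_vec[OF P c(1)] by simp
  also have "\<dots> - \<mu> \<cdot>\<^sub>v (?P *\<^sub>v c) = 0\<^sub>v d" using P by (intro eq_vecI) auto
  finally have uz: "orbit_mat d \<rho> u *\<^sub>v c = 0\<^sub>v d" .
  have "u = 0\<^sub>v d"
  proof (rule ccontr)
    assume "u \<noteq> 0\<^sub>v d"
    from orbit_mat_right_inverse[OF u this] obtain Q' where
      Q': "Q' \<in> carrier_mat N d" "orbit_mat d \<rho> u * Q' = 1\<^sub>m d" .
    have Pu: "orbit_mat d \<rho> u \<in> carrier_mat d N" by simp
    have "Q' * orbit_mat d \<rho> u = 1\<^sub>m N" using Q' Pu d by (metis mat_mult_left_right_inverse)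
    then have "c = Q' *\<^sub>v (orbit_mat d \<rho> u *\<^sub>v c)"
      using assoc_mult_mat_vec[OF Q'(1) Pu c(1)] c by simp
    also have "\<dots> = 0\<^sub>v N" unfolding uz using Q' by (intro eq_vecI) auto
    finally show False using c by simp
  qed
  then have "w = \<mu> \<cdot>\<^sub>v v"
    using vc by (auto simp: u_def vec_eq_iff)
  then show ?thesis by (rule that)
qed

text \<open>The line of \<open>v\<close> occurs as the column of \<open>orbit_mat\<close> belonging
  to the coset of the identity and, if \<open>h\<close> preserves that line, also as the one
  belonging to the coset of \<open>inv h\<close>. In degree \<open>N\<close> the columns are
  independent, so the two cosets coincide.\<close>

lemma weight_vector_not_stabilized:
  assumes v: "weight_vector d \<rho> v" "v \<noteq> 0\<^sub>v d" and d: "d = N"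
    and h: "h \<in> carrier G" "\<rho> h *\<^sub>v v = \<mu> \<cdot>\<^sub>v v"
  shows "h \<in> A"
proof (rule ccontr)
  assume hA: "h \<notin> A"
  let ?P = "orbit_mat d \<rho> v"
  obtain Q where Q: "Q \<in> carrier_mat N d" "?P * Q = 1\<^sub>m d" using orbit_mat_right_inverse[OF v] .
  have P: "?P \<in> carrier_mat d N" by simp
  have QP: "Q * ?P = 1\<^sub>m N" using Q P d by (metis mat_mult_left_right_inverse)
  have vc: "v \<in> carrier_vec d" using v by (auto simp: weight_vector_def)
  obtain i where i: "i < N" "\<one> \<otimes> inv (r i) \<in> A" using transversal[OF one_closed] by blast
  obtain j where j: "j < N" "inv h \<otimes> inv (r j) \<in> A" using transversal[of "inv h"] h by blast
  define a b where "a = inv (r i)" and "b = inv h \<otimes> inv (r j)"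
  have c: "r i \<in> carrier G" "r j \<in> carrier G" using i j r_carrier by auto
  have ab: "a \<in> A" "b \<in> A" "a \<in> carrier G" "b \<in> carrier G"
    using i j c h by (auto simp: a_def b_def)
  have "lam a * lam (inv a) = 1"
    using lam_mult[of a "inv a"] lam_one subgroup.m_inv_closed[OF subgroup_A] ab by simp
  then have a0: "lam a \<noteq> 0" by auto
  have "i \<noteq> j"
  proof
    assume "i = j"
    then have "inv b = inv a \<otimes> h" using c h by (simp add: a_def b_def inv_mult_group)
    then have "inv a \<otimes> h \<in> A" using subgroup.m_inv_closed[OF subgroup_A ab(2)] by simp
    then show False using hA A_mult_iff(1)[of "inv a" h] ab h subgroup.m_inv_closed[OF subgroup_A] by auto
  qed
  have colP: "?P *\<^sub>v unit_vec N k = \<rho> (inv (r k)) *\<^sub>v v" if "k < N" for k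
    using that r_carrier[OF that] rho(1)[of "inv (r k)"] vc
    by (intro eq_vecI) (auto simp: orbit_mat_def)
  have Pi: "?P *\<^sub>v unit_vec N i = lam a \<cdot>\<^sub>v v"
    using colP[OF i(1)] v ab by (simp add: a_def weight_vector_def)
  have "inv (r j) = h \<otimes> b" using c h by (simp add: b_def inv_mult_cancel)
  then have "?P *\<^sub>v unit_vec N j = \<rho> h *\<^sub>v (\<rho> b *\<^sub>v v)"
    using colP[OF j(1)] rho_vec h ab vc by simp
  also have "\<dots> = lam b \<cdot>\<^sub>v (\<mu> \<cdot>\<^sub>v v)"
    using v ab h mult_mat_vec[OF rho(1)[OF h(1)] vc] by (simp add: weight_vector_def)
  finally have Pj: "?P *\<^sub>v unit_vec N j = (lam b * \<mu>) \<cdot>\<^sub>v v" by (simp add: smult_smult_assoc)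
  have "lam a \<cdot>\<^sub>v (?P *\<^sub>v unit_vec N j) = (lam b * \<mu>) \<cdot>\<^sub>v (?P *\<^sub>v unit_vec N i)"
    by (simp add: Pi Pj smult_smult_assoc mult_ac)
  then have "?P *\<^sub>v (lam a \<cdot>\<^sub>v unit_vec N j) = ?P *\<^sub>v ((lam b * \<mu>) \<cdot>\<^sub>v unit_vec N i)"
    by (simp add: mult_mat_vec[OF P])
  then have "Q *\<^sub>v (?P *\<^sub>v (lam a \<cdot>\<^sub>v unit_vec N j)) = Q *\<^sub>v (?P *\<^sub>v ((lam b * \<mu>) \<cdot>\<^sub>v unit_vec N i))"
    by simp
  then have "lam a \<cdot>\<^sub>v unit_vec N j = (lam b * \<mu>) \<cdot>\<^sub>v unit_vec N i"
    by (simp add: assoc_mult_mat_vec[OF Q(1) P, symmetric] QP)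
  then have "(lam a \<cdot>\<^sub>v unit_vec N j) $ j = ((lam b * \<mu>) \<cdot>\<^sub>v unit_vec N i) $ j" by simp
  then show False using a0 \<open>i \<noteq> j\<close> j i by simp
qed

end

text \<open>A normal \<open>A\<close> acts by diagonal matrices. Its characters on the
  \<open>N\<close> coordinate lines differ pairwise, while \<open>G\<close> moves every coordinate
  line to every other.\<close>

lemma irreducible_induced_mat:
  assumes normal: "\<And>g a. g \<in> carrier G \<Longrightarrow> a \<in> A \<Longrightarrow> g \<otimes> a \<otimes> inv g \<in> A"
    and separated: "\<And>i j. i < N \<Longrightarrow> j < N \<Longrightarrow> i \<noteq> j \<Longrightarrow>
      \<exists>a\<in>A. lam (r i \<otimes> a \<otimes> inv (r i)) \<noteq> lam (r j \<otimes> a \<otimes> inv (r j))"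
  shows "irreducible_representation G N induced_mat"
  unfolding irreducible_representation_def
proof (intro conjI allI impI)
  show "representation G N induced_mat" by (rule representation_induced_mat)
  show "N \<noteq> 0" using transversal[OF one_closed] by auto
next
  fix W assume "VectorSpace.subspace class_ring W (module_vec TYPE(complex) N)"
    and inv: "\<forall>g\<in>carrier G. \<forall>w\<in>W. induced_mat g *\<^sub>v w \<in> W"
  then have W: "W \<subseteq> carrier_vec N" "0\<^sub>v N \<in> W" "\<And>v w. v \<in> W \<Longrightarrow> w \<in> W \<Longrightarrow> v + w \<in> W"
    "\<And>c v. v \<in> W \<Longrightarrow> c \<cdot>\<^sub>v v \<in> W"
    by (auto simp: subspace_module_vec_iff)
  have diag: "induced_mat a *\<^sub>v w = vec N (\<lambda>k. lam (r k \<otimes> a \<otimes> inv (r k)) * w $ k)"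
    if a: "a \<in> A" and w: "w \<in> carrier_vec N" for a w
  proof (rule eq_vecI)
    fix k assume "k < dim_vec (vec N (\<lambda>k. lam (r k \<otimes> a \<otimes> inv (r k)) * w $ k))"
    then have k: "k < N" by simp
    have *: "lam0 (r k \<otimes> a \<otimes> inv (r l)) = (if l = k then lam (r k \<otimes> a \<otimes> inv (r k)) else 0)"
      if l: "l < N" for l
    proof -
      have c: "r k \<in> carrier G" "r l \<in> carrier G" "a \<in> carrier G"
        using k l r_carrier a A_carrier by auto
      have "r k \<otimes> a \<otimes> inv (r l) = (r k \<otimes> a \<otimes> inv (r k)) \<otimes> (r k \<otimes> inv (r l))"
        using c by (simp add: m_assoc inv_mult_cancel)
      then have "r k \<otimes> a \<otimes> inv (r l) \<in> A \<longleftrightarrow> l = k"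
        using A_mult_iff(1)[OF normal[OF c(1) a]] c transversal_unique[OF l k] by simp
      then show ?thesis by (auto simp: lam0_def)
    qed
    have "(induced_mat a *\<^sub>v w) $ k = (\<Sum>l<N. lam0 (r k \<otimes> a \<otimes> inv (r l)) * w $ l)"
      using k w by (simp add: induced_mat_def scalar_prod_def atLeast0LessThan)
    also have "\<dots> = (\<Sum>l<N. if l = k then lam (r k \<otimes> a \<otimes> inv (r k)) * w $ k else 0)"
      by (rule sum.cong) (auto simp: *)
    finally show "(induced_mat a *\<^sub>v w) $ k = vec N (\<lambda>k. lam (r k \<otimes> a \<otimes> inv (r k)) * w $ k) $ k"
      using k by simp
  qed (simp add: induced_mat_def)
  show "W = {0\<^sub>v N} \<or> W = carrier_vec N"
  proof (rule disjCI)
    assume "W \<noteq> carrier_vec N"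
    show "W = {0\<^sub>v N}"
    proof (rule ccontr)
      assume "W \<noteq> {0\<^sub>v N}"
      \<comment> \<open>A vector of minimal support in \<open>W\<close> is a multiple of a unit vector.\<close>
      define S where "S w = {k. k < N \<and> w $ k \<noteq> 0}" for w :: "complex vec"
      have finS: "finite (S w)" for w by (simp add: S_def)
      obtain w0 where "w0 \<in> W \<and> w0 \<noteq> 0\<^sub>v N" using W(2) \<open>W \<noteq> {0\<^sub>v N}\<close> by auto
      from ex_has_least_nat[of "\<lambda>w. w \<in> W \<and> w \<noteq> 0\<^sub>v N", OF this, of "card \<circ> S"]
      obtain w where w: "w \<in> W" "w \<noteq> 0\<^sub>v N"
        and least: "\<And>u. u \<in> W \<Longrightarrow> u \<noteq> 0\<^sub>v N \<Longrightarrow> card (S w) \<le> card (S u)"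
        by auto
      have wc: "w \<in> carrier_vec N" using w W(1) by auto
      obtain i where i: "i < N" "w $ i \<noteq> 0"
        using w(2) wc by (metis carrier_vecD eq_vecI index_zero_vec(1) index_zero_vec(2))
      have single: "w $ j = 0" if j: "j < N" "j \<noteq> i" for j
      proof (rule ccontr)
        assume wj: "w $ j \<noteq> 0"
        obtain a where a: "a \<in> A" "lam (r i \<otimes> a \<otimes> inv (r i)) \<noteq> lam (r j \<otimes> a \<otimes> inv (r j))"
          using separated[OF i(1) j(1)] j(2) by auto
        define c where "c k = lam (r k \<otimes> a \<otimes> inv (r k))" for k
        \<comment> \<open>Subtracting the eigenvalue of \<open>a\<close> at \<open>i\<close> kills
          coordinate \<open>i\<close>, scales the others and keeps coordinate \<open>j\<close>
          nonzero, so the support shrinks.\<close>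
        define u where "u = induced_mat a *\<^sub>v w + (- c i) \<cdot>\<^sub>v w"
        have "u \<in> W" unfolding u_def using inv w A_carrier[OF a(1)] W by blast
        have u: "u $ k = (c k - c i) * w $ k" if "k < N" for k
          using that wc by (simp add: u_def diag[OF a(1) wc] c_def algebra_simps)
        have "u $ j \<noteq> 0" using u[OF j(1)] wj a(2) by (simp add: c_def)
        then have "u \<noteq> 0\<^sub>v N" using j by auto
        have "k \<in> S w" if "k \<in> S u" for k using that u[of k] by (simp add: S_def)
        moreover have "i \<in> S w" "i \<notin> S u" using i u[OF i(1)] by (simp_all add: S_def)
        ultimately have "S u \<subset> S w" by blast
        then have "card (S u) < card (S w)" using finS by (simp add: psubset_card_mono)
        then show False using least[OF \<open>u \<in> W\<close> \<open>u \<noteq> 0\<^sub>v N\<close>] by simp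
      qed
      have "(1 / w $ i) \<cdot>\<^sub>v w = unit_vec N i"
        using wc i single by (intro eq_vecI) (auto simp: unit_vec_def)
      then have ei: "unit_vec N i \<in> W" using W(4)[OF w(1)] by metis
      have ej: "unit_vec N j \<in> W" if j: "j < N" for j
      proof -
        have c: "r i \<in> carrier G" "r j \<in> carrier G" using i j r_carrier by auto
        have "induced_mat (inv (r j) \<otimes> r i) *\<^sub>v unit_vec N i = unit_vec N j"
        proof (rule eq_vecI)
          fix k assume "k < dim_vec (unit_vec N j)"
          then have k: "k < N" by simp
          have "r k \<otimes> (inv (r j) \<otimes> r i) \<otimes> inv (r i) = r k \<otimes> inv (r j)"
            using c r_carrier[OF k] by (simp add: m_assoc)
          moreover have "lam0 (r k \<otimes> inv (r j)) = (if k = j then 1 else 0)"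
            using k j c by (auto simp: lam0_def transversal_unique lam_one subgroup.one_closed[OF subgroup_A])
          ultimately show "(induced_mat (inv (r j) \<otimes> r i) *\<^sub>v unit_vec N i) $ k = unit_vec N j $ k"
            using k i j by (simp add: induced_mat_def)
        qed (simp add: induced_mat_def)
        then show ?thesis using inv ei c by (metis inv_closed m_closed)
      qed
      have "x \<in> W" if x: "x \<in> carrier_vec N" for x
      proof -
        have "m \<le> N \<Longrightarrow> vec N (\<lambda>k. if k < m then x $ k else 0) \<in> W" for m
        proof (induction m)
          case 0
          have "vec N (\<lambda>k. if k < 0 then x $ k else 0) = 0\<^sub>v N" by (intro eq_vecI) auto
          then show ?case using W(2) by simp
        next
          case (Suc m)
          have "vec N (\<lambda>k. if k < Suc m then x $ k else 0) =
              vec N (\<lambda>k. if k < m then x $ k else 0) + x $ m \<cdot>\<^sub>v unit_vec N m"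
            using Suc.prems by (intro eq_vecI) (auto simp: less_Suc_eq)
          then show ?case using Suc W(3,4) ej[of m] by simp
        qed
        from this[of N] have "vec N (\<lambda>k. if k < N then x $ k else 0) \<in> W" by simp
        also have "vec N (\<lambda>k. if k < N then x $ k else 0) = x" using x by (intro eq_vecI) auto
        finally show ?thesis .
      qed
      with W(1) have "W = carrier_vec N" by auto
      with \<open>W \<noteq> carrier_vec N\<close> show False by simp
    qed
  qed
qed

end

section \<open>Products of induced characters\<close>

context group
begin

lemma inv_mult_mem_subgroup_iff:
  assumes "subgroup H G" "x \<in> carrier G" "y \<in> carrier G"
  shows "x \<otimes> inv y \<in> H \<longleftrightarrow> y \<otimes> inv x \<in> H"
proof -
  have "inv (x \<otimes> inv y) = y \<otimes> inv x" "inv (y \<otimes> inv x) = x \<otimes> inv y"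
    using assms by (simp_all add: inv_mult_group)
  then show ?thesis using subgroup.m_inv_closed[OF assms(1)] by metis
qed

lemma card_right_translate:
  assumes H: "subgroup H G" and y: "y \<in> carrier G"
  shows "card {z \<in> carrier G. z \<otimes> inv y \<in> H} = card H"
proof -
  have "bij_betw (\<lambda>h. h \<otimes> y) H {z \<in> carrier G. z \<otimes> inv y \<in> H}"
  proof (rule bij_betw_byWitness[where f' = "\<lambda>z. z \<otimes> inv y"])
    show "\<forall>h\<in>H. h \<otimes> y \<otimes> inv y = h"
      using subgroup.mem_carrier[OF H] y by (simp add: m_assoc)
    show "\<forall>z\<in>{z \<in> carrier G. z \<otimes> inv y \<in> H}. z \<otimes> inv y \<otimes> y = z"
      using y by (simp add: m_assoc)
    show "(\<lambda>h. h \<otimes> y) ` H \<subseteq> {z \<in> carrier G. z \<otimes> inv y \<in> H}"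
      using subgroup.mem_carrier[OF H] y by (auto simp: m_assoc)
  qed auto
  then show ?thesis by (simp add: bij_betw_same_card)
qed

text \<open>Conjugation by an element of \<open>H\<close> preserves \<open>H\<close> and every
  linear character of it. Hence a summand of the induction formula depends only on the coset
  \<open>H x\<close>.\<close>

lemma linear_character_conjugate:
  fixes lam :: "'a \<Rightarrow> complex"
  assumes H: "subgroup H G" and lam: "\<And>a b. a \<in> H \<Longrightarrow> b \<in> H \<Longrightarrow> lam (a \<otimes> b) = lam a * lam b"
    and one: "lam \<one> = 1" and x: "x \<in> carrier G" and y: "y \<in> carrier G" and g: "g \<in> carrier G"
    and yx: "y \<otimes> inv x \<in> H"
  shows "(if y \<otimes> g \<otimes> inv y \<in> H then lam (y \<otimes> g \<otimes> inv y) else 0) =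
    (if x \<otimes> g \<otimes> inv x \<in> H then lam (x \<otimes> g \<otimes> inv x) else 0)"
proof -
  define k u where "k = y \<otimes> inv x" and "u = x \<otimes> g \<otimes> inv x"
  have k: "k \<in> H" "k \<in> carrier G" "inv k \<in> H" and uc: "u \<in> carrier G"
    using yx x y g subgroup.m_inv_closed[OF H] by (auto simp: k_def u_def)
  have yg: "y \<otimes> g \<otimes> inv y = k \<otimes> u \<otimes> inv k"
    using x y g by (simp add: k_def u_def inv_mult_group m_assoc inv_mult_cancel)
  have ug: "u = inv k \<otimes> (k \<otimes> u \<otimes> inv k) \<otimes> k"
    using k uc by (simp add: m_assoc inv_mult_cancel)
  have iff: "k \<otimes> u \<otimes> inv k \<in> H \<longleftrightarrow> u \<in> H"
    using k ug subgroup.m_closed[OF H] by metis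
  have "lam (k \<otimes> u \<otimes> inv k) = lam u" if "u \<in> H"
  proof -
    have "lam (k \<otimes> u \<otimes> inv k) = lam u * (lam k * lam (inv k))"
      using that k subgroup.m_closed[OF H] by (simp add: lam)
    also have "lam k * lam (inv k) = 1" using lam[OF k(1,3)] k one by simp
    finally show ?thesis by simp
  qed
  then show ?thesis using iff by (simp add: yg u_def[symmetric])
qed

lemma subgroup_Collect_family:
  assumes "\<And>i. i \<in> I \<Longrightarrow> subgroup (K i) G"
  shows "subgroup {h \<in> carrier G. \<forall>i\<in>I. h \<in> K i} G"
proof (rule subgroupI)
  show "{h \<in> carrier G. \<forall>i\<in>I. h \<in> K i} \<noteq> {}"
    using subgroup.one_closed[OF assms] by auto
qed (use subgroup.m_closed[OF assms] subgroup.m_inv_closed[OF assms] in auto)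

text \<open>Double counting of the pairs consisting of a family \<open>x\<^sub>i\<close> and of an element \<open>y\<close> that lies in
  every coset \<open>K\<^sub>i x\<^sub>i\<close>.\<close>

lemma prod_induced_character:
  fixes lam :: "'i \<Rightarrow> 'a \<Rightarrow> complex"
  assumes fin: "finite (carrier G)" "finite I"
    and K: "\<And>i. i \<in> I \<Longrightarrow> subgroup (K i) G"
    and lam: "\<And>i a b. i \<in> I \<Longrightarrow> a \<in> K i \<Longrightarrow> b \<in> K i \<Longrightarrow> lam i (a \<otimes> b) = lam i a * lam i b"
    and one: "\<And>i. i \<in> I \<Longrightarrow> lam i \<one> = 1"
    and lift: "\<And>x. x \<in> I \<rightarrow> carrier G \<Longrightarrow> \<exists>y\<in>carrier G. \<forall>i\<in>I. y \<otimes> inv (x i) \<in> K i"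
    and g: "g \<in> carrier G"
  shows "(\<Prod>i\<in>I. induced_character G (K i) (lam i) g) =
    induced_character G {h \<in> carrier G. \<forall>i\<in>I. h \<in> K i} (\<lambda>h. \<Prod>i\<in>I. lam i h) g"
proof -
  define F where "F i x = (if x \<otimes> g \<otimes> inv x \<in> K i then lam i (x \<otimes> g \<otimes> inv x) else 0)" for i x
  define L where "L = {h \<in> carrier G. \<forall>i\<in>I. h \<in> K i}"
  define X where "X = (\<Pi>\<^sub>E i\<in>I. carrier G)"
  define R where "R x y \<longleftrightarrow> (\<forall>i\<in>I. y \<otimes> inv (x i) \<in> K i)" for x y
  have L: "subgroup L G" unfolding L_def by (rule subgroup_Collect_family) (rule K)
  have finX: "finite X" unfolding X_def using fin by (intro finite_PiE) auto
  have cardH: "card H \<noteq> 0" if "subgroup H G" for H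
    using that fin finite_subset[OF subgroup.subset[OF that] fin(1)] subgroup.one_closed[OF that] by auto
  have FR: "(\<Prod>i\<in>I. F i (x i)) = (\<Prod>i\<in>I. F i y)" if "x \<in> X" "y \<in> carrier G" "R x y" for x y
  proof (rule prod.cong)
    fix i assume i: "i \<in> I"
    then have "x i \<in> carrier G" "y \<otimes> inv (x i) \<in> K i" using that by (auto simp: X_def R_def)
    then show "F i (x i) = F i y" unfolding F_def
      using linear_character_conjugate[OF K[OF i] lam[OF i] one[OF i] _ that(2) g, of "x i"] by simp
  qed simp
  \<comment> \<open>The place where \<open>lift\<close> is used: the cosets \<open>K i x_i\<close>
    have a common element \<open>z\<close>, and their intersection is then the coset
    \<open>L z\<close>.\<close>
  have card_y: "card {y \<in> carrier G. R x y} = card L" if x: "x \<in> X" for x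
  proof -
    have xc: "x i \<in> carrier G" if "i \<in> I" for i using x that by (auto simp: X_def)
    then obtain z where z: "z \<in> carrier G" "\<And>i. i \<in> I \<Longrightarrow> z \<otimes> inv (x i) \<in> K i"
      using lift[of x] by auto
    have "y \<otimes> inv (x i) \<in> K i \<longleftrightarrow> y \<otimes> inv z \<in> K i" if i: "i \<in> I" and y: "y \<in> carrier G" for i y
    proof -
      have "y \<otimes> inv (x i) = (y \<otimes> inv z) \<otimes> (z \<otimes> inv (x i))"
        "y \<otimes> inv z = (y \<otimes> inv (x i)) \<otimes> (x i \<otimes> inv z)"
        using xc[OF i] y z(1) by (simp_all add: m_assoc inv_mult_cancel)
      moreover have "x i \<otimes> inv z \<in> K i"
        using z(2)[OF i] inv_mult_mem_subgroup_iff[OF K[OF i]] xc[OF i] z(1) by simp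
      ultimately show ?thesis using z(2)[OF i] subgroup.m_closed[OF K[OF i]] by metis
    qed
    then have "{y \<in> carrier G. R x y} = {y \<in> carrier G. y \<otimes> inv z \<in> L}"
      using z(1) by (auto simp: R_def L_def)
    then show ?thesis using card_right_translate[OF L z(1)] by simp
  qed
  have card_x: "card {x \<in> X. R x y} = (\<Prod>i\<in>I. card (K i))" if y: "y \<in> carrier G" for y
  proof -
    have "{x \<in> X. R x y} = (\<Pi>\<^sub>E i\<in>I. {z \<in> carrier G. y \<otimes> inv z \<in> K i})"
      unfolding X_def R_def by (auto simp: PiE_iff extensional_def)
    also have "card \<dots> = (\<Prod>i\<in>I. card {z \<in> carrier G. y \<otimes> inv z \<in> K i})"
      using fin by (simp add: card_PiE)
    also have "\<dots> = (\<Prod>i\<in>I. card (K i))"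
    proof (rule prod.cong)
      fix i assume i: "i \<in> I"
      have "{z \<in> carrier G. y \<otimes> inv z \<in> K i} = {z \<in> carrier G. z \<otimes> inv y \<in> K i}"
        using inv_mult_mem_subgroup_iff[OF K[OF i]] y by auto
      then show "card {z \<in> carrier G. y \<otimes> inv z \<in> K i} = card (K i)"
        using card_right_translate[OF K[OF i] y] by simp
    qed simp
    finally show ?thesis .
  qed
  have "(\<Prod>i\<in>I. \<Sum>x\<in>carrier G. F i x) * of_nat (card L) =
      (\<Sum>x\<in>X. (\<Prod>i\<in>I. F i (x i)) * of_nat (card L))"
    using fin by (simp add: prod_sum_PiE X_def sum_distrib_right)
  also have "\<dots> = (\<Sum>x\<in>X. \<Sum>y\<in>{y \<in> carrier G. R x y}. \<Prod>i\<in>I. F i y)"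
  proof (rule sum.cong)
    fix x assume x: "x \<in> X"
    have "(\<Sum>y\<in>{y \<in> carrier G. R x y}. \<Prod>i\<in>I. F i y) =
        (\<Sum>y\<in>{y \<in> carrier G. R x y}. \<Prod>i\<in>I. F i (x i))"
      by (rule sum.cong) (use FR[OF x] in auto)
    then show "(\<Prod>i\<in>I. F i (x i)) * of_nat (card L) = (\<Sum>y\<in>{y \<in> carrier G. R x y}. \<Prod>i\<in>I. F i y)"
      using card_y[OF x] by (simp add: mult.commute)
  qed simp
  also have "\<dots> = (\<Sum>y\<in>carrier G. \<Sum>x\<in>{x \<in> X. R x y}. \<Prod>i\<in>I. F i y)"
    using finX fin(1) by (rule sum.swap_restrict)
  also have "\<dots> = (\<Sum>y\<in>carrier G. (\<Prod>i\<in>I. F i y) * of_nat (\<Prod>i\<in>I. card (K i)))"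
    by (rule sum.cong) (simp_all add: card_x mult.commute)
  also have "\<dots> = (\<Sum>y\<in>carrier G. \<Prod>i\<in>I. F i y) * (\<Prod>i\<in>I. of_nat (card (K i)))"
    by (simp add: sum_distrib_right)
  also have "(\<Sum>y\<in>carrier G. \<Prod>i\<in>I. F i y) =
      (\<Sum>y\<in>carrier G. if y \<otimes> g \<otimes> inv y \<in> L then \<Prod>i\<in>I. lam i (y \<otimes> g \<otimes> inv y) else 0)"
  proof (rule sum.cong)
    fix y assume y: "y \<in> carrier G"
    show "(\<Prod>i\<in>I. F i y) = (if y \<otimes> g \<otimes> inv y \<in> L then \<Prod>i\<in>I. lam i (y \<otimes> g \<otimes> inv y) else 0)"
    proof (cases "y \<otimes> g \<otimes> inv y \<in> L")
      case True
      then show ?thesis by (auto simp: F_def L_def intro!: prod.cong)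
    next
      case False
      then obtain i where "i \<in> I" "F i y = 0" using y g by (auto simp: F_def L_def)
      then show ?thesis using False fin(2) by (auto intro: prod_zero)
    qed
  qed simp
  finally have *: "(\<Prod>i\<in>I. \<Sum>x\<in>carrier G. F i x) * of_nat (card L) =
      (\<Sum>y\<in>carrier G. if y \<otimes> g \<otimes> inv y \<in> L then \<Prod>i\<in>I. lam i (y \<otimes> g \<otimes> inv y) else 0) *
      (\<Prod>i\<in>I. of_nat (card (K i)))" .
  have "(\<Prod>i\<in>I. of_nat (card (K i)) :: complex) \<noteq> 0" using fin(2) cardH[OF K] by simp
  moreover have "of_nat (card L) \<noteq> (0 :: complex)" using cardH[OF L] by simp
  moreover have "(\<Prod>i\<in>I. induced_character G (K i) (lam i) g) =
      (\<Prod>i\<in>I. \<Sum>x\<in>carrier G. F i x) / (\<Prod>i\<in>I. of_nat (card (K i)))"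
    by (simp add: induced_character_def F_def prod_dividef)
  ultimately show ?thesis using * unfolding L_def[symmetric]
    by (simp add: induced_character_def frac_eq_eq)
qed

end

section \<open>Symmetric matrices up to unitriangular congruence\<close>

lemma unitriangular_carrier: "x \<in> unitriangular n \<Longrightarrow> x \<in> carrier_mat n n"
  by (simp add: unitriangular_def)

lemma unitriangular_iff:
  "x \<in> unitriangular n \<longleftrightarrow>
    x \<in> carrier_mat n n \<and> (\<forall>i<n. \<forall>j\<le>i. x $$ (i, j) = (if i = j then 1 else 0))"
  by (auto simp: unitriangular_def upper_triangular_def)

lemma one_unitriangular: "1\<^sub>m n \<in> unitriangular n"
  by (auto simp: unitriangular_iff)

lemma mult_unitriangular:
  fixes x y :: "'a::field mat"
  assumes x: "x \<in> unitriangular n" and y: "y \<in> unitriangular n"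
  shows "x * y \<in> unitriangular n"
  unfolding unitriangular_iff
proof (intro conjI allI impI)
  have c: "x \<in> carrier_mat n n" "y \<in> carrier_mat n n" using x y by (auto simp: unitriangular_carrier)
  then show "x * y \<in> carrier_mat n n" by simp
  fix i j assume ij: "i < n" "j \<le> i"
  have "(x * y) $$ (i, j) = (\<Sum>k<n. x $$ (i, k) * y $$ (k, j))"
    using c ij by (simp add: scalar_prod_def atLeast0LessThan)
  also have "\<dots> = (\<Sum>k<n. if k = i then (if i = j then 1 else 0) else 0)"
  proof (rule sum.cong)
    fix k assume k: "k \<in> {..<n}"
    consider "k < i" | "k = i" | "k > i" by linarith
    then show "x $$ (i, k) * y $$ (k, j) = (if k = i then (if i = j then 1 else 0) else 0)"
      using k x y ij by cases (auto simp: unitriangular_iff)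
  qed simp
  finally show "(x * y) $$ (i, j) = (if i = j then 1 else 0)" using ij by simp
qed

lemma unitriangular_inverse_exists:
  fixes x :: "'a::field mat"
  assumes x: "x \<in> unitriangular n"
  obtains y where "y \<in> unitriangular n" "x * y = 1\<^sub>m n" "y * x = 1\<^sub>m n"
proof -
  have c: "x \<in> carrier_mat n n" "upper_triangular x" using x by (auto simp: unitriangular_def)
  have "prod_list (diag_mat x) = 1" using x
    by (auto simp: prod_list_diag_prod unitriangular_def intro: prod.neutral)
  then have "det x \<noteq> 0" using det_upper_triangular[OF c(2,1)] by simp
  from det_non_zero_imp_unit[OF c(1) this, of "()"] obtain y where
    "y \<in> carrier_mat n n" "x * y = 1\<^sub>m n" "y * x = 1\<^sub>m n"
    by (auto simp: Units_def ring_mat_simps)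
  with unitriangular_inverse[OF x] that show ?thesis by blast
qed

text \<open>The Gram matrix of the bilinear form \<open>T\<close> on the columns of
  \<open>x\<close>; it gives a right action of the unitriangular group.\<close>

definition congruence :: "'a::semiring_0 mat \<Rightarrow> 'a mat \<Rightarrow> 'a mat" where
  "congruence x T = transpose_mat x * T * x"

lemma congruence_carrier [simp]:
  "x \<in> carrier_mat n n \<Longrightarrow> T \<in> carrier_mat n n \<Longrightarrow> congruence x T \<in> carrier_mat n n"
  by (simp add: congruence_def)

lemma congruence_mult:
  fixes T :: "'a::comm_semiring_0 mat"
  assumes "x \<in> carrier_mat n n" "y \<in> carrier_mat n n" "T \<in> carrier_mat n n"
  shows "congruence (x * y) T = congruence y (congruence x T)"
  using assms by (simp add: congruence_def transpose_mult[of _ n n] assoc_mult_mat[of _ n n _ n _ n])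

lemma congruence_one:
  "T \<in> carrier_mat n n \<Longrightarrow> congruence (1\<^sub>m n) (T :: 'a::semiring_1 mat) = T"
  by (simp add: congruence_def)

lemma congruence_symmetric:
  fixes T :: "'a::comm_semiring_0 mat"
  assumes "x \<in> carrier_mat n n" "T \<in> carrier_mat n n" "transpose_mat T = T"
  shows "transpose_mat (congruence x T) = congruence x T"
  using assms by (simp add: congruence_def transpose_mult[of _ n n _ n] assoc_mult_mat[of _ n n _ n _ n])

text \<open>Stabilizers along an orbit are conjugate, so a nontrivial one found after some reduction
  steps can be carried back to the original matrix.\<close>

lemma conjugate_stabilizer:
  fixes T :: "'a::field mat"
  assumes T: "T \<in> carrier_mat n n" and y: "y \<in> unitriangular n"
    and x: "x \<in> unitriangular n" "x \<noteq> 1\<^sub>m n" "congruence x (congruence y T) = congruence y T"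
  shows "\<exists>z\<in>unitriangular n. z \<noteq> 1\<^sub>m n \<and> congruence z T = T"
proof -
  obtain y' where y': "y' \<in> unitriangular n" "y * y' = 1\<^sub>m n" "y' * y = 1\<^sub>m n"
    using unitriangular_inverse_exists[OF y] .
  have c: "x \<in> carrier_mat n n" "y \<in> carrier_mat n n" "y' \<in> carrier_mat n n"
    using x y y' by (auto simp: unitriangular_carrier)
  have "congruence (y * x * y') T = congruence y' (congruence x (congruence y T))"
    using c T by (simp add: congruence_mult[of _ n])
  also have "\<dots> = congruence (y * y') T" using c T x by (simp add: congruence_mult[of _ n])
  also have "\<dots> = T" using T y' by (simp add: congruence_one)
  finally have "congruence (y * x * y') T = T" .
  moreover have "y * x * y' \<noteq> 1\<^sub>m n"
  proof
    assume eq: "y * x * y' = 1\<^sub>m n"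
    have "x = (y' * y) * x * (y' * y)" using c y' by simp
    also have "\<dots> = y' * (y * x * y') * y" using c by (simp add: assoc_mult_mat[of _ n n _ n _ n])
    also have "\<dots> = 1\<^sub>m n" using c y' by (simp add: eq)
    finally show False using x(2) by simp
  qed
  moreover have "y * x * y' \<in> unitriangular n" using x y y' by (simp add: mult_unitriangular)
  ultimately show ?thesis by blast
qed

text \<open>The case \<open>k = l\<close>, \<open>d = 0\<close> is allowed and serves for pivots of size one.\<close>

definition column_ops :: "nat \<Rightarrow> nat \<Rightarrow> nat \<Rightarrow> (nat \<Rightarrow> 'a) \<Rightarrow> (nat \<Rightarrow> 'a) \<Rightarrow> 'a::field mat" where
  "column_ops n k l c d = mat n n (\<lambda>(i, j).
     (if i = j then 1 else 0) + (if i = k then c j else 0) + (if i = l then d j else 0))"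

lemma column_ops_unitriangular:
  assumes "\<And>j. j \<le> k \<Longrightarrow> c j = 0" "\<And>j. j \<le> l \<Longrightarrow> d j = 0"
  shows "column_ops n k l c d \<in> unitriangular n"
  using assms by (auto simp: unitriangular_iff column_ops_def)

text \<open>The matrix replaces the basis vector \<open>e_j\<close> by
  \<open>e_j + c_j e_k + d_j e_l\<close>; the right-hand side expands the form on two such
  vectors.\<close>

lemma congruence_column_ops:
  fixes T :: "'a::field mat"
  assumes T: "T \<in> carrier_mat n n" and kl: "k < n" "l < n" and ij: "i < n" "j < n"
  shows "congruence (column_ops n k l c d) T $$ (i, j) =
    T $$ (i, j) + c j * T $$ (i, k) + d j * T $$ (i, l)
    + c i * (T $$ (k, j) + c j * T $$ (k, k) + d j * T $$ (k, l))
    + d i * (T $$ (l, j) + c j * T $$ (l, k) + d j * T $$ (l, l))"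
proof -
  let ?x = "column_ops n k l c d"
  have x: "?x \<in> carrier_mat n n" by (simp add: column_ops_def)
  have right: "(T * ?x) $$ (a, j) = T $$ (a, j) + c j * T $$ (a, k) + d j * T $$ (a, l)"
    if a: "a < n" for a
  proof -
    have "(T * ?x) $$ (a, j) = (\<Sum>b<n. T $$ (a, b) * ?x $$ (b, j))"
      using T x a ij by (simp add: scalar_prod_def atLeast0LessThan)
    also have "\<dots> = (\<Sum>b<n. (if b = j then T $$ (a, j) else 0) + (if b = k then c j * T $$ (a, k) else 0)
        + (if b = l then d j * T $$ (a, l) else 0))"
      by (rule sum.cong) (use ij in \<open>auto simp: column_ops_def algebra_simps\<close>)
    finally show ?thesis using ij kl by (simp add: sum.distrib)
  qed
  define M where "M = T * ?x"
  have M: "M \<in> carrier_mat n n" using T x by (simp add: M_def)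
  have "congruence ?x T $$ (i, j) = (transpose_mat ?x * M) $$ (i, j)"
    unfolding congruence_def M_def using T x by (simp add: assoc_mult_mat[of _ n n _ n _ n])
  also have "\<dots> = (\<Sum>a<n. ?x $$ (a, i) * M $$ (a, j))"
    using x M ij by (simp add: scalar_prod_def atLeast0LessThan)
  also have "\<dots> = (\<Sum>a<n. (if a = i then M $$ (i, j) else 0)
      + (if a = k then c i * M $$ (k, j) else 0) + (if a = l then d i * M $$ (l, j) else 0))"
    by (rule sum.cong) (use ij in \<open>auto simp: column_ops_def algebra_simps\<close>)
  also have "\<dots> = M $$ (i, j) + c i * M $$ (k, j) + d i * M $$ (l, j)"
    using ij kl by (simp add: sum.distrib)
  finally show ?thesis using right ij kl by (simp add: M_def)
qed

text \<open>For symmetric \<open>T\<close>: the first \<open>k\<close> basis vectors span an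
  orthogonal summand on which the form is nondegenerate, monomial and tridiagonal.\<close>

definition reduced_upto :: "nat \<Rightarrow> nat \<Rightarrow> 'a::field mat \<Rightarrow> bool" where
  "reduced_upto n k T \<longleftrightarrow>
     (\<forall>i<k. \<forall>j<n. T $$ (i, j) \<noteq> 0 \<longrightarrow> j < k \<and> j \<le> Suc i \<and> i \<le> Suc j) \<and>
     (\<forall>i<k. \<exists>!j. j < n \<and> T $$ (i, j) \<noteq> 0)"

text \<open>Weaker than \<open>reduced_upto n n\<close> in one respect: existence of a nonzero entry
  is demanded for \<open>Suc i < n\<close> only, so the last row may vanish.\<close>

definition reduced_form :: "nat \<Rightarrow> 'a::field mat \<Rightarrow> bool" where
  "reduced_form n T \<longleftrightarrow> T \<in> carrier_mat n n \<and> transpose_mat T = T \<and>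
     (\<forall>i<n. \<forall>j<n. T $$ (i, j) \<noteq> 0 \<longrightarrow> j \<le> Suc i \<and> i \<le> Suc j) \<and>
     (\<forall>i<n. \<forall>j<n. \<forall>k<n. T $$ (i, j) \<noteq> 0 \<longrightarrow> T $$ (i, k) \<noteq> 0 \<longrightarrow> j = k) \<and>
     (\<forall>i. Suc i < n \<longrightarrow> (\<exists>j<n. T $$ (i, j) \<noteq> 0))"

text \<open>Without a pivot, \<open>e\<^sub>k\<close> is isotropic and orthogonal to \<open>e\<^sub>l\<close>, and the Eichler transformation
  attached to this pair is an isometry. It is trivial only if both vectors lie in the radical, and
  then every transvection in their plane is an isometry.\<close>

lemma ex_stabilizer:
  fixes T :: "'a::field mat"
  assumes two: "(2::'a) \<noteq> 0" and T: "T \<in> carrier_mat n n" and sym: "transpose_mat T = T"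
    and kl: "l = Suc k" "l < n"
    and zero: "\<And>j. j \<le> l \<Longrightarrow> T $$ (j, k) = 0" "\<And>j. j < k \<Longrightarrow> T $$ (j, l) = 0"
  shows "\<exists>x\<in>unitriangular n. x \<noteq> 1\<^sub>m n \<and> congruence x T = T"
proof -
  have s: "T $$ (i, j) = T $$ (j, i)" if "i < n" "j < n" for i j
    using that sym T by (metis carrier_matD index_transpose_mat(1))
  \<comment> \<open>Coefficients of the Eichler transformation, which adds
    \<open>- T_jl e_k + T_jk e_l - (T_ll / 2) T_jk e_k\<close> to \<open>e_j\<close>. The
    contributions of the first two terms cancel each other up to \<open>d_i d_j T_ll\<close>, and
    the half removes that remainder.\<close>
  define c where "c j = - T $$ (j, l) - T $$ (l, l) * T $$ (j, k) / 2" for j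
  define d where "d j = T $$ (j, k)" for j
  define x where "x = column_ops n k l c d"
  have kn: "k < n" using kl by simp
  have Tkl: "T $$ (k, l) = 0" "T $$ (k, k) = 0" "T $$ (l, k) = 0"
    using zero(1)[of k] zero(1)[of l] s[of k l] kl by auto
  have "x \<in> unitriangular n" unfolding x_def
  proof (rule column_ops_unitriangular)
    show "c j = 0" if "j \<le> k" for j
      using that zero(1)[of j] zero(2)[of j] Tkl kl by (cases "j = k") (auto simp: c_def)
    show "d j = 0" if "j \<le> l" for j using that zero by (simp add: d_def)
  qed
  have "congruence x T = T"
  proof (rule eq_matI)
    fix i j assume "i < dim_row T" "j < dim_col T"
    then have ij: "i < n" "j < n" using T by auto
    have "congruence x T $$ (i, j) - T $$ (i, j) =
        c j * T $$ (i, k) + d j * T $$ (i, l) + c i * T $$ (j, k) + d i * T $$ (j, l) + d i * d j * T $$ (l, l)"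
      unfolding x_def congruence_column_ops[OF T kn kl(2) ij] 
      using s[OF kn ij(2)] s[OF kl(2) ij(2)] by (simp add: Tkl algebra_simps)
    also have "\<dots> = 0"
      using two by (simp add: c_def d_def field_simps)
    finally show "congruence x T $$ (i, j) = T $$ (i, j)" by simp
  qed (use T in \<open>auto simp: congruence_def x_def column_ops_def\<close>)
  show ?thesis
  proof (cases "x = 1\<^sub>m n")
    case False
    then show ?thesis using \<open>x \<in> unitriangular n\<close> \<open>congruence x T = T\<close> by blast
  next
    case True
    have dz: "d j = 0" if j: "j < n" for j
    proof (cases "j \<le> l")
      case False
      then have "x $$ (l, j) = d j" using j kl by (simp add: x_def column_ops_def)
      then show ?thesis using True False j kl by simp
    qed (use zero d_def in simp)
    have cz: "T $$ (j, l) = 0" if j: "j < n" for j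
    proof (cases "j \<le> k")
      case False
      then have "x $$ (k, j) = c j" using j kl by (simp add: x_def column_ops_def)
      then have "c j = 0" using True False j kl by simp
      then show ?thesis using dz[OF j] two unfolding c_def d_def by simp
    qed (use zero Tkl in \<open>auto simp: le_less\<close>)
    define y where "y = column_ops n k k (\<lambda>j. if j = l then 1 else 0) (\<lambda>_. 0 :: 'a)"
    have "y \<in> unitriangular n" unfolding y_def by (rule column_ops_unitriangular) (use kl in auto)
    moreover have "y $$ (k, l) = 1" using kl by (simp add: y_def column_ops_def)
    then have "y \<noteq> 1\<^sub>m n" using kl by auto
    moreover have "congruence y T = T"
    proof (rule eq_matI)
      fix i j assume "i < dim_row T" "j < dim_col T"
      then have ij: "i < n" "j < n" using T by auto
      have z: "T $$ (j, k) = 0" if "j < n" for j using dz[OF that] by (simp add: d_def)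
      show "congruence y T $$ (i, j) = T $$ (i, j)"
        unfolding y_def congruence_column_ops[OF T kn kn ij]
        using z[OF ij(1)] z[OF ij(2)] z[OF kn] s[OF kn ij(2)] by simp
    qed (use T in \<open>auto simp: congruence_def y_def column_ops_def\<close>)
    ultimately show ?thesis by blast
  qed
qed

lemma reduced_upto_zero:
  assumes T: "T \<in> carrier_mat n n" and sym: "transpose_mat T = T" and red: "reduced_upto n k T"
    and "k \<le> n" "i < k" "k \<le> j" "j < n"
  shows "T $$ (i, j) = 0" "T $$ (j, i) = 0"
proof -
  show *: "T $$ (i, j) = 0" using assms unfolding reduced_upto_def by (meson not_less)
  have "T $$ (i, j) = T $$ (j, i)"
    using assms by (metis carrier_matD index_transpose_mat(1) le_trans less_le_trans linorder_not_le nless_le)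
  then show "T $$ (j, i) = 0" using * by simp
qed

text \<open>Gaussian elimination with the pivot \<open>(k, k)\<close>: the later basis vectors are
  made orthogonal to \<open>e_k\<close>. The earlier rows do not change, because \<open>e_k\<close>
  is orthogonal to the first \<open>k\<close> basis vectors.\<close>

lemma reduced_upto_step_one:
  fixes T :: "'a::field mat"
  assumes T: "T \<in> carrier_mat n n" and sym: "transpose_mat T = T"
    and red: "reduced_upto n k T" and k: "k < n" and pivot: "T $$ (k, k) \<noteq> 0"
  shows "\<exists>x\<in>unitriangular n. reduced_upto n (Suc k) (congruence x T)"
proof -
  have s: "T $$ (i, j) = T $$ (j, i)" if "i < n" "j < n" for i j
    using that sym T by (metis carrier_matD index_transpose_mat(1))
  have z: "T $$ (i, j) = 0" "T $$ (j, i) = 0" if "i < k" "k \<le> j" "j < n" for i j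
    using reduced_upto_zero[OF T sym red _ that] k by auto
  define c where "c j = (if j \<le> k then 0 else - T $$ (k, j) / T $$ (k, k))" for j
  define x where "x = column_ops n k k c (\<lambda>_. 0)"
  define S where "S = congruence x T"
  have x: "x \<in> unitriangular n" unfolding x_def by (rule column_ops_unitriangular) (simp_all add: c_def)
  have S: "S $$ (i, j) = T $$ (i, j) + c j * T $$ (i, k) + c i * (T $$ (k, j) + c j * T $$ (k, k))"
    if "i < n" "j < n" for i j
    unfolding S_def x_def congruence_column_ops[OF T k k that] by simp
  have old: "S $$ (i, j) = T $$ (i, j)" if "i < k" "j < n" for i j
    using that k z[of i k] by (simp add: S c_def)
  have new: "S $$ (k, j) = (if j = k then T $$ (k, k) else 0)" if j: "j < n" for j
    using j k pivot z[of j k] by (auto simp: S c_def)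
  have "reduced_upto n (Suc k) S"
    unfolding reduced_upto_def
  proof (intro conjI allI impI)
    fix i j assume ij: "i < Suc k" "j < n" "S $$ (i, j) \<noteq> 0"
    have "j < Suc k \<and> j \<le> Suc i \<and> i \<le> Suc j"
    proof (cases "i = k")
      case True
      then have "j = k" using new[OF ij(2)] ij(3) by (simp split: if_splits)
      then show ?thesis using True by simp
    next
      case False
      then have "i < k" "T $$ (i, j) \<noteq> 0" using ij old[of i j] by auto
      then show ?thesis using red ij(2) unfolding reduced_upto_def by (meson less_SucI)
    qed
    then show "j < Suc k" "j \<le> Suc i" "i \<le> Suc j" by auto
  next
    fix i assume i: "i < Suc k"
    show "\<exists>!j. j < n \<and> S $$ (i, j) \<noteq> 0"
    proof (cases "i = k")
      case True
      then show ?thesis using new pivot k by (auto intro!: ex1I[of _ k] split: if_splits)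
    next
      case False
      then have "i < k" using i by simp
      then have "(j < n \<and> S $$ (i, j) \<noteq> 0) = (j < n \<and> T $$ (i, j) \<noteq> 0)" for j using old by auto
      then show ?thesis using red \<open>i < k\<close> by (simp add: reduced_upto_def)
    qed
  qed
  with x show ?thesis unfolding S_def by blast
qed

text \<open>Here \<open>e_k\<close> is isotropic but not orthogonal to \<open>e_l\<close>, so the
  two span a hyperbolic plane. Making \<open>e_l\<close> isotropic too turns its block antidiagonal,
  and the later basis vectors are projected off the plane.\<close>

lemma reduced_upto_step_two:
  fixes T :: "'a::field mat"
  assumes two: "(2::'a) \<noteq> 0" and T: "T \<in> carrier_mat n n" and sym: "transpose_mat T = T"
    and red: "reduced_upto n k T" and kl: "l = Suc k" "l < n"
    and Tkk: "T $$ (k, k) = 0" and pivot: "T $$ (k, l) \<noteq> 0"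
  shows "\<exists>x\<in>unitriangular n. reduced_upto n (Suc l) (congruence x T)"
proof -
  have s: "T $$ (i, j) = T $$ (j, i)" if "i < n" "j < n" for i j
    using that sym T by (metis carrier_matD index_transpose_mat(1))
  have kn: "k < n" using kl by simp
  have z: "T $$ (i, j) = 0" "T $$ (j, i) = 0" if "i < k" "k \<le> j" "j < n" for i j
    using reduced_upto_zero[OF T sym red _ that] kn by auto
  define t where "t = T $$ (k, l)"
  have t: "t \<noteq> 0" "T $$ (l, k) = t" using pivot s[of k l] kl by (auto simp: t_def)
  \<comment> \<open>For \<open>j > l\<close>, \<open>d j\<close> solves orthogonality of the new
    \<open>e_j\<close> to \<open>e_k\<close>, and then \<open>c j\<close> solves orthogonality to
    the old \<open>e_l\<close>. The value \<open>c l\<close> makes \<open>e_l + c_l e_k\<close>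
    isotropic; it carries a half because \<open>c l * t\<close> enters the diagonal entry
    twice.\<close>
  define d where "d j = (if j \<le> l then 0 else - T $$ (k, j) / t)" for j
  define c where "c j = (if j \<le> k then 0 else if j = l then - T $$ (l, l) / (2 * t)
    else - (T $$ (l, j) + d j * T $$ (l, l)) / t)" for j
  define x where "x = column_ops n k l c d"
  define S where "S = congruence x T"
  have x: "x \<in> unitriangular n" unfolding x_def
    by (rule column_ops_unitriangular) (simp_all add: c_def d_def)
  have S: "S $$ (i, j) = T $$ (i, j) + c j * T $$ (i, k) + d j * T $$ (i, l)
      + c i * (T $$ (k, j) + d j * t) + d i * (T $$ (l, j) + c j * t + d j * T $$ (l, l))"
    if "i < n" "j < n" for i j
    unfolding S_def x_def congruence_column_ops[OF T kn kl(2) that] by (simp add: Tkk t t_def)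
  have old: "S $$ (i, j) = T $$ (i, j)" if "i < k" "j < n" for i j
    using that kl z[of i k] z[of i l] by (simp add: S c_def d_def)
  have newk: "S $$ (k, j) = (if j = l then t else 0)" if j: "j < n" for j
  proof -
    consider "j < k" | "j = k" | "j = l" | "j > l" using kl by linarith
    then show ?thesis
      using z[of j k] z[of j l] j kl t by cases (auto simp: S c_def d_def Tkk t_def)
  qed
  have newl: "S $$ (l, j) = (if j = k then t else 0)" if j: "j < n" for j
  proof -
    consider "j < k" | "j = k" | "j = l" | "j > l" using kl by linarith
    then show ?thesis
    proof cases
      case 3
      have "S $$ (l, l) = T $$ (l, l) + 2 * (c l * t)"
        unfolding S[OF kl(2,2)] by (simp add: t t_def[symmetric] d_def)
      also have "2 * (c l * t) = - T $$ (l, l)" using two t kl by (simp add: c_def field_simps)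
      finally show ?thesis using 3 kl by simp
    next
      case 4
      have "T $$ (k, j) + d j * t = 0" "d l = 0" using 4 t by (simp_all add: d_def)
      moreover have "T $$ (l, j) + c j * t + d j * T $$ (l, l) = 0"
        using 4 t kl by (simp add: c_def)
      moreover have "j \<noteq> k" using 4 kl by simp
      ultimately show ?thesis unfolding S[OF kl(2) j] by (simp add: t add.commute add.left_commute)
    qed (use z[of j k] z[of j l] j kl t in \<open>auto simp: S c_def d_def Tkk t_def\<close>)
  qed
  have "reduced_upto n (Suc l) S"
    unfolding reduced_upto_def
  proof (intro conjI allI impI)
    fix i j assume ij: "i < Suc l" "j < n" "S $$ (i, j) \<noteq> 0"
    then consider "i < k" | "i = k" "j = l" | "i = l" "j = k"
      using newk[of j] newl[of j] kl by (metis less_SucE)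
    then have "j < Suc l \<and> j \<le> Suc i \<and> i \<le> Suc j"
    proof cases
      case 1
      then have "T $$ (i, j) \<noteq> 0" using ij old[of i j] by simp
      then have "j < k \<and> j \<le> Suc i \<and> i \<le> Suc j"
        using red ij(2) 1 unfolding reduced_upto_def by blast
      then show ?thesis using kl by simp
    qed (use kl in auto)
    then show "j < Suc l" "j \<le> Suc i" "i \<le> Suc j" by auto
  next
    fix i assume i: "i < Suc l"
    then consider "i < k" | "i = k" | "i = l" using kl by linarith
    then show "\<exists>!j. j < n \<and> S $$ (i, j) \<noteq> 0"
    proof cases
      case 1
      then have "(j < n \<and> S $$ (i, j) \<noteq> 0) = (j < n \<and> T $$ (i, j) \<noteq> 0)" for j using old by auto
      then show ?thesis using red 1 by (simp add: reduced_upto_def)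
    next
      case 2
      then show ?thesis using newk t kl by (auto intro!: ex1I[of _ l] split: if_splits)
    next
      case 3
      then show ?thesis using newl t kl by (auto intro!: ex1I[of _ k] split: if_splits)
    qed
  qed
  with x show ?thesis unfolding S_def by blast
qed

text \<open>Both alternatives pass back through a reduction step: a stabilizer by conjugation, a
  reducing matrix by composition. The case without a pivot is absorbed by the first
  alternative.\<close>

lemma reduce_from:
  fixes T :: "'a::field mat"
  assumes two: "(2::'a) \<noteq> 0" and "T \<in> carrier_mat n n" "transpose_mat T = T"
    "reduced_upto n k T" "k \<le> n"
  shows "(\<exists>x\<in>unitriangular n. x \<noteq> 1\<^sub>m n \<and> congruence x T = T) \<or>
    (\<exists>x\<in>unitriangular n. reduced_form n (congruence x T))"
  using assms(2-)
proof (induction "n - k" arbitrary: k T rule: less_induct)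
  case less
  note T = less.prems(1) and sym = less.prems(2) and red = less.prems(3)
  have s: "T $$ (i, j) = T $$ (j, i)" if "i < n" "j < n" for i j
    using that sym T by (metis carrier_matD index_transpose_mat(1))
  have step: ?case if x: "x \<in> unitriangular n" and r: "reduced_upto n k' (congruence x T)"
    and k': "k < k'" "k' \<le> n" for x k'
  proof -
    have xc: "x \<in> carrier_mat n n" using x by (rule unitriangular_carrier)
    have "(\<exists>y\<in>unitriangular n. y \<noteq> 1\<^sub>m n \<and> congruence y (congruence x T) = congruence x T) \<or>
      (\<exists>y\<in>unitriangular n. reduced_form n (congruence y (congruence x T)))"
      by (rule less.hyps[OF _ _ _ r]) (use k' xc T sym in \<open>auto simp: congruence_symmetric\<close>)
    then show ?thesis
    proof
      assume "\<exists>y\<in>unitriangular n. y \<noteq> 1\<^sub>m n \<and> congruence y (congruence x T) = congruence x T"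
      then show ?thesis using conjugate_stabilizer[OF T x] by blast
    next
      assume "\<exists>y\<in>unitriangular n. reduced_form n (congruence y (congruence x T))"
      then obtain y where y: "y \<in> unitriangular n" "reduced_form n (congruence y (congruence x T))" by blast
      then have "reduced_form n (congruence (x * y) T)"
        using congruence_mult[OF xc unitriangular_carrier T] by metis
      then show ?thesis using mult_unitriangular[OF x y(1)] by blast
    qed
  qed
  have z: "T $$ (i, j) = 0" "T $$ (j, i) = 0" if "i < k" "k \<le> j" "j < n" for i j
    using reduced_upto_zero[OF T sym red less.prems(4) that] by auto
  \<comment> \<open>A zero at the last diagonal place leaves no next column to try. The last row is
    then zero, which \<open>reduced_form\<close> admits.\<close>
  have done_: ?case if "k = n \<or> Suc k = n \<and> T $$ (k, k) = 0"
  proof -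
    have last: "T $$ (i, j) = 0" if "\<not> i < k" "i < n" "j < n" for i j
    proof -
      have *: "Suc k = n" "T $$ (k, k) = 0" "i = k" using \<open>k = n \<or> _\<close> that by auto
      show ?thesis
      proof (cases "j = k")
        case False
        then have "j < k" using * that(3) by linarith
        then show ?thesis using z(2)[of j k] * by simp
      qed (use * in simp)
    qed
    have "reduced_form n T"
      unfolding reduced_form_def
    proof (intro conjI allI impI T sym)
      fix i j assume ij: "i < n" "j < n" "T $$ (i, j) \<noteq> 0"
      then have "i < k" using last by blast
      then show "j \<le> Suc i" "i \<le> Suc j" using red ij unfolding reduced_upto_def by auto
    next
      fix i j m assume ij: "i < n" "j < n" "m < n" "T $$ (i, j) \<noteq> 0" "T $$ (i, m) \<noteq> 0"
      then have "i < k" using last by blast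
      then show "j = m" using red ij unfolding reduced_upto_def by blast
    next
      fix i assume "Suc i < n"
      then have "i < k" using that by auto
      then show "\<exists>j<n. T $$ (i, j) \<noteq> 0" using red unfolding reduced_upto_def by blast
    qed
    then show ?thesis using one_unitriangular congruence_one[OF T] by metis
  qed
  consider "k = n \<or> Suc k = n \<and> T $$ (k, k) = 0" | "k < n" "T $$ (k, k) \<noteq> 0"
    | "Suc k < n" "T $$ (k, k) = 0" "T $$ (k, Suc k) \<noteq> 0"
    | "Suc k < n" "T $$ (k, k) = 0" "T $$ (k, Suc k) = 0"
    using less.prems(4) by linarith
  then show ?case
  proof cases
    case 1
    then show ?thesis by (rule done_)
  next
    case 2
    then show ?thesis using reduced_upto_step_one[OF T sym red] step[of _ "Suc k"] by auto
  next
    case 3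
    then show ?thesis using reduced_upto_step_two[OF two T sym red refl] step[of _ "Suc (Suc k)"] by auto
  next
    case 4
    have "T $$ (j, k) = 0" if jk: "j \<le> Suc k" for j
    proof -
      consider "j < k" | "j = k" | "j = Suc k" using jk by linarith
      then show ?thesis using 4 z(1)[of j k] s[of k j] by cases auto
    qed
    moreover have "T $$ (j, Suc k) = 0" if "j < k" for j using that 4 z(1)[of j "Suc k"] by simp
    ultimately show ?thesis using ex_stabilizer[OF two T sym refl 4(1)] by blast
  qed
qed

lemma stabilizer_or_reduced_form:
  fixes T :: "'a::field mat"
  assumes "(2::'a) \<noteq> 0" "T \<in> carrier_mat n n" "transpose_mat T = T"
  shows "(\<exists>x\<in>unitriangular n. x \<noteq> 1\<^sub>m n \<and> congruence x T = T) \<or>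
    (\<exists>x\<in>unitriangular n. reduced_form n (congruence x T))"
  by (rule reduce_from[OF assms, of 0]) (simp_all add: reduced_upto_def)

section \<open>Coordinates on the symplectic group\<close>

definition symmetric_mats :: "nat \<Rightarrow> 'a mat set" where
  "symmetric_mats n = {b \<in> carrier_mat n n. transpose_mat b = b}"

definition upper_left :: "nat \<Rightarrow> 'a mat \<Rightarrow> 'a mat" where
  "upper_left n g = mat n n (\<lambda>ij. g $$ ij)"

text \<open>The upper right block with its columns in reverse order, that is, multiplied by
  \<open>J\<close> on the right. Its entry \<open>(i, j)\<close> is the one with row label
  \<open>i + 1\<close> and column label \<open>-(j + 1)\<close>.\<close>

definition upper_right :: "nat \<Rightarrow> 'a mat \<Rightarrow> 'a mat" where
  "upper_right n g = mat n n (\<lambda>(i, j). g $$ (i, 2 * n - 1 - j))"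

text \<open>In the coordinates given by the upper left block \<open>x\<close> and \<open>b = x z J x\<^sup>T\<close>, the group is the
  semidirect product of the unitriangular group and the symmetric matrices, with
  \<open>(x, b) (x', b') = (x x', b + x b' x\<^sup>T)\<close>.\<close>

definition sym_part :: "nat \<Rightarrow> 'a::semiring_0 mat \<Rightarrow> 'a mat" where
  "sym_part n g = upper_right n g * transpose_mat (upper_left n g)"

text \<open>The inverse \<open>y\<close> of \<open>x\<close> is an argument, so no inverse has to be
  chosen. The upper right block is \<open>x z\<close> in terms of \<open>b\<close>: from
  \<open>b = x z J x^T\<close> follows \<open>x z = b y^T J\<close>.\<close>

definition usp_mat :: "nat \<Rightarrow> 'a::field mat \<Rightarrow> 'a mat \<Rightarrow> 'a mat \<Rightarrow> 'a mat" where
  "usp_mat n x y b = four_block_mat x (b * transpose_mat y * antidiag_mat n) (0\<^sub>m n n)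
     (antidiag_mat n * transpose_mat y * antidiag_mat n)"

lemma transpose_eq_imp_index:
  assumes "T \<in> carrier_mat n n" "transpose_mat T = T" "i < n" "j < n"
  shows "T $$ (i, j) = T $$ (j, i)"
  using assms by (metis carrier_matD index_transpose_mat(1))

context
  fixes n :: nat and J :: "'a::field mat"
  defines "J \<equiv> antidiag_mat n"
begin

private lemma J: "J \<in> carrier_mat n n" "transpose_mat J = J" "J * J = 1\<^sub>m n"
  by (simp_all add: J_def)

private lemmas assoc = assoc_mult_mat[where n\<^sub>1=n and n\<^sub>2=n and n\<^sub>3=n and n\<^sub>4=n]
private lemmas tmult = transpose_mult[where n=n and nr=n and nc=n]

private lemma JJ: "M \<in> carrier_mat n n \<Longrightarrow> J * (J * M) = M"
  using J by (simp add: assoc[symmetric] del: assoc_mult_mat)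

private lemma cancel:
  assumes "(x :: 'a mat) \<in> carrier_mat n n" "y \<in> carrier_mat n n" "x * y = 1\<^sub>m n" "M \<in> carrier_mat n n"
  shows "x * (y * M) = M" "y * (x * M) = M"
    "transpose_mat y * (transpose_mat x * M) = M" "transpose_mat x * (transpose_mat y * M) = M"
proof -
  have yx: "y * x = 1\<^sub>m n" by (rule mat_mult_left_right_inverse[OF assms(1,2,3)])
  moreover have "transpose_mat y * transpose_mat x = 1\<^sub>m n" "transpose_mat x * transpose_mat y = 1\<^sub>m n"
    unfolding tmult[OF assms(1,2), symmetric] tmult[OF assms(2,1), symmetric] yx assms(3)
    by (rule transpose_one)+
  ultimately show "x * (y * M) = M" "y * (x * M) = M"
    "transpose_mat y * (transpose_mat x * M) = M" "transpose_mat x * (transpose_mat y * M) = M"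
    using assms by (simp_all add: assoc[symmetric] del: assoc_mult_mat)
qed

text \<open>The condition \<open>J z^T = z J\<close> says that \<open>z J\<close> is symmetric, and
  this is equivalent to symmetry of \<open>b = x (z J) x^T\<close>.\<close>

lemma carrier_USp_eq_usp_mat:
  "carrier (USp n) = {usp_mat n x y b | x y b :: 'a mat.
     x \<in> unitriangular n \<and> y \<in> carrier_mat n n \<and> x * y = 1\<^sub>m n \<and> b \<in> symmetric_mats n}"
proof (intro equalityI subsetI)
  fix g :: "'a mat" assume "g \<in> carrier (USp n)"
  then obtain x y z where g: "g = four_block_mat x (x * z) (0\<^sub>m n n) (J * transpose_mat y * J)"
    and x: "x \<in> unitriangular n" and y: "y \<in> carrier_mat n n" "x * y = 1\<^sub>m n"
    and z: "z \<in> carrier_mat n n" "J * transpose_mat z - z * J = 0\<^sub>m n n"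
    unfolding carrier_USp J_def by auto
  have xc: "x \<in> carrier_mat n n" using x by (rule unitriangular_carrier)
  have zJ: "J * transpose_mat z = z * J"
    using z J by (subst minus_mat_eq_zero_iff(1)[symmetric]) auto
  define b where "b = x * (z * J) * transpose_mat x"
  have b: "b \<in> symmetric_mats n"
    using xc z J zJ by (simp add: symmetric_mats_def b_def tmult assoc)
  have "b * transpose_mat y * J = x * z"
    using xc y z J cancel[OF xc y] by (simp add: b_def assoc)
  then have "g = usp_mat n x y b" by (simp add: g usp_mat_def J_def[symmetric])
  then show "g \<in> {usp_mat n x y b | x y b.
     x \<in> unitriangular n \<and> y \<in> carrier_mat n n \<and> x * y = 1\<^sub>m n \<and> b \<in> symmetric_mats n}"
    using x y b by blast
next
  fix g assume "g \<in> {usp_mat n x y b | x y b :: 'a mat.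
     x \<in> unitriangular n \<and> y \<in> carrier_mat n n \<and> x * y = 1\<^sub>m n \<and> b \<in> symmetric_mats n}"
  then obtain x y b where g: "g = usp_mat n x y b" and x: "x \<in> unitriangular n"
    and y: "y \<in> carrier_mat n n" "x * y = 1\<^sub>m n" and b: "b \<in> carrier_mat n n" "transpose_mat b = b"
    by (auto simp: symmetric_mats_def)
  have xc: "x \<in> carrier_mat n n" using x by (rule unitriangular_carrier)
  define z where "z = y * (b * (transpose_mat y * J))"
  have z: "z \<in> carrier_mat n n" using y b J by (simp add: z_def)
  have "J * transpose_mat z = z * J"
    using y b J JJ by (simp add: z_def tmult assoc)
  then have "J * transpose_mat z - z * J = 0\<^sub>m n n"
    using z J by (subst minus_mat_eq_zero_iff(1)) auto
  moreover have "b * transpose_mat y * J = x * z"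
    using xc y b J cancel[OF xc y] by (simp add: z_def assoc)
  then have "g = four_block_mat x (x * z) (0\<^sub>m n n) (J * transpose_mat y * J)"
    by (simp add: g usp_mat_def J_def[symmetric])
  ultimately show "g \<in> carrier (USp n)"
    using x y z unfolding carrier_USp J_def[symmetric] by blast
qed

private lemma mult_antidiag:
  assumes "(M :: 'a mat) \<in> carrier_mat n n" "i < n" "j < n"
  shows "(M * J) $$ (i, j) = M $$ (i, n - 1 - j)"
proof -
  have "(M * J) $$ (i, j) = (\<Sum>l<n. M $$ (i, l) * J $$ (l, j))"
    using assms J by (simp add: scalar_prod_def atLeast0LessThan)
  also have "\<dots> = (\<Sum>l<n. if l = n - 1 - j then M $$ (i, l) else 0)"
    by (rule sum.cong) (use assms in \<open>auto simp: J_def antidiag_mat_def\<close>)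
  finally show ?thesis using assms by simp
qed

lemma usp_mat_parts:
  assumes x: "x \<in> carrier_mat n n" and y: "y \<in> carrier_mat n n" "x * y = 1\<^sub>m n"
    and b: "(b :: 'a mat) \<in> carrier_mat n n"
  shows "upper_left n (usp_mat n x y b) = x" "upper_right n (usp_mat n x y b) = b * transpose_mat y"
    "sym_part n (usp_mat n x y b) = b"
proof -
  show l: "upper_left n (usp_mat n x y b) = x"
    using x y by (intro eq_matI) (auto simp: upper_left_def usp_mat_def)
  show r: "upper_right n (usp_mat n x y b) = b * transpose_mat y"
  proof (rule eq_matI)
    fix i j assume "i < dim_row (b * transpose_mat y)" "j < dim_col (b * transpose_mat y)"
    then have ij: "i < n" "j < n" using b y by auto
    define M where "M = b * transpose_mat y"
    have M: "M \<in> carrier_mat n n" using b y by (simp add: M_def)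
    have "upper_right n (usp_mat n x y b) $$ (i, j) = (M * J) $$ (i, n - 1 - j)"
    proof -
      define m where "m = n - 1 - j"
      have m: "2 * n - 1 - j = n + m" "m < n" using ij by (auto simp: m_def)
      have "upper_right n (usp_mat n x y b) $$ (i, j) = usp_mat n x y b $$ (i, n + m)"
        unfolding m(1)[symmetric] using ij by (simp add: upper_right_def)
      also have "\<dots> = (M * J) $$ (i, m)"
        using ij m(2) x y carrier_matD[OF M] carrier_matD[OF J(1)]
        by (simp add: usp_mat_def J_def[symmetric] M_def[symmetric] del: index_mult_mat(1))
      finally show ?thesis by (simp only: m_def)
    qed
    also have "\<dots> = M $$ (i, j)" using ij M by (simp add: mult_antidiag)
    finally show "upper_right n (usp_mat n x y b) $$ (i, j) = (b * transpose_mat y) $$ (i, j)"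
      by (simp add: M_def)
  qed (use b y in \<open>auto simp: upper_right_def\<close>)
  show "sym_part n (usp_mat n x y b) = b"
    using x y b cancel(3)[OF x y, of "1\<^sub>m n"] by (simp add: sym_part_def l r assoc)
qed

lemma usp_mat_mult:
  assumes x: "x \<in> carrier_mat n n" "x' \<in> carrier_mat n n"
    and y: "y \<in> carrier_mat n n" "x * y = 1\<^sub>m n" and y': "y' \<in> carrier_mat n n" "x' * y' = 1\<^sub>m n"
    and b: "(b :: 'a mat) \<in> carrier_mat n n" "b' \<in> carrier_mat n n"
  shows "usp_mat n x y b * usp_mat n x' y' b' =
    usp_mat n (x * x') (y' * y) (b + x * b' * transpose_mat x)"
proof -
  note c = x y y' b J
  have "usp_mat n x y b * usp_mat n x' y' b' =
    four_block_mat (x * x' + (b * transpose_mat y * J) * 0\<^sub>m n n)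
      (x * (b' * transpose_mat y' * J) + (b * transpose_mat y * J) * (J * transpose_mat y' * J))
      (0\<^sub>m n n * x' + (J * transpose_mat y * J) * 0\<^sub>m n n)
      (0\<^sub>m n n * (b' * transpose_mat y' * J) + (J * transpose_mat y * J) * (J * transpose_mat y' * J))"
    unfolding usp_mat_def J_def[symmetric]
    by (rule mult_four_block_mat[where ?nr1.0=n and ?n1.0=n and ?n2.0=n and ?nr2.0=n and ?nc1.0=n and ?nc2.0=n])
       (use c in auto)
  also have "x * x' + (b * transpose_mat y * J) * 0\<^sub>m n n = x * x'" using c by simp
  also have "0\<^sub>m n n * x' + (J * transpose_mat y * J) * 0\<^sub>m n n = 0\<^sub>m n n" using c by simp
  also have "0\<^sub>m n n * (b' * transpose_mat y' * J) + (J * transpose_mat y * J) * (J * transpose_mat y' * J) =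
      J * transpose_mat (y' * y) * J"
    using c JJ by (simp add: assoc tmult left_mult_zero_mat[of _ n n])
  also have "x * (b' * transpose_mat y' * J) + (b * transpose_mat y * J) * (J * transpose_mat y' * J) =
      (b + x * b' * transpose_mat x) * transpose_mat (y' * y) * J"
  proof -
    have "(b + x * b' * transpose_mat x) * transpose_mat (y' * y) * J =
        b * (transpose_mat y * (transpose_mat y' * J)) + x * b' * transpose_mat x * (transpose_mat y * (transpose_mat y' * J))"
      using c by (simp add: assoc tmult add_mult_distrib_mat[of _ n n _ _ n])
    also have "x * b' * transpose_mat x * (transpose_mat y * (transpose_mat y' * J)) = x * (b' * (transpose_mat y' * J))"
      using c cancel[OF x(1) y] by (simp add: assoc)
    also have "b * (transpose_mat y * (transpose_mat y' * J)) = (b * transpose_mat y * J) * (J * transpose_mat y' * J)"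
      using c JJ by (simp add: assoc)
    finally show ?thesis
      using c by (simp add: assoc comm_add_mat[of _ n n])
  qed
  finally show ?thesis by (simp add: usp_mat_def J_def[symmetric])
qed

lemma USp_cases:
  assumes "g \<in> carrier (USp n :: 'a mat monoid)"
  obtains x y b where "g = usp_mat n x y b" "x \<in> unitriangular n" "x \<in> carrier_mat n n"
    "y \<in> carrier_mat n n" "x * y = 1\<^sub>m n" "b \<in> symmetric_mats n" "b \<in> carrier_mat n n"
    "upper_left n g = x" "upper_right n g = b * transpose_mat y" "sym_part n g = b"
proof -
  obtain x y b where *: "g = usp_mat n x y b" "x \<in> unitriangular n"
    "y \<in> carrier_mat n n" "x * y = 1\<^sub>m n" "b \<in> symmetric_mats n"
    using assms unfolding carrier_USp_eq_usp_mat by blast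
  have c: "x \<in> carrier_mat n n" "b \<in> carrier_mat n n"
    using * by (auto simp: unitriangular_carrier symmetric_mats_def)
  show ?thesis
    by (rule that[OF *(1,2) c(1) *(3,4,5) c(2)]) (use usp_mat_parts[OF c(1) *(3,4) c(2)] *(1) in auto)
qed

lemma upper_left_unitriangular:
  "g \<in> carrier (USp n :: 'a mat monoid) \<Longrightarrow> upper_left n g \<in> unitriangular n"
  by (erule USp_cases) simp

lemma sym_part_symmetric:
  "g \<in> carrier (USp n :: 'a mat monoid) \<Longrightarrow> sym_part n g \<in> symmetric_mats n"
  by (erule USp_cases) simp

lemma USp_mult_parts:
  assumes g: "g \<in> carrier (USp n :: 'a mat monoid)" and h: "h \<in> carrier (USp n)"
  shows "upper_left n (g \<otimes>\<^bsub>USp n\<^esub> h) = upper_left n g * upper_left n h"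
    and "sym_part n (g \<otimes>\<^bsub>USp n\<^esub> h) =
      sym_part n g + upper_left n g * sym_part n h * transpose_mat (upper_left n g)"
proof -
  obtain x y b where g: "g = usp_mat n x y b" "x \<in> carrier_mat n n"
    "y \<in> carrier_mat n n" "x * y = 1\<^sub>m n" "b \<in> carrier_mat n n" "upper_left n g = x" "sym_part n g = b"
    by (rule USp_cases[OF g])
  obtain x' y' b' where h: "h = usp_mat n x' y' b'" "x' \<in> carrier_mat n n"
    "y' \<in> carrier_mat n n" "x' * y' = 1\<^sub>m n" "b' \<in> carrier_mat n n" "upper_left n h = x'" "sym_part n h = b'"
    by (rule USp_cases[OF h])
  have gh: "g \<otimes>\<^bsub>USp n\<^esub> h = usp_mat n (x * x') (y' * y) (b + x * b' * transpose_mat x)"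
    using g h usp_mat_mult by (simp add: USp_def)
  have "(x * x') * (y' * y) = 1\<^sub>m n"
    using g h cancel(1)[OF h(2,3,4), of y] by (simp add: assoc)
  then show "upper_left n (g \<otimes>\<^bsub>USp n\<^esub> h) = upper_left n g * upper_left n h"
    and "sym_part n (g \<otimes>\<^bsub>USp n\<^esub> h) =
      sym_part n g + upper_left n g * sym_part n h * transpose_mat (upper_left n g)"
    unfolding gh using g(2-7) h(2-7) usp_mat_parts[of "x * x'" "y' * y" "b + x * b' * transpose_mat x"]
    by simp_all
qed

lemma USp_one_parts:
  "upper_left n \<one>\<^bsub>USp n\<^esub> = (1\<^sub>m n :: 'a mat)" "sym_part n \<one>\<^bsub>USp n\<^esub> = (0\<^sub>m n n :: 'a mat)"
proof -
  have ul: "upper_left n (1\<^sub>m (2 * n)) = (1\<^sub>m n :: 'a mat)"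
    by (intro eq_matI) (auto simp: upper_left_def)
  have "upper_right n (1\<^sub>m (2 * n)) = (0\<^sub>m n n :: 'a mat)"
    by (intro eq_matI) (auto simp: upper_right_def)
  with ul show "upper_left n \<one>\<^bsub>USp n\<^esub> = (1\<^sub>m n :: 'a mat)" "sym_part n \<one>\<^bsub>USp n\<^esub> = (0\<^sub>m n n :: 'a mat)"
    by (simp_all add: USp_def sym_part_def)
qed

lemma USp_ex_parts:
  assumes x: "x \<in> unitriangular n" and b: "(b :: 'a mat) \<in> symmetric_mats n"
  shows "\<exists>g\<in>carrier (USp n). upper_left n g = x \<and> sym_part n g = b"
proof -
  obtain y where y: "y \<in> unitriangular n" "x * y = 1\<^sub>m n"
    using unitriangular_inverse_exists[OF x] by metis
  have c: "x \<in> carrier_mat n n" "y \<in> carrier_mat n n" "b \<in> carrier_mat n n"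
    using x y b by (auto simp: unitriangular_carrier symmetric_mats_def)
  have "usp_mat n x y b \<in> carrier (USp n)"
    unfolding carrier_USp_eq_usp_mat using x y b c by blast
  then show ?thesis using usp_mat_parts[OF c(1,2) y(2) c(3)] by blast
qed

lemma USp_eqI:
  assumes g: "g \<in> carrier (USp n :: 'a mat monoid)" and h: "h \<in> carrier (USp n)"
    and eq: "upper_left n g = upper_left n h" "sym_part n g = sym_part n h"
  shows "g = h"
proof -
  obtain x y b where g: "g = usp_mat n x y b" "x \<in> carrier_mat n n"
    "y \<in> carrier_mat n n" "x * y = 1\<^sub>m n" "upper_left n g = x" "sym_part n g = b"
    by (rule USp_cases[OF g])
  obtain x' y' b' where h: "h = usp_mat n x' y' b'" "x' \<in> carrier_mat n n"
    "y' \<in> carrier_mat n n" "x' * y' = 1\<^sub>m n" "upper_left n h = x'" "sym_part n h = b'"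
    by (rule USp_cases[OF h])
  have "y = y'" using cancel(2)[OF g(2,3,4), of y'] g h eq by simp
  then show ?thesis using g h eq by simp
qed

text \<open>Right multiplication by \<open>x^T\<close> does not alter column \<open>j\<close> if row
  \<open>j\<close> of \<open>x\<close> is trivial. On the subgroup of a root in \<Gamma> this makes
  the matrix entry read by the linear character an entry of \<open>b\<close>.\<close>

lemma sym_part_eq_upper_right:
  assumes g: "(g :: 'a mat) \<in> carrier (USp n)" and ij: "i < n" "j < n"
    and row: "\<And>k. k < n \<Longrightarrow> upper_left n g $$ (j, k) = (if k = j then 1 else 0)"
  shows "sym_part n g $$ (i, j) = upper_right n g $$ (i, j)"
proof -
  have "sym_part n g $$ (i, j) = (\<Sum>k<n. upper_right n g $$ (i, k) * upper_left n g $$ (j, k))"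
    using ij by (simp add: sym_part_def scalar_prod_def atLeast0LessThan upper_left_def upper_right_def)
  also have "\<dots> = (\<Sum>k<n. if k = j then upper_right n g $$ (i, j) else 0)"
    by (rule sum.cong) (auto simp: row)
  finally show ?thesis using ij by simp
qed

end

lemma finite_carrier_mat: "finite (carrier_mat m n :: 'a::finite mat set)"
proof -
  have "inj_on (\<lambda>A. \<lambda>ij\<in>{..<m} \<times> {..<n}. A $$ ij) (carrier_mat m n :: 'a mat set)"
  proof (rule inj_onI)
    fix A B :: "'a mat" assume AB: "A \<in> carrier_mat m n" "B \<in> carrier_mat m n"
      and eq: "(\<lambda>ij\<in>{..<m} \<times> {..<n}. A $$ ij) = (\<lambda>ij\<in>{..<m} \<times> {..<n}. B $$ ij)"
    show "A = B"
    proof (rule eq_matI)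
      fix i j assume "i < dim_row B" "j < dim_col B"
      then show "A $$ (i, j) = B $$ (i, j)" using fun_cong[OF eq, of "(i, j)"] AB by simp
    qed (use AB in auto)
  qed
  moreover have "(\<lambda>A. \<lambda>ij\<in>{..<m} \<times> {..<n}. A $$ ij) ` (carrier_mat m n :: 'a mat set)
      \<subseteq> ({..<m} \<times> {..<n}) \<rightarrow>\<^sub>E UNIV"
    by (rule image_subsetI) (simp only: restrict_PiE_iff, simp)
  ultimately show ?thesis
    by (rule inj_on_finite) (simp add: finite_PiE)
qed

lemma finite_carrier_USp: "finite (carrier (USp n :: 'a::{field,finite} mat monoid))"
  by (rule finite_subset[OF _ finite_carrier_mat[of "2 * n" "2 * n"]]) (auto simp: USp_def Sp_def)

section \<open>Irreducible characters of maximal degree\<close>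

definition pairing :: "nat \<Rightarrow> 'a::comm_ring_1 mat \<Rightarrow> 'a mat \<Rightarrow> 'a" where
  "pairing n T b = (\<Sum>i<n. \<Sum>j<n. T $$ (i, j) * b $$ (i, j))"

lemma pairing_commute: "pairing n T b = pairing n b T"
  by (simp add: pairing_def mult.commute)

lemma pairing_add:
  assumes "b \<in> carrier_mat n n" "c \<in> carrier_mat n n"
  shows "pairing n T (b + c) = pairing n T b + pairing n T c"
  using assms by (simp add: pairing_def distrib_left sum.distrib)

lemma pairing_add_left:
  assumes "T \<in> carrier_mat n n" "S \<in> carrier_mat n n"
  shows "pairing n (T + S) b = pairing n T b + pairing n S b"
  using pairing_add[OF assms, of b] by (simp add: pairing_commute)

lemma pairing_zero [simp]: "pairing n T (0\<^sub>m n n) = 0"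
  by (simp add: pairing_def)

lemma pairing_eq_trace:
  assumes "T \<in> carrier_mat n n" "b \<in> carrier_mat n n"
  shows "pairing n T b = mat_trace (transpose_mat T * b)"
proof -
  have "mat_trace (transpose_mat T * b) = (\<Sum>j<n. \<Sum>i<n. T $$ (i, j) * b $$ (i, j))"
    using assms by (simp add: mat_trace_def scalar_prod_def atLeast0LessThan)
  also have "\<dots> = pairing n T b" unfolding pairing_def by (rule sum.swap)
  finally show ?thesis by simp
qed

text \<open>Cyclicity of the trace. It turns the conjugation action of \<open>U\<close> on
  \<open>A\<close>, which sends \<open>b\<close> to \<open>x b x^T\<close>, into congruence of the
  parameter \<open>T\<close>.\<close>

lemma pairing_congruence:
  assumes T: "T \<in> carrier_mat n n" and b: "b \<in> carrier_mat n n" and x: "x \<in> carrier_mat n n"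
  shows "pairing n T (x * b * transpose_mat x) = pairing n (congruence x T) b"
proof -
  note assoc = assoc_mult_mat[where n\<^sub>1=n and n\<^sub>2=n and n\<^sub>3=n and n\<^sub>4=n]
  note tmult = transpose_mult[where n=n and nr=n and nc=n]
  have "pairing n T (x * b * transpose_mat x) = mat_trace ((transpose_mat T * (x * b)) * transpose_mat x)"
    using assms by (simp add: pairing_eq_trace assoc)
  also have "\<dots> = mat_trace (transpose_mat x * (transpose_mat T * (x * b)))"
    by (rule mat_trace_mult_commute[of _ n n]) (use assms in auto)
  also have "transpose_mat x * (transpose_mat T * (x * b)) = transpose_mat (congruence x T) * b"
    using assms by (simp add: congruence_def tmult assoc)
  also have "mat_trace \<dots> = pairing n (congruence x T) b"
    using assms by (simp add: pairing_eq_trace[of _ n])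
  finally show ?thesis .
qed

lemma symmetric_matsD:
  "b \<in> symmetric_mats n \<Longrightarrow> b \<in> carrier_mat n n" "b \<in> symmetric_mats n \<Longrightarrow> transpose_mat b = b"
  by (auto simp: symmetric_mats_def)

lemma symmetric_mats_add:
  "a \<in> symmetric_mats n \<Longrightarrow> b \<in> symmetric_mats n \<Longrightarrow> a + b \<in> symmetric_mats n"
  for a b :: "'a::comm_monoid_add mat"
  by (auto simp: symmetric_mats_def transpose_add[of _ n n])

lemma symmetric_mats_minus:
  "a \<in> symmetric_mats n \<Longrightarrow> b \<in> symmetric_mats n \<Longrightarrow> a - b \<in> symmetric_mats n"
  for a b :: "'a::ab_group_add mat"
  by (auto simp: symmetric_mats_def transpose_minus[of _ n n])

lemma symmetric_mats_zero: "0\<^sub>m n n \<in> symmetric_mats n"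
  by (auto simp: symmetric_mats_def)

lemma finite_symmetric_mats: "finite (symmetric_mats n :: 'a::finite mat set)"
  by (rule finite_subset[OF _ finite_carrier_mat[of n n]]) (auto simp: symmetric_mats_def)

lemma finite_unitriangular: "finite (unitriangular n :: 'a::{finite,zero,one} mat set)"
  by (rule finite_subset[OF _ finite_carrier_mat[of n n]]) (auto simp: unitriangular_def)

lemma congruence_symmetric_mats:
  fixes T :: "'a::comm_semiring_0 mat"
  assumes "x \<in> carrier_mat n n" "T \<in> symmetric_mats n"
  shows "congruence x T \<in> symmetric_mats n"
  using assms congruence_symmetric[of x n T] by (auto simp: symmetric_mats_def)

lemma additive_character_zero:
  assumes "nontrivial_additive_character \<theta>"
  shows "\<theta> 0 = 1"
proof -
  have "\<theta> (0 + 0) = \<theta> 0 * \<theta> 0" "\<theta> 0 \<noteq> 0"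
    using assms unfolding nontrivial_additive_character_def by blast+
  then show ?thesis by simp
qed

lemma additive_character_add:
  "nontrivial_additive_character \<theta> \<Longrightarrow> \<theta> (a + b) = \<theta> a * \<theta> b"
  by (simp add: nontrivial_additive_character_def)

lemma pairing_nondegenerate:
  fixes S :: "'a::field mat"
  assumes two: "(2::'a) \<noteq> 0" and \<theta>: "nontrivial_additive_character \<theta>"
    and S: "S \<in> symmetric_mats n" "S \<noteq> 0\<^sub>m n n"
  shows "\<exists>b\<in>symmetric_mats n. \<theta> (pairing n S b) \<noteq> 1"
proof -
  note Sc = symmetric_matsD[OF S(1)]
  obtain i j where ij: "i < n" "j < n" "S $$ (i, j) \<noteq> 0"
    using S(2) Sc(1) by (metis carrier_matD eq_matI index_zero_mat)
  obtain a where a: "\<theta> a \<noteq> 1" using \<theta> unfolding nontrivial_additive_character_def by blast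
  \<comment> \<open>The matrix \<open>b\<close> has \<open>s\<close> at \<open>(i, j)\<close> and
    \<open>(j, i)\<close>, or \<open>2 s\<close> at \<open>(i, i)\<close> if \<open>i = j\<close>;
    in both cases the pairing with \<open>S\<close> is \<open>2 s S_ij = a\<close>.\<close>
  define s where "s = a / (2 * S $$ (i, j))"
  define b where "b = mat n n (\<lambda>(k, l). (if k = i \<and> l = j then s else 0) + (if k = j \<and> l = i then s else 0))"
  have bc: "b \<in> carrier_mat n n" by (simp add: b_def)
  have "transpose_mat b = b"
  proof (rule eq_matI)
    fix k l assume "k < dim_row b" "l < dim_col b"
    then have "k < n" "l < n" using bc by auto
    then show "transpose_mat b $$ (k, l) = b $$ (k, l)"
      by (simp add: b_def add.commute conj_commute)
  qed (use bc in auto)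
  with bc have b: "b \<in> symmetric_mats n" by (simp add: symmetric_mats_def)
  have "pairing n S b = (\<Sum>k<n. \<Sum>l<n. (if k = i then if l = j then S $$ (i, j) * s else 0 else 0)
      + (if k = j then if l = i then S $$ (j, i) * s else 0 else 0))"
    unfolding pairing_def by (intro sum.cong refl) (auto simp: b_def algebra_simps)
  also have "\<dots> = S $$ (i, j) * s + S $$ (j, i) * s"
  proof -
    have delta: "(\<Sum>k<n. \<Sum>l<n. if k = i' then if l = j' then c else 0 else 0) = c"
      if "i' < n" "j' < n" for i' j' and c :: 'a
    proof -
      have "(\<Sum>l<n. if k = i' then if l = j' then c else 0 else 0) = (if k = i' then c else 0)" for k
        using that by simp
      then show ?thesis using that by simp
    qed
    show ?thesis using ij by (simp add: sum.distrib delta)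
  qed
  also have "S $$ (j, i) = S $$ (i, j)" using transpose_eq_imp_index[OF Sc] ij by simp
  also have "S $$ (i, j) * s + S $$ (i, j) * s = a" using two ij by (simp add: s_def field_simps)
  finally show ?thesis using a b by auto
qed

text \<open>Translating the summation index by a suitable \<open>U\<close> multiplies the sum by a
  factor other than 1.\<close>

lemma character_sum_symmetric_mats:
  fixes b :: "'a::{field,finite} mat"
  assumes two: "(2::'a) \<noteq> 0" and \<theta>: "nontrivial_additive_character \<theta>"
    and b: "b \<in> symmetric_mats n" "b \<noteq> 0\<^sub>m n n"
  shows "(\<Sum>T\<in>symmetric_mats n. \<theta> (pairing n T b)) = 0"
proof -
  let ?S = "symmetric_mats n :: 'a mat set"
  obtain U where U: "U \<in> ?S" "\<theta> (pairing n U b) \<noteq> 1"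
    using pairing_nondegenerate[OF two \<theta> b] by (auto simp: pairing_commute)
  have "bij_betw (\<lambda>T. T + U) ?S ?S"
  proof (rule bij_betw_byWitness[where f' = "\<lambda>T. T - U"])
    show "\<forall>T\<in>?S. T + U - U = T" "\<forall>T\<in>?S. T - U + U = T"
      using U(1) by (auto simp: symmetric_mats_def intro!: eq_matI)
  qed (use U(1) symmetric_mats_add symmetric_mats_minus in auto)
  then have "(\<Sum>T\<in>?S. \<theta> (pairing n T b)) = (\<Sum>T\<in>?S. \<theta> (pairing n (T + U) b))"
    by (rule sum.reindex_bij_betw[symmetric])
  also have "\<dots> = (\<Sum>T\<in>?S. \<theta> (pairing n T b) * \<theta> (pairing n U b))"
    by (rule sum.cong)
       (use U(1) in \<open>auto simp: pairing_add_left symmetric_matsD additive_character_add[OF \<theta>]\<close>)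
  also have "\<dots> = (\<Sum>T\<in>?S. \<theta> (pairing n T b)) * \<theta> (pairing n U b)"
    by (simp add: sum_distrib_right)
  finally show ?thesis using U(2) by (metis mult_cancel_left2)
qed

text \<open>The group \<open>A\<close> of the overview. It is the unipotent radical of the Siegel
  parabolic subgroup, and \<open>sym_part\<close> identifies it with the additive group of symmetric
  matrices.\<close>

definition siegel :: "nat \<Rightarrow> 'a::field mat set" where
  "siegel n = {g \<in> carrier (USp n). upper_left n g = 1\<^sub>m n}"

definition siegel_character :: "('a::field \<Rightarrow> complex) \<Rightarrow> nat \<Rightarrow> 'a mat \<Rightarrow> 'a mat \<Rightarrow> complex" where
  "siegel_character \<theta> n T g = \<theta> (pairing n T (sym_part n g))"

definition unitriangular_enum :: "nat \<Rightarrow> nat \<Rightarrow> 'a::{field,finite} mat" where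
  "unitriangular_enum n = (SOME h. bij_betw h {0..<card (unitriangular n :: 'a mat set)} (unitriangular n))"

definition usp_elem :: "nat \<Rightarrow> 'a::field mat \<Rightarrow> 'a mat \<Rightarrow> 'a mat" where
  "usp_elem n x b = (SOME g. g \<in> carrier (USp n) \<and> upper_left n g = x \<and> sym_part n g = b)"

text \<open>The block diagonal elements of \<open>U\<close>, one for each unitriangular upper left
  block, as representatives of the cosets of \<open>siegel n\<close>.\<close>

definition levi :: "nat \<Rightarrow> nat \<Rightarrow> 'a::{field,finite} mat" where
  "levi n i = usp_elem n (unitriangular_enum n i) (0\<^sub>m n n)"

lemma unitriangular_enum_bij:
  "bij_betw (unitriangular_enum n) {0..<card (unitriangular n :: 'a::{field,finite} mat set)}
     (unitriangular n :: 'a mat set)"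
  unfolding unitriangular_enum_def
  using someI_ex[OF ex_bij_betw_nat_finite[OF finite_unitriangular]] .

lemma usp_elem:
  assumes "x \<in> unitriangular n" "b \<in> symmetric_mats n"
  shows "usp_elem n x b \<in> carrier (USp n)" "upper_left n (usp_elem n x b) = x"
    "sym_part n (usp_elem n x b) = b"
proof -
  have "\<exists>g. g \<in> carrier (USp n) \<and> upper_left n g = x \<and> sym_part n g = b"
    using USp_ex_parts[OF assms] by blast
  from someI_ex[OF this]
  show "usp_elem n x b \<in> carrier (USp n)" "upper_left n (usp_elem n x b) = x"
    "sym_part n (usp_elem n x b) = b"
    unfolding usp_elem_def by auto
qed

lemma levi:
  assumes "i < card (unitriangular n :: 'a::{field,finite} mat set)"
  shows "levi n i \<in> carrier (USp n :: 'a mat monoid)" "upper_left n (levi n i) = (unitriangular_enum n i :: 'a mat)"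
    "sym_part n (levi n i) = (0\<^sub>m n n :: 'a mat)"
proof -
  have "unitriangular_enum n i \<in> (unitriangular n :: 'a mat set)"
    using bij_betwE[OF unitriangular_enum_bij[of n, where ?'a = 'a]] assms by auto
  from usp_elem[OF this symmetric_mats_zero]
  show "levi n i \<in> carrier (USp n :: 'a mat monoid)" "upper_left n (levi n i) = (unitriangular_enum n i :: 'a mat)"
    "sym_part n (levi n i) = (0\<^sub>m n n :: 'a mat)" by (auto simp: levi_def)
qed

locale usp_characters =
  fixes n N :: nat and \<theta> :: "'a::{field,finite} \<Rightarrow> complex"
  assumes N: "N = card (unitriangular n :: 'a mat set)"
    and two: "(2::'a) \<noteq> 0" and \<theta>: "nontrivial_additive_character \<theta>"
begin

abbreviation (input) G :: "'a mat monoid" where "G \<equiv> USp n"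
abbreviation (input) A :: "'a mat set" where "A \<equiv> siegel n"
abbreviation (input) UL :: "'a mat \<Rightarrow> 'a mat" where "UL \<equiv> upper_left n"
abbreviation (input) SP :: "'a mat \<Rightarrow> 'a mat" where "SP \<equiv> sym_part n"

interpretation USp: group G by (rule group_USp)

lemma UL_carrier: "g \<in> carrier G \<Longrightarrow> UL g \<in> carrier_mat n n"
  by (simp add: upper_left_unitriangular unitriangular_carrier)

lemma SP_carrier: "g \<in> carrier G \<Longrightarrow> SP g \<in> carrier_mat n n"
  using sym_part_symmetric symmetric_matsD by blast

lemma UL_inv:
  assumes g: "g \<in> carrier G"
  shows "UL (inv\<^bsub>G\<^esub> g) * UL g = 1\<^sub>m n" "UL g * UL (inv\<^bsub>G\<^esub> g) = 1\<^sub>m n"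
  using USp_mult_parts(1)[of "inv\<^bsub>G\<^esub> g" n g] USp_mult_parts(1)[of g n "inv\<^bsub>G\<^esub> g"] g
    USp_one_parts(1)[of n, where ?'a = 'a] by auto

text \<open>The upper left block is a homomorphism with kernel \<open>A\<close>, so the cosets of
  \<open>A\<close> are its fibres.\<close>

lemma UL_div_eq_one_iff:
  assumes g: "g \<in> carrier G" and h: "h \<in> carrier G"
  shows "g \<otimes>\<^bsub>G\<^esub> inv\<^bsub>G\<^esub> h \<in> A \<longleftrightarrow> UL g = UL h"
proof -
  note c = UL_carrier[OF g] UL_carrier[OF h] UL_carrier[OF USp.inv_closed[OF h]]
  have "UL (g \<otimes>\<^bsub>G\<^esub> inv\<^bsub>G\<^esub> h) = UL g * UL (inv\<^bsub>G\<^esub> h)" using g h by (simp add: USp_mult_parts)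
  moreover have "UL g * UL (inv\<^bsub>G\<^esub> h) = 1\<^sub>m n \<longleftrightarrow> UL g = UL h"
  proof
    assume "UL g * UL (inv\<^bsub>G\<^esub> h) = 1\<^sub>m n"
    then have "UL g * (UL (inv\<^bsub>G\<^esub> h) * UL h) = 1\<^sub>m n * UL h"
      using c by (simp add: assoc_mult_mat[of _ n n _ n _ n, symmetric] del: assoc_mult_mat)
    then show "UL g = UL h" using c by (simp add: UL_inv[OF h])
  qed (simp add: UL_inv[OF h])
  ultimately show ?thesis using g h by (simp add: siegel_def)
qed

lemma subgroup_siegel: "subgroup A G"
proof (rule USp.subgroupI)
  show "A \<noteq> {}" using USp_one_parts(1)[of n] USp.one_closed by (auto simp: siegel_def)
  fix a assume "a \<in> A"
  then have a: "a \<in> carrier G" "UL a = 1\<^sub>m n" by (auto simp: siegel_def)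
  then show "inv\<^bsub>G\<^esub> a \<in> A"
    using UL_inv[OF a(1)] UL_carrier[of "inv\<^bsub>G\<^esub> a"] by (simp add: siegel_def)
next
  fix a b assume "a \<in> A" "b \<in> A"
  then show "a \<otimes>\<^bsub>G\<^esub> b \<in> A" by (auto simp: siegel_def USp_mult_parts)
qed (auto simp: siegel_def)

lemma SP_mult_siegel:
  assumes "a \<in> A" "g \<in> carrier G"
  shows "SP (a \<otimes>\<^bsub>G\<^esub> g) = SP a + SP g"
  using assms SP_carrier[of g] by (auto simp: siegel_def USp_mult_parts)

lemma siegel_conjugate:
  assumes g: "g \<in> carrier G" and a: "a \<in> A"
  shows "g \<otimes>\<^bsub>G\<^esub> a \<otimes>\<^bsub>G\<^esub> inv\<^bsub>G\<^esub> g \<in> A"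
    "SP (g \<otimes>\<^bsub>G\<^esub> a \<otimes>\<^bsub>G\<^esub> inv\<^bsub>G\<^esub> g) = UL g * SP a * transpose_mat (UL g)"
proof -
  have ac: "a \<in> carrier G" "UL a = 1\<^sub>m n" using a by (auto simp: siegel_def)
  show h: "g \<otimes>\<^bsub>G\<^esub> a \<otimes>\<^bsub>G\<^esub> inv\<^bsub>G\<^esub> g \<in> A"
    using g ac UL_carrier[OF g] by (subst UL_div_eq_one_iff) (auto simp: USp_mult_parts)
  let ?h = "g \<otimes>\<^bsub>G\<^esub> a \<otimes>\<^bsub>G\<^esub> inv\<^bsub>G\<^esub> g"
  have hc: "?h \<in> carrier G" using g ac by simp
  \<comment> \<open>Comparing the symmetric parts of \<open>h g = g a\<close> avoids a formula for
    the symmetric part of an inverse.\<close>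
  have "?h \<otimes>\<^bsub>G\<^esub> g = g \<otimes>\<^bsub>G\<^esub> a" using g ac by (simp add: USp.m_assoc)
  then have "SP ?h + SP g = SP (g \<otimes>\<^bsub>G\<^esub> a)" using SP_mult_siegel[OF h g] by simp
  also have "\<dots> = SP g + UL g * SP a * transpose_mat (UL g)" using g ac by (simp add: USp_mult_parts)
  finally have "SP ?h + SP g = UL g * SP a * transpose_mat (UL g) + SP g"
    using UL_carrier[OF g] SP_carrier[OF ac(1)] SP_carrier[OF g] by (simp add: comm_add_mat[of _ n n])
  then show "SP ?h = UL g * SP a * transpose_mat (UL g)"
    using UL_carrier[OF g] SP_carrier[OF ac(1)] SP_carrier[OF g] SP_carrier[OF hc]
    by (auto simp: mat_eq_iff)
qed

lemma linear_induction_siegel: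
  assumes T: "T \<in> symmetric_mats n"
  shows "linear_induction G A (siegel_character \<theta> n T) N (levi n)"
proof (rule linear_induction.intro[OF group_USp], rule linear_induction_axioms.intro)
  show "finite (carrier G)" by (rule finite_carrier_USp)
  show "subgroup A G" by (rule subgroup_siegel)
  show "siegel_character \<theta> n T \<one>\<^bsub>G\<^esub> = 1"
    by (simp add: siegel_character_def USp_one_parts additive_character_zero[OF \<theta>])
  show "levi n i \<in> carrier G" if "i < N" for i using levi(1)[of i n] that by (simp add: N)
next
  fix a b assume ab: "a \<in> A" "b \<in> A"
  then have "a \<in> carrier G" "b \<in> carrier G" by (auto simp: siegel_def)
  then show "siegel_character \<theta> n T (a \<otimes>\<^bsub>G\<^esub> b) = siegel_character \<theta> n T a * siegel_character \<theta> n T b"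
    using ab by (simp add: siegel_character_def SP_mult_siegel pairing_add SP_carrier
        additive_character_add[OF \<theta>])
next
  fix g assume g: "g \<in> carrier G"
  have b: "bij_betw (unitriangular_enum n) {0..<N} (unitriangular n :: 'a mat set)"
    unfolding N by (rule unitriangular_enum_bij)
  have iff: "g \<otimes>\<^bsub>G\<^esub> inv\<^bsub>G\<^esub> levi n i \<in> A \<longleftrightarrow> UL g = unitriangular_enum n i" if "i < N" for i
  proof -
    have i: "i < card (unitriangular n :: 'a mat set)" using that N by simp
    show ?thesis using UL_div_eq_one_iff[OF g levi(1)[OF i]] levi(2)[OF i] by simp
  qed
  have "\<exists>!i. i \<in> {0..<N} \<and> unitriangular_enum n i = UL g"
    using b upper_left_unitriangular[OF g] unfolding bij_betw_def inj_on_def image_iff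
    by (metis (no_types, lifting) imageE)
  then show "\<exists>!i. i < N \<and> g \<otimes>\<^bsub>G\<^esub> inv\<^bsub>G\<^esub> levi n i \<in> A"
    using iff by (metis atLeastLessThan_iff zero_le)
qed

text \<open>Fourier inversion on the finite abelian group \<open>A\<close>: character sums vanish at
  every nonzero \<open>b\<close>, so the sum of the projections keeps only the term of the identity,
  and some projection is nonzero.\<close>

lemma ex_weight_vector:
  assumes irr: "irreducible_representation G d \<rho>"
  shows "\<exists>T\<in>symmetric_mats n. \<exists>v. v \<noteq> 0\<^sub>v d \<and>
    linear_induction.weight_vector A (siegel_character \<theta> n T) d \<rho> v"
proof -
  let ?S = "symmetric_mats n :: 'a mat set"
  note rho = USp.irreducible_representationD[OF irr]
  define e where "e b = usp_elem n (1\<^sub>m n) b" for b :: "'a mat"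
  have e: "e b \<in> carrier G" "UL (e b) = 1\<^sub>m n" "SP (e b) = b" if "b \<in> ?S" for b
    using usp_elem[OF one_unitriangular that] by (auto simp: e_def)
  have eA: "e b \<in> A" if "b \<in> ?S" for b using e[OF that] by (simp add: siegel_def)
  have e_add: "a \<otimes>\<^bsub>G\<^esub> e b = e (SP a + b)" if a: "a \<in> A" and b: "b \<in> ?S" for a b
  proof (rule USp_eqI)
    have ac: "a \<in> carrier G" "UL a = 1\<^sub>m n" using a by (auto simp: siegel_def)
    have s: "SP a + b \<in> ?S" using symmetric_mats_add[OF sym_part_symmetric[OF ac(1)] b] .
    show "a \<otimes>\<^bsub>G\<^esub> e b \<in> carrier G" using ac e(1)[OF b] by simp
    show "e (SP a + b) \<in> carrier G" using e(1)[OF s] .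
    show "UL (a \<otimes>\<^bsub>G\<^esub> e b) = UL (e (SP a + b))" using ac e[OF b] e[OF s] by (simp add: USp_mult_parts)
    show "SP (a \<otimes>\<^bsub>G\<^esub> e b) = SP (e (SP a + b))" using SP_mult_siegel[OF a e(1)[OF b]] e[OF b] e[OF s] by simp
  qed
  define w :: "complex vec" where "w = unit_vec d 0"
  have wc: "w \<in> carrier_vec d" by (simp add: w_def)
  have d: "0 < d" using rho(4) by simp
  \<comment> \<open>The projections of \<open>w\<close> to the \<open>A\<close>-eigenspaces; they add up to a nonzero multiple of \<open>w\<close>.\<close>
  define v where "v T = vec d (\<lambda>k. \<Sum>b\<in>?S. \<theta> (- pairing n T b) * (\<rho> (e b) *\<^sub>v w) $ k)" for T
  have weight: "\<rho> a *\<^sub>v v T = siegel_character \<theta> n T a \<cdot>\<^sub>v v T" if a: "a \<in> A" for a T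
  proof (rule eq_vecI)
    have ac: "a \<in> carrier G" using a by (auto simp: siegel_def)
    have sa: "SP a \<in> ?S" using sym_part_symmetric[OF ac] .
    have ra: "\<rho> a \<in> carrier_mat d d" using rho(1)[OF ac] .
    fix k assume "k < dim_vec (siegel_character \<theta> n T a \<cdot>\<^sub>v v T)"
    then have k: "k < d" by (simp add: v_def)
    have step: "(\<Sum>l<d. \<rho> a $$ (k, l) * (\<rho> (e b) *\<^sub>v w) $ l) = (\<rho> (e (SP a + b)) *\<^sub>v w) $ k"
      if b: "b \<in> ?S" for b
    proof -
      have rb: "\<rho> (e b) \<in> carrier_mat d d" using rho(1)[OF e(1)[OF b]] .
      have uc: "\<rho> (e b) *\<^sub>v w \<in> carrier_vec d" using rb wc by simp
      have "(\<Sum>l<d. \<rho> a $$ (k, l) * (\<rho> (e b) *\<^sub>v w) $ l) = (\<rho> a *\<^sub>v (\<rho> (e b) *\<^sub>v w)) $ k"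
        using ra uc carrier_vecD[OF uc] carrier_matD[OF ra] k
        by (simp add: scalar_prod_def atLeast0LessThan del: index_mult_mat_vec)
           (simp add: scalar_prod_def atLeast0LessThan del: assoc_mult_mat_vec)
      also have "\<rho> a *\<^sub>v (\<rho> (e b) *\<^sub>v w) = \<rho> (a \<otimes>\<^bsub>G\<^esub> e b) *\<^sub>v w"
        using rho(2)[OF ac e(1)[OF b]] assoc_mult_mat_vec[OF ra rb wc] by simp
      finally show ?thesis using e_add[OF a b] by simp
    qed
    have "(\<rho> a *\<^sub>v v T) $ k = (\<Sum>l<d. \<rho> a $$ (k, l) * (\<Sum>b\<in>?S. \<theta> (- pairing n T b) * (\<rho> (e b) *\<^sub>v w) $ l))"
      using ra k by (simp add: v_def scalar_prod_def atLeast0LessThan)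
    also have "\<dots> = (\<Sum>b\<in>?S. \<Sum>l<d. \<rho> a $$ (k, l) * (\<theta> (- pairing n T b) * (\<rho> (e b) *\<^sub>v w) $ l))"
      by (subst sum.swap) (simp only: sum_distrib_left)
    also have "\<dots> = (\<Sum>b\<in>?S. \<theta> (- pairing n T b) * (\<Sum>l<d. \<rho> a $$ (k, l) * (\<rho> (e b) *\<^sub>v w) $ l))"
      by (simp only: sum_distrib_left mult.left_commute)
    also have "\<dots> = (\<Sum>b\<in>?S. \<theta> (- pairing n T b) * (\<rho> (e (SP a + b)) *\<^sub>v w) $ k)"
      by (rule sum.cong) (simp_all only: step)
    \<comment> \<open>Written in terms of \<open>SP a + b\<close>, so that a shift of the summation
      index leaves only the eigenvalue in front.\<close>
    also have "\<dots> = (\<Sum>b\<in>?S. \<theta> (pairing n T (SP a)) * (\<theta> (- pairing n T (SP a + b)) * (\<rho> (e (SP a + b)) *\<^sub>v w) $ k))"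
    proof (rule sum.cong)
      fix b assume b: "b \<in> ?S"
      have "- pairing n T b = pairing n T (SP a) + (- pairing n T (SP a + b))"
        using pairing_add[OF symmetric_matsD(1)[OF sa] symmetric_matsD(1)[OF b], of T] by simp
      then have "\<theta> (- pairing n T b) = \<theta> (pairing n T (SP a)) * \<theta> (- pairing n T (SP a + b))"
        using additive_character_add[OF \<theta>] by metis
      then show "\<theta> (- pairing n T b) * (\<rho> (e (SP a + b)) *\<^sub>v w) $ k =
          \<theta> (pairing n T (SP a)) * (\<theta> (- pairing n T (SP a + b)) * (\<rho> (e (SP a + b)) *\<^sub>v w) $ k)"
        by (simp only: mult.assoc)
    qed simp
    also have "\<dots> = \<theta> (pairing n T (SP a)) * (\<Sum>b\<in>?S. \<theta> (- pairing n T (SP a + b)) * (\<rho> (e (SP a + b)) *\<^sub>v w) $ k)"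
      by (simp only: sum_distrib_left)
    also have "(\<Sum>b\<in>?S. \<theta> (- pairing n T (SP a + b)) * (\<rho> (e (SP a + b)) *\<^sub>v w) $ k) =
        (\<Sum>b\<in>?S. \<theta> (- pairing n T b) * (\<rho> (e b) *\<^sub>v w) $ k)"
    proof (rule sum.reindex_bij_betw)
      show "bij_betw (\<lambda>b. SP a + b) ?S ?S"
      proof (rule bij_betw_byWitness[where f' = "\<lambda>b. b - SP a"])
        show "\<forall>b\<in>?S. SP a + b - SP a = b" "\<forall>b\<in>?S. SP a + (b - SP a) = b"
          using sa by (auto simp: symmetric_mats_def intro!: eq_matI)
      qed (use sa symmetric_mats_add symmetric_mats_minus in auto)
    qed
    finally show "(\<rho> a *\<^sub>v v T) $ k = (siegel_character \<theta> n T a \<cdot>\<^sub>v v T) $ k"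
      using k by (simp add: v_def siegel_character_def)
  next
    have "a \<in> carrier G" using a by (auto simp: siegel_def)
    then show "dim_vec (\<rho> a *\<^sub>v v T) = dim_vec (siegel_character \<theta> n T a \<cdot>\<^sub>v v T)"
      using rho(1)[of a] by (simp add: v_def)
  qed
  \<comment> \<open>Coordinate 0 is enough, as \<open>w\<close> is the unit vector there.\<close>
  have "(\<Sum>T\<in>?S. v T $ 0) = (\<Sum>T\<in>?S. \<Sum>b\<in>?S. \<theta> (- pairing n T b) * (\<rho> (e b) *\<^sub>v w) $ 0)"
    using d by (simp add: v_def)
  also have "\<dots> = (\<Sum>b\<in>?S. (\<Sum>T\<in>?S. \<theta> (- pairing n T b)) * (\<rho> (e b) *\<^sub>v w) $ 0)"
    by (subst sum.swap) (simp only: sum_distrib_right)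
  also have "\<dots> = (\<Sum>b\<in>?S. if b = 0\<^sub>m n n then of_nat (card ?S) * (\<rho> (e b) *\<^sub>v w) $ 0 else 0)"
  proof (rule sum.cong)
    fix b assume b: "b \<in> ?S"
    show "(\<Sum>T\<in>?S. \<theta> (- pairing n T b)) * (\<rho> (e b) *\<^sub>v w) $ 0 =
        (if b = 0\<^sub>m n n then of_nat (card ?S) * (\<rho> (e b) *\<^sub>v w) $ 0 else 0)"
    proof (cases "b = 0\<^sub>m n n")
      case True
      then show ?thesis by (simp add: additive_character_zero[OF \<theta>])
    next
      case False
      have "- b \<in> ?S" using b by (auto simp: symmetric_mats_def transpose_uminus)
      moreover have "- b \<noteq> 0\<^sub>m n n"
      proof
        assume "- b = 0\<^sub>m n n"
        then have "- (- b) = - 0\<^sub>m n n" by simp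
        also have "- 0\<^sub>m n n = (0\<^sub>m n n :: 'a mat)" by (rule eq_matI) auto
        finally show False using False by simp
      qed
      moreover have "- pairing n T b = pairing n T (- b)" for T
        using symmetric_matsD(1)[OF b] by (simp add: pairing_def sum_negf)
      ultimately have "(\<Sum>T\<in>?S. \<theta> (- pairing n T b)) = 0"
        using character_sum_symmetric_mats[OF two \<theta>, of "- b" n] by simp
      then show ?thesis using False by simp
    qed
  qed simp
  also have "\<dots> = of_nat (card ?S) * (\<rho> (e (0\<^sub>m n n)) *\<^sub>v w) $ 0"
    by (simp add: finite_symmetric_mats symmetric_mats_zero sum.delta)
  also have "e (0\<^sub>m n n) = \<one>\<^bsub>G\<^esub>"
    by (rule USp_eqI) (use e[OF symmetric_mats_zero] in \<open>auto simp: USp_one_parts\<close>)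
  also have "(\<rho> \<one>\<^bsub>G\<^esub> *\<^sub>v w) $ 0 = 1" using d wc by (simp add: rho(3) w_def)
  finally have "(\<Sum>T\<in>?S. v T $ 0) \<noteq> 0"
    using finite_symmetric_mats[where ?'a='a] symmetric_mats_zero[of n, where ?'a='a] by (auto simp: card_eq_0_iff)
  then obtain T where T: "T \<in> ?S" "v T $ 0 \<noteq> 0" by (meson sum.neutral)
  interpret linear_induction G A "siegel_character \<theta> n T" N "levi n"
    by (rule linear_induction_siegel[OF T(1)])
  have "v T \<noteq> 0\<^sub>v d" using T(2) d by auto
  moreover have "weight_vector d \<rho> (v T)"
    unfolding weight_vector_def using weight by (auto simp: v_def)
  ultimately show ?thesis using T(1) by blast
qed

end

text \<open>The transpose of \<open>z\<close> is the inverse of \<open>z\<close>, hence upper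
  triangular, so \<open>z\<close> is upper and lower unitriangular at once.\<close>

lemma transpose_unitriangular_self_inverse:
  fixes z :: "'b::field mat"
  assumes z: "z \<in> unitriangular n" and zz: "transpose_mat z * z = 1\<^sub>m n"
  shows "z = 1\<^sub>m n"
proof -
  have zc: "z \<in> carrier_mat n n" using z by (rule unitriangular_carrier)
  then have "z * transpose_mat z = 1\<^sub>m n"
    using mat_mult_left_right_inverse[of "transpose_mat z" n z] zz by simp
  then have t: "transpose_mat z \<in> unitriangular n"
    using unitriangular_inverse[OF z] zc by simp
  show ?thesis
  proof (rule eq_matI)
    fix i j assume "i < dim_row (1\<^sub>m n)" "j < dim_col (1\<^sub>m n)"
    then have ij: "i < n" "j < n" by auto
    show "z $$ (i, j) = (1\<^sub>m n :: 'b mat) $$ (i, j)"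
    proof (cases "j \<le> i")
      case True
      then show ?thesis using z ij unfolding unitriangular_iff by auto
    next
      case False
      then have "transpose_mat z $$ (j, i) = 0" using t ij unfolding unitriangular_iff by auto
      then show ?thesis using zc ij False by simp
    qed
  qed (use zc in auto)
qed

text \<open>The stabilizer of the identity consists of the orthogonal unitriangular matrices, so it
  is trivial; multiplying by the inverse \<open>w\<close> of \<open>y\<close> reduces to it.\<close>

lemma congruence_one_inj:
  fixes x y :: "'b::field mat"
  assumes x: "x \<in> unitriangular n" and y: "y \<in> unitriangular n"
    and eq: "congruence x (1\<^sub>m n) = congruence y (1\<^sub>m n)"
  shows "x = y"
proof -
  obtain w where w: "w \<in> unitriangular n" "y * w = 1\<^sub>m n" "w * y = 1\<^sub>m n"
    using unitriangular_inverse_exists[OF y] .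
  have c: "x \<in> carrier_mat n n" "y \<in> carrier_mat n n" "w \<in> carrier_mat n n"
    using x y w by (auto simp: unitriangular_carrier)
  have "congruence (x * w) (1\<^sub>m n) = congruence (y * w) (1\<^sub>m n)"
    using c eq by (simp add: congruence_mult[of _ n])
  also have "\<dots> = 1\<^sub>m n" by (simp add: w congruence_one[of _ n])
  finally have "transpose_mat (x * w) * (x * w) = 1\<^sub>m n"
    using c by (simp add: congruence_def del: assoc_mult_mat)
  then have "x * w = 1\<^sub>m n"
    using transpose_unitriangular_self_inverse mult_unitriangular[OF x w(1)] by blast
  then have "x * (w * y) = 1\<^sub>m n * y"
    using c by (simp add: assoc_mult_mat[of _ n n _ n _ n, symmetric] del: assoc_mult_mat)
  then show ?thesis using c w by simp
qed

section \<open>The maximal degree and the characters that have it\<close>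

context usp_characters
begin

interpretation USp: group G by (rule group_USp)

text \<open>The conjugates of \<open>\<lambda>_T\<close> for \<open>T = 1\<close> have the
  parameters \<open>x^T x\<close>, which differ for different \<open>x\<close>. The nondegenerate
  pairing turns this into different characters of \<open>A\<close>, as the irreducibility criterion
  demands.\<close>

lemma ex_irreducible_degree_N: "\<exists>\<rho>. irreducible_representation G N \<rho>"
proof -
  have one: "(1\<^sub>m n :: 'a mat) \<in> symmetric_mats n" by (simp add: symmetric_mats_def)
  interpret linear_induction G A "siegel_character \<theta> n (1\<^sub>m n)" N "levi n"
    by (rule linear_induction_siegel[OF one])
  have "irreducible_representation G N induced_mat"
  proof (rule irreducible_induced_mat)
    show "g \<otimes>\<^bsub>G\<^esub> a \<otimes>\<^bsub>G\<^esub> inv\<^bsub>G\<^esub> g \<in> A" if "g \<in> carrier G" "a \<in> A" for g a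
      using siegel_conjugate(1)[OF that] .
  next
    fix i j assume ij: "i < N" "j < N" "i \<noteq> j"
    let ?x = "unitriangular_enum n i :: 'a mat" and ?y = "unitriangular_enum n j :: 'a mat"
    let ?C = "\<lambda>x :: 'a mat. congruence x (1\<^sub>m n)"
    have b: "bij_betw (unitriangular_enum n) {0..<N} (unitriangular n :: 'a mat set)"
      unfolding N by (rule unitriangular_enum_bij)
    have xy: "?x \<in> unitriangular n" "?y \<in> unitriangular n"
      using bij_betwE[OF b] ij(1,2) by simp_all
    have "?x \<noteq> ?y" using inj_onD[OF bij_betw_imp_inj_on[OF b], of i j] ij by auto
    have c: "?x \<in> carrier_mat n n" "?y \<in> carrier_mat n n"
      using xy by (auto simp: unitriangular_carrier)
    have S: "?C ?x \<in> symmetric_mats n" "?C ?y \<in> symmetric_mats n"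
      using c one by (auto simp: congruence_symmetric_mats)
    have "?C ?x - ?C ?y \<noteq> 0\<^sub>m n n"
      using congruence_one_inj[OF xy(1,2)] \<open>?x \<noteq> ?y\<close> minus_mat_eq_zero_iff(1)[of "?C ?x" n "?C ?y"] S
      by (auto simp: symmetric_matsD(1))
    then obtain b where b: "b \<in> symmetric_mats n" "\<theta> (pairing n (?C ?x - ?C ?y) b) \<noteq> 1"
      using pairing_nondegenerate[OF two \<theta> symmetric_mats_minus[OF S]] by blast
    have bc: "b \<in> carrier_mat n n" using b(1) by (rule symmetric_matsD)
    have "pairing n (?C ?x) b = pairing n (?C ?x - ?C ?y) b + pairing n (?C ?y) b"
      using S[THEN symmetric_matsD(1)] by (simp add: pairing_def sum_subtractf left_diff_distrib)
    then have "\<theta> (pairing n (?C ?x) b) = \<theta> (pairing n (?C ?x - ?C ?y) b) * \<theta> (pairing n (?C ?y) b)"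
      by (simp add: additive_character_add[OF \<theta>])
    moreover have "\<theta> (pairing n (?C ?y) b) \<noteq> 0"
      using \<theta> unfolding nontrivial_additive_character_def by blast
    ultimately have ne: "\<theta> (pairing n (?C ?x) b) \<noteq> \<theta> (pairing n (?C ?y) b)" using b(2) by simp
    define a where "a = usp_elem n (1\<^sub>m n) b"
    have a: "a \<in> A" "SP a = b" using usp_elem[OF one_unitriangular b(1)] by (auto simp: a_def siegel_def)
    have "siegel_character \<theta> n (1\<^sub>m n) (levi n k \<otimes>\<^bsub>G\<^esub> a \<otimes>\<^bsub>G\<^esub> inv\<^bsub>G\<^esub> (levi n k)) = \<theta> (pairing n (?C (unitriangular_enum n k)) b)"
      if k: "k < N" and kc: "(unitriangular_enum n k :: 'a mat) \<in> carrier_mat n n" for k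
    proof -
      have l: "levi n k \<in> carrier G" "UL (levi n k) = unitriangular_enum n k"
        using levi[of k n] k unfolding N by auto
      show ?thesis
        using siegel_conjugate(2)[OF l(1) a(1)] pairing_congruence[OF one_carrier_mat bc kc]
        by (simp add: siegel_character_def l(2) a(2) del: assoc_mult_mat)
    qed
    then show "\<exists>a\<in>A. siegel_character \<theta> n (1\<^sub>m n) (levi n i \<otimes>\<^bsub>G\<^esub> a \<otimes>\<^bsub>G\<^esub> inv\<^bsub>G\<^esub> levi n i) \<noteq>
        siegel_character \<theta> n (1\<^sub>m n) (levi n j \<otimes>\<^bsub>G\<^esub> a \<otimes>\<^bsub>G\<^esub> inv\<^bsub>G\<^esub> levi n j)"
      using ne a(1) ij c by (intro bexI[of _ a]) auto
  qed
  then show ?thesis by blast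
qed

lemma irreducible_dim_le:
  assumes irr: "irreducible_representation G d \<rho>"
  shows "d \<le> N"
proof -
  obtain T v where T: "T \<in> symmetric_mats n" and v: "v \<noteq> 0\<^sub>v d"
    "linear_induction.weight_vector A (siegel_character \<theta> n T) d \<rho> v"
    using ex_weight_vector[OF irr] by blast
  interpret linear_induction G A "siegel_character \<theta> n T" N "levi n"
    by (rule linear_induction_siegel[OF T])
  show ?thesis using weight_vector_dim_le[OF irr v(2,1)] .
qed

text \<open>From \<open>a k^-1 = k^-1 (k a k^-1)\<close>: on the translate by \<open>inv k\<close>,
  \<open>a\<close> acts as its conjugate acts on \<open>v\<close>, and conjugation changes
  \<open>T\<close> by a congruence.\<close>

lemma weight_vector_translate:
  assumes irr: "irreducible_representation G d \<rho>" and T: "T \<in> symmetric_mats n"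
    and v: "linear_induction.weight_vector A (siegel_character \<theta> n T) d \<rho> v" "v \<noteq> 0\<^sub>v d"
    and k: "k \<in> carrier G"
  shows "linear_induction.weight_vector A (siegel_character \<theta> n (congruence (UL k) T)) d \<rho>
      (\<rho> (inv\<^bsub>G\<^esub> k) *\<^sub>v v)" "\<rho> (inv\<^bsub>G\<^esub> k) *\<^sub>v v \<noteq> 0\<^sub>v d"
proof -
  have Tc: "T \<in> carrier_mat n n" using T by (rule symmetric_matsD)
  have T': "congruence (UL k) T \<in> symmetric_mats n"
    using congruence_symmetric_mats[OF UL_carrier[OF k] T] .
  interpret L: linear_induction G A "siegel_character \<theta> n T" N "levi n"
    by (rule linear_induction_siegel[OF T])
  interpret L': linear_induction G A "siegel_character \<theta> n (congruence (UL k) T)" N "levi n"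
    by (rule linear_induction_siegel[OF T'])
  note rho = USp.irreducible_representationD[OF irr]
  have vc: "v \<in> carrier_vec d" using v(1) by (simp add: L.weight_vector_def)
  have rk: "\<rho> (inv\<^bsub>G\<^esub> k) \<in> carrier_mat d d" using rho(1) k by simp
  show "L'.weight_vector d \<rho> (\<rho> (inv\<^bsub>G\<^esub> k) *\<^sub>v v)"
    unfolding L'.weight_vector_def
  proof (intro conjI ballI)
    show "\<rho> (inv\<^bsub>G\<^esub> k) *\<^sub>v v \<in> carrier_vec d" using rk vc by simp
    fix a assume a: "a \<in> A"
    then have ac: "a \<in> carrier G" by (simp add: siegel_def)
    let ?c = "k \<otimes>\<^bsub>G\<^esub> a \<otimes>\<^bsub>G\<^esub> inv\<^bsub>G\<^esub> k"
    have c: "?c \<in> A" "?c \<in> carrier G" using siegel_conjugate(1)[OF k a] k ac by auto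
    have "\<rho> a *\<^sub>v (\<rho> (inv\<^bsub>G\<^esub> k) *\<^sub>v v) = \<rho> (a \<otimes>\<^bsub>G\<^esub> inv\<^bsub>G\<^esub> k) *\<^sub>v v"
      using L.rho_vec[OF irr ac USp.inv_closed[OF k] vc] by simp
    also have "a \<otimes>\<^bsub>G\<^esub> inv\<^bsub>G\<^esub> k = inv\<^bsub>G\<^esub> k \<otimes>\<^bsub>G\<^esub> ?c"
      using k ac by (simp add: USp.m_assoc USp.inv_mult_cancel)
    also have "\<rho> \<dots> *\<^sub>v v = \<rho> (inv\<^bsub>G\<^esub> k) *\<^sub>v (\<rho> ?c *\<^sub>v v)"
      using L.rho_vec[OF irr USp.inv_closed[OF k] c(2) vc] .
    also have "\<rho> ?c *\<^sub>v v = siegel_character \<theta> n T ?c \<cdot>\<^sub>v v"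
      using v(1) c(1) by (simp add: L.weight_vector_def)
    also have "siegel_character \<theta> n T ?c = siegel_character \<theta> n (congruence (UL k) T) a"
      using siegel_conjugate(2)[OF k a] pairing_congruence[OF Tc SP_carrier[OF ac] UL_carrier[OF k]]
      by (simp add: siegel_character_def)
    finally show "\<rho> a *\<^sub>v (\<rho> (inv\<^bsub>G\<^esub> k) *\<^sub>v v) =
        siegel_character \<theta> n (congruence (UL k) T) a \<cdot>\<^sub>v (\<rho> (inv\<^bsub>G\<^esub> k) *\<^sub>v v)"
      by (simp add: mult_mat_vec[OF rk vc])
  qed
  show "\<rho> (inv\<^bsub>G\<^esub> k) *\<^sub>v v \<noteq> 0\<^sub>v d"
  proof
    assume z: "\<rho> (inv\<^bsub>G\<^esub> k) *\<^sub>v v = 0\<^sub>v d"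
    have "v = \<rho> k *\<^sub>v (\<rho> (inv\<^bsub>G\<^esub> k) *\<^sub>v v)"
      using L.rho_inv_vec[OF irr USp.inv_closed[OF k] vc] k by simp
    also have "\<dots> = 0\<^sub>v d" unfolding z using rho(1)[OF k] by (intro eq_vecI) auto
    finally show False using v(2) by simp
  qed
qed

text \<open>A nontrivial \<open>x\<close> that stabilizes \<open>T\<close> would give an element
  \<open>k\<close> outside \<open>A\<close> that preserves the one-dimensional weight space of
  \<open>T\<close>, impossible in degree \<open>N\<close>. With the stabilizer trivial, the matrix
  that reduces \<open>T\<close> also translates the weight vector to the reduced weight.\<close>

lemma max_degree_imp_reduced_form:
  assumes irr: "irreducible_representation G N \<rho>"
  shows "\<exists>T. reduced_form n T \<and>
    (\<forall>g\<in>carrier G. mat_trace (\<rho> g) = induced_character G A (siegel_character \<theta> n T) g)"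
proof -
  obtain T v where T: "T \<in> symmetric_mats n" and v: "v \<noteq> 0\<^sub>v N"
    "linear_induction.weight_vector A (siegel_character \<theta> n T) N \<rho> v"
    using ex_weight_vector[OF irr] by blast
  interpret L: linear_induction G A "siegel_character \<theta> n T" N "levi n"
    by (rule linear_induction_siegel[OF T])
  note Tc = symmetric_matsD[OF T]
  have no_stabilizer: False if x: "x \<in> unitriangular n" "x \<noteq> 1\<^sub>m n" "congruence x T = T" for x
  proof -
    define k where "k = usp_elem n x (0\<^sub>m n n)"
    have k: "k \<in> carrier G" "UL k = x"
      using usp_elem[OF x(1) symmetric_mats_zero] by (auto simp: k_def)
    have "L.weight_vector N \<rho> (\<rho> (inv\<^bsub>G\<^esub> k) *\<^sub>v v)"
      using weight_vector_translate(1)[OF irr T v(2,1) k(1)] by (simp add: k(2) x(3))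
    then obtain \<mu> where "\<rho> (inv\<^bsub>G\<^esub> k) *\<^sub>v v = \<mu> \<cdot>\<^sub>v v"
      using L.weight_vector_unique[OF irr v(2,1) refl] by metis
    then have "inv\<^bsub>G\<^esub> k \<in> A"
      using L.weight_vector_not_stabilized[OF irr v(2,1) refl] k(1) by simp
    then have "k \<in> A" using subgroup.m_inv_closed[OF subgroup_siegel, of "inv\<^bsub>G\<^esub> k"] k(1) by simp
    then show False using x(2) k(2) by (simp add: siegel_def)
  qed
  then obtain x where x: "x \<in> unitriangular n" "reduced_form n (congruence x T)"
    using stabilizer_or_reduced_form[OF two Tc] by blast
  define k where "k = usp_elem n x (0\<^sub>m n n)"
  have k: "k \<in> carrier G" "UL k = x"
    using usp_elem[OF x(1) symmetric_mats_zero] by (auto simp: k_def)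
  let ?T = "congruence x T"
  have T': "?T \<in> symmetric_mats n"
    using congruence_symmetric_mats[OF unitriangular_carrier[OF x(1)] T] .
  interpret L': linear_induction G A "siegel_character \<theta> n ?T" N "levi n"
    by (rule linear_induction_siegel[OF T'])
  have "L'.weight_vector N \<rho> (\<rho> (inv\<^bsub>G\<^esub> k) *\<^sub>v v)" "\<rho> (inv\<^bsub>G\<^esub> k) *\<^sub>v v \<noteq> 0\<^sub>v N"
    using weight_vector_translate[OF irr T v(2,1) k(1)] by (simp_all add: k(2))
  then show ?thesis using L'.character_eq_induced[OF irr _ _ refl] x(2) by blast
qed

lemma induced_degree:
  assumes "lam \<one>\<^bsub>G\<^esub> = 1"
  shows "induced_character G A lam \<one>\<^bsub>G\<^esub> = of_nat N"
proof -
  interpret linear_induction G A "siegel_character \<theta> n (0\<^sub>m n n)" N "levi n"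
    by (rule linear_induction_siegel[OF symmetric_mats_zero])
  have "card (carrier G) = card A * N"
    using bij_betw_same_card[OF bij_betw_transversal] by (simp add: card_cartesian_product)
  moreover have "finite A" using finite_carrier by (rule finite_subset[rotated]) (auto simp: siegel_def)
  then have "card A \<noteq> 0" using subgroup.one_closed[OF subgroup_siegel] by auto
  moreover have "induced_character G A lam \<one>\<^bsub>G\<^esub> = of_nat (card (carrier G)) / of_nat (card A)"
    unfolding induced_character_def
    using subgroup.one_closed[OF subgroup_siegel] assms by (simp cong: sum.cong)
  ultimately show ?thesis by simp
qed

end

section \<open>Basic subsets of the root set\<close>

text \<open>The rows of \<open>x\<close>, counted from 0, that are trivial on
  \<open>U_\<alpha>\<close> for \<alpha> in \<Gamma>. The value at \<open>Eps_Diff\<close> is a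
  dummy, as \<Gamma> has no such root.\<close>

fun root_rows :: "root \<Rightarrow> nat set" where
  "root_rows (Eps_Diff i j) = {}"
| "root_rows (Eps_Sum i j) = {i - 1, j - 1}"
| "root_rows (Eps_Double i) = {i - 1}"

lemma Gamma_cases [consumes 1, case_names Double Sum]:
  assumes "\<alpha> \<in> Gamma n"
  obtains i where "\<alpha> = Eps_Double (Suc i)" "i < n"
  | i where "\<alpha> = Eps_Sum (Suc i) (Suc (Suc i))" "Suc i < n"
proof -
  from assms consider i where "\<alpha> = Eps_Double i" "1 \<le> i" "i \<le> n"
    | i where "\<alpha> = Eps_Sum i (i + 1)" "1 \<le> i" "i < n"
    by (auto simp: Gamma_def)
  then show ?thesis
  proof cases
    case 1
    then show ?thesis using that(1)[of "i - 1"] by simp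
  next
    case 2
    then show ?thesis using that(2)[of "i - 1"] by simp
  qed
qed

lemma root_rows_less: "\<alpha> \<in> Gamma n \<Longrightarrow> i \<in> root_rows \<alpha> \<Longrightarrow> i < n"
  by (erule Gamma_cases) auto

lemma root_rows_nonempty: "\<alpha> \<in> Gamma n \<Longrightarrow> root_rows \<alpha> \<noteq> {}"
  by (erule Gamma_cases) auto

lemma entries_rows:
  assumes "\<alpha> \<in> Gamma n" "e \<in> entries \<alpha>"
  shows "\<exists>i\<in>root_rows \<alpha>. fst e = int i + 1" "\<exists>i\<in>root_rows \<alpha>. snd e = - int i - 1"
  using assms by (auto elim!: Gamma_cases)

lemma rows_entries:
  assumes "\<alpha> \<in> Gamma n" "i \<in> root_rows \<alpha>"
  shows "\<exists>e\<in>entries \<alpha>. fst e = int i + 1"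
  using assms by (auto elim!: Gamma_cases)

lemma inj_on_entries:
  assumes "\<alpha> \<in> Gamma n"
  shows "inj_on fst (entries \<alpha>)" "inj_on snd (entries \<alpha>)"
  using assms by (auto elim!: Gamma_cases)

lemma entries_disjoint:
  assumes "\<alpha> \<in> Gamma n" "\<beta> \<in> Gamma n" "e \<in> entries \<alpha>" "e \<in> entries \<beta>"
  shows "\<alpha> = \<beta>"
  using assms by (auto elim!: Gamma_cases)

definition disjoint_rows :: "root set \<Rightarrow> bool" where
  "disjoint_rows D \<longleftrightarrow> (\<forall>\<alpha>\<in>D. \<forall>\<beta>\<in>D. \<alpha> \<noteq> \<beta> \<longrightarrow> root_rows \<alpha> \<inter> root_rows \<beta> = {})"

text \<open>The entries of a root in \<Gamma> lie in rows \<open>i\<close> and columns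
  \<open>-i\<close> for the same set of labels \<open>i\<close>, so the row condition and the column
  condition coincide.\<close>

lemma basic_iff_disjoint_rows:
  assumes D: "D \<subseteq> Gamma n"
  shows "basic D \<longleftrightarrow> disjoint_rows D"
proof
  assume b: "basic D"
  show "disjoint_rows D" unfolding disjoint_rows_def
  proof (intro ballI impI, rule ccontr)
    fix \<alpha> \<beta> assume ab: "\<alpha> \<in> D" "\<beta> \<in> D" "\<alpha> \<noteq> \<beta>" "root_rows \<alpha> \<inter> root_rows \<beta> \<noteq> {}"
    then have g: "\<alpha> \<in> Gamma n" "\<beta> \<in> Gamma n" using D by auto
    obtain i where "i \<in> root_rows \<alpha>" "i \<in> root_rows \<beta>" using ab by auto
    then obtain e f where "e \<in> entries \<alpha>" "f \<in> entries \<beta>" "fst e = fst f"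
      using rows_entries g by metis
    moreover from this have "e = f" using b ab(1,2) unfolding basic_def inj_on_def by blast
    ultimately show False using entries_disjoint[OF g] ab(3) by blast
  qed
next
  assume d: "disjoint_rows D"
  have *: "\<alpha> = \<beta>" if p: "\<alpha> \<in> D" "\<beta> \<in> D" "e \<in> entries \<alpha>" "f \<in> entries \<beta>" "fst e = fst f \<or> snd e = snd f"
    for \<alpha> \<beta> e f
  proof (rule ccontr)
    assume "\<alpha> \<noteq> \<beta>"
    have g: "\<alpha> \<in> Gamma n" "\<beta> \<in> Gamma n" using D p by auto
    from p(5) have "\<exists>i. i \<in> root_rows \<alpha> \<and> i \<in> root_rows \<beta>"
    proof
      assume eq: "fst e = fst f"
      obtain i j where ij: "i \<in> root_rows \<alpha>" "fst e = int i + 1" "j \<in> root_rows \<beta>" "fst f = int j + 1"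
        using entries_rows(1)[OF g(1) p(3)] entries_rows(1)[OF g(2) p(4)] by blast
      then have "i = j" using eq by simp
      then show ?thesis using ij by blast
    next
      assume eq: "snd e = snd f"
      obtain i j where ij: "i \<in> root_rows \<alpha>" "snd e = - int i - 1" "j \<in> root_rows \<beta>" "snd f = - int j - 1"
        using entries_rows(2)[OF g(1) p(3)] entries_rows(2)[OF g(2) p(4)] by blast
      then have "i = j" using eq by simp
      then show ?thesis using ij by blast
    qed
    then show False using d p(1,2) \<open>\<alpha> \<noteq> \<beta>\<close> unfolding disjoint_rows_def by blast
  qed
  have "inj_on h (\<Union>\<alpha>\<in>D. entries \<alpha>)" if h: "h = fst \<or> h = snd" for h
  proof (rule inj_onI)
    fix e f assume "e \<in> (\<Union>\<alpha>\<in>D. entries \<alpha>)" "f \<in> (\<Union>\<alpha>\<in>D. entries \<alpha>)" and eq: "h e = h f"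
    then obtain \<alpha> \<beta> where ab: "\<alpha> \<in> D" "\<beta> \<in> D" "e \<in> entries \<alpha>" "f \<in> entries \<beta>" by auto
    then have "\<alpha> = \<beta>" using *[OF ab] eq h by auto
    moreover have "inj_on h (entries \<alpha>)" using inj_on_entries[of \<alpha> n] D ab(1) h by auto
    ultimately show "e = f" using ab(3,4) eq by (meson inj_onD)
  qed
  then show "basic D" by (simp add: basic_def)
qed

lemma disjoint_rows_insert:
  assumes "disjoint_rows D" "\<And>\<beta>. \<beta> \<in> D \<Longrightarrow> root_rows \<alpha> \<inter> root_rows \<beta> = {}"
  shows "disjoint_rows (insert \<alpha> D)"
  using assms unfolding disjoint_rows_def by blast

text \<open>If row \<open>i\<close> is free, \<open>Eps_Double\<close> can be added there. If no row
  is free, every further root meets an occupied one.\<close>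

lemma maximal_basic_iff:
  assumes D: "D \<subseteq> Gamma n"
  shows "maximal_basic (Gamma n) D \<longleftrightarrow> disjoint_rows D \<and> (\<forall>i<n. \<exists>\<alpha>\<in>D. i \<in> root_rows \<alpha>)"
proof
  assume m: "maximal_basic (Gamma n) D"
  then have d: "disjoint_rows D" using basic_iff_disjoint_rows[OF D] by (simp add: maximal_basic_def)
  moreover have "\<exists>\<alpha>\<in>D. i \<in> root_rows \<alpha>" if i: "i < n" for i
  proof (rule ccontr)
    assume no: "\<not> (\<exists>\<alpha>\<in>D. i \<in> root_rows \<alpha>)"
    let ?D = "insert (Eps_Double (Suc i)) D"
    have sub: "?D \<subseteq> Gamma n" using D i by (auto simp: Gamma_def)
    have "disjoint_rows ?D" using no by (intro disjoint_rows_insert d) auto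
    then have "basic ?D" using basic_iff_disjoint_rows[OF sub] by simp
    then have "?D = D" using m sub unfolding maximal_basic_def by blast
    then have "Eps_Double (Suc i) \<in> D" by blast
    then show False using no by force
  qed
  ultimately show "disjoint_rows D \<and> (\<forall>i<n. \<exists>\<alpha>\<in>D. i \<in> root_rows \<alpha>)" by blast
next
  assume *: "disjoint_rows D \<and> (\<forall>i<n. \<exists>\<alpha>\<in>D. i \<in> root_rows \<alpha>)"
  have "D' \<subseteq> D" if D': "D' \<subseteq> Gamma n" "basic D'" "D \<subseteq> D'" for D'
  proof
    fix \<alpha> assume \<alpha>: "\<alpha> \<in> D'"
    then have g: "\<alpha> \<in> Gamma n" using D' by auto
    obtain i where i: "i \<in> root_rows \<alpha>" using root_rows_nonempty[OF g] by auto
    then obtain \<beta> where b: "\<beta> \<in> D" "i \<in> root_rows \<beta>" using * root_rows_less[OF g] by blast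
    have "disjoint_rows D'" using D' basic_iff_disjoint_rows by simp
    then have "\<alpha> = \<beta>" using i b \<alpha> D'(3) unfolding disjoint_rows_def by blast
    then show "\<alpha> \<in> D" using b by simp
  qed
  then show "maximal_basic (Gamma n) D"
    using * D basic_iff_disjoint_rows[OF D] unfolding maximal_basic_def by blast
qed

text \<open>\<open>Eps_Double n\<close> occupies nothing but the last row, so the two alternatives
  together say that every other row is covered. This is the form in which the condition can be
  compared with \<open>reduced_form\<close>.\<close>

lemma maximal_basic_up_to_last_iff:
  assumes D: "D \<subseteq> Gamma n" and n: "1 \<le> n"
  shows "basic D \<and> (maximal_basic (Gamma n) D \<or> maximal_basic (Gamma n) (D \<union> {Eps_Double n})) \<longleftrightarrow>
    disjoint_rows D \<and> (\<forall>i. Suc i < n \<longrightarrow> (\<exists>\<alpha>\<in>D. i \<in> root_rows \<alpha>))"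
proof -
  have D': "D \<union> {Eps_Double n} \<subseteq> Gamma n" using D n by (auto simp: Gamma_def)
  show ?thesis
  proof (intro iffI conjI allI impI; (elim conjE)?)
    assume "basic D" then show "disjoint_rows D" using basic_iff_disjoint_rows[OF D] by simp
  next
    fix i assume "maximal_basic (Gamma n) D \<or> maximal_basic (Gamma n) (D \<union> {Eps_Double n})" and i: "Suc i < n"
    then have "\<exists>\<alpha>\<in>D \<union> {Eps_Double n}. i \<in> root_rows \<alpha>"
      unfolding maximal_basic_iff[OF D] maximal_basic_iff[OF D'] by (meson Suc_lessD UnI1)
    then show "\<exists>\<alpha>\<in>D. i \<in> root_rows \<alpha>" using i by auto
  next
    assume "disjoint_rows D" then show "basic D" using basic_iff_disjoint_rows[OF D] by simp
  next
    assume d: "disjoint_rows D" and c: "\<forall>i. Suc i < n \<longrightarrow> (\<exists>\<alpha>\<in>D. i \<in> root_rows \<alpha>)"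
    show "maximal_basic (Gamma n) D \<or> maximal_basic (Gamma n) (D \<union> {Eps_Double n})"
    proof (cases "\<exists>\<alpha>\<in>D. n - 1 \<in> root_rows \<alpha>")
      case True
      have "\<exists>\<alpha>\<in>D. i \<in> root_rows \<alpha>" if "i < n" for i
        using c True that by (cases "Suc i < n") (auto dest: Suc_lessI simp: less_Suc_eq)
      then show ?thesis using d maximal_basic_iff[OF D] by blast
    next
      case False
      have "disjoint_rows (insert (Eps_Double n) D)" using False by (intro disjoint_rows_insert d) auto
      moreover have "\<exists>\<alpha>\<in>D \<union> {Eps_Double n}. i \<in> root_rows \<alpha>" if i: "i < n" for i
      proof (cases "Suc i < n")
        case False
        then have "i = n - 1" using i by simp
        then show ?thesis by simp
      qed (use c in blast)
      ultimately show ?thesis using maximal_basic_iff[OF D'] by simp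
    qed
  qed
qed

section \<open>Products of elementary supercharacters\<close>

text \<open>The place in \<open>b\<close>, counted from 0, that the linear character of a root in
  \<Gamma> reads. The value at \<open>Eps_Diff\<close> is again a dummy.\<close>

fun root_index :: "root \<Rightarrow> nat \<times> nat" where
  "root_index (Eps_Diff i j) = (i - 1, j - 1)"
| "root_index (Eps_Sum i j) = (i - 1, j - 1)"
| "root_index (Eps_Double i) = (i - 1, i - 1)"

lemma root_index_rows:
  assumes "\<alpha> \<in> Gamma n"
  shows "fst (root_index \<alpha>) \<in> root_rows \<alpha>" "snd (root_index \<alpha>) \<in> root_rows \<alpha>"
  using assms by (auto elim!: Gamma_cases)

lemma finite_Gamma: "finite (Gamma n)"
proof (rule finite_subset)
  show "Gamma n \<subseteq> Eps_Double ` {..n} \<union> (\<lambda>i. Eps_Sum i (i + 1)) ` {..n}"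
    by (auto simp: Gamma_def)
qed simp

lemma additive_character_sum:
  assumes "nontrivial_additive_character \<theta>" "finite I"
  shows "\<theta> (\<Sum>i\<in>I. f i) = (\<Prod>i\<in>I. \<theta> (f i))"
  using assms(2) by (induction I)
    (auto simp: additive_character_zero[OF assms(1)] additive_character_add[OF assms(1)])

lemma induced_character_cong:
  assumes "\<And>h. h \<in> H \<Longrightarrow> f h = f' h"
  shows "induced_character G H f g = induced_character G H f' g"
  unfolding induced_character_def using assms by (simp cong: if_cong)

definition row_trivial :: "nat \<Rightarrow> nat \<Rightarrow> 'a::{zero,one} mat \<Rightarrow> bool" where
  "row_trivial n i g \<longleftrightarrow> (\<forall>k<n. upper_left n g $$ (i, k) = (if k = i then 1 else 0))"

context usp_characters
begin

interpretation USp: group G by (rule group_USp)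

lemma row_trivial_mult:
  assumes g: "g \<in> carrier G" and h: "h \<in> carrier G" and i: "i < n" "row_trivial n i g" and k: "k < n"
  shows "UL (g \<otimes>\<^bsub>G\<^esub> h) $$ (i, k) = UL h $$ (i, k)"
proof -
  have "UL (g \<otimes>\<^bsub>G\<^esub> h) $$ (i, k) = (\<Sum>l<n. UL g $$ (i, l) * UL h $$ (l, k))"
    using UL_carrier[OF g] UL_carrier[OF h] i k g h
    by (simp add: USp_mult_parts scalar_prod_def atLeast0LessThan)
  also have "\<dots> = (\<Sum>l<n. if l = i then UL h $$ (i, k) else 0)"
    by (rule sum.cong) (use i in \<open>auto simp: row_trivial_def\<close>)
  finally show ?thesis using i by simp
qed

text \<open>Row \<open>i\<close> of a product depends on the first factor only through its row
  \<open>i\<close>; so \<open>g\<close> may be replaced by \<open>h\<close> there, leaving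
  \<open>h h^-1\<close>.\<close>

lemma row_trivial_div:
  assumes g: "g \<in> carrier G" and h: "h \<in> carrier G" and i: "i < n"
    and eq: "\<And>k. k < n \<Longrightarrow> UL g $$ (i, k) = UL h $$ (i, k)"
  shows "row_trivial n i (g \<otimes>\<^bsub>G\<^esub> inv\<^bsub>G\<^esub> h)"
  unfolding row_trivial_def
proof (intro allI impI)
  fix k assume k: "k < n"
  have h': "inv\<^bsub>G\<^esub> h \<in> carrier G" using h by simp
  note c = UL_carrier[OF g] UL_carrier[OF h] UL_carrier[OF h']
  have "UL (g \<otimes>\<^bsub>G\<^esub> inv\<^bsub>G\<^esub> h) $$ (i, k) = (\<Sum>l<n. UL g $$ (i, l) * UL (inv\<^bsub>G\<^esub> h) $$ (l, k))"
    using c i k g h' by (simp add: USp_mult_parts scalar_prod_def atLeast0LessThan)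
  also have "\<dots> = (\<Sum>l<n. UL h $$ (i, l) * UL (inv\<^bsub>G\<^esub> h) $$ (l, k))"
    by (rule sum.cong) (auto simp: eq)
  also have "\<dots> = (UL h * UL (inv\<^bsub>G\<^esub> h)) $$ (i, k)"
    using c i k by (simp add: scalar_prod_def atLeast0LessThan)
  also have "\<dots> = (if k = i then 1 else 0)" using UL_inv(2)[OF h] i k by simp
  finally show "UL (g \<otimes>\<^bsub>G\<^esub> inv\<^bsub>G\<^esub> h) $$ (i, k) = (if k = i then 1 else 0)" .
qed

lemma row_trivial_iff_entries:
  assumes g: "g \<in> carrier G" and i: "i < n"
  shows "row_trivial n i g \<longleftrightarrow>
    (\<forall>k. Suc i < k \<and> k \<le> n \<longrightarrow> entry n g (int (Suc i)) (int k) = 0)"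
proof -
  have e: "entry n g (int (Suc i)) (int (Suc k)) = UL g $$ (i, k)" if "k < n" for k
    using that i by (simp add: entry_def pos_def upper_left_def)
  have u: "UL g $$ (i, k) = (if k = i then 1 else 0)" if "k \<le> i" for k
    using upper_left_unitriangular[OF g] i that unfolding unitriangular_iff by auto
  show ?thesis
  proof (intro iffI allI impI)
    fix k assume r: "row_trivial n i g" and k: "Suc i < k \<and> k \<le> n"
    then show "entry n g (int (Suc i)) (int k) = 0"
      using e[of "k - 1"] unfolding row_trivial_def by auto
  next
    assume r: "\<forall>k. Suc i < k \<and> k \<le> n \<longrightarrow> entry n g (int (Suc i)) (int k) = 0"
    show "row_trivial n i g" unfolding row_trivial_def
    proof (intro allI impI)
      fix k assume k: "k < n"
      show "UL g $$ (i, k) = (if k = i then 1 else 0)"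
      proof (cases "k \<le> i")
        case False
        then have "entry n g (int (Suc i)) (int (Suc k)) = 0" using r[rule_format, of "Suc k"] k by simp
        then show ?thesis using e[OF k] False by simp
      qed (rule u)
    qed
  qed
qed

lemma mem_root_subgroup_iff:
  assumes "\<alpha> \<in> Gamma n"
  shows "g \<in> root_subgroup n \<alpha> \<longleftrightarrow> g \<in> carrier G \<and> (\<forall>i\<in>root_rows \<alpha>. row_trivial n i g)"
  using assms
proof (cases rule: Gamma_cases)
  case (Double i)
  then show ?thesis using row_trivial_iff_entries[of g i] by auto
next
  case (Sum i)
  then show ?thesis using row_trivial_iff_entries[of g i] row_trivial_iff_entries[of g "Suc i"] by auto
qed

lemma subgroup_root_subgroup:
  assumes \<alpha>: "\<alpha> \<in> Gamma n"
  shows "subgroup (root_subgroup n \<alpha>) G"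
proof (rule USp.subgroupI)
  have "row_trivial n i \<one>\<^bsub>G\<^esub>" if "i < n" for i
    using that by (auto simp: row_trivial_def USp_one_parts)
  then have "\<one>\<^bsub>G\<^esub> \<in> root_subgroup n \<alpha>"
    using root_rows_less[OF \<alpha>] by (simp add: mem_root_subgroup_iff[OF \<alpha>])
  then show "root_subgroup n \<alpha> \<noteq> ({} :: 'a mat set)" by blast
next
  fix a :: "'a mat" assume "a \<in> root_subgroup n \<alpha>"
  then have a: "a \<in> carrier G" "\<And>i. i \<in> root_rows \<alpha> \<Longrightarrow> row_trivial n i a"
    by (simp_all add: mem_root_subgroup_iff[OF \<alpha>])
  have "row_trivial n i (inv\<^bsub>G\<^esub> a)" if i: "i \<in> root_rows \<alpha>" for i
  proof -
    have "UL \<one>\<^bsub>G\<^esub> $$ (i, k) = UL a $$ (i, k)" if "k < n" for k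
      using a(2)[OF i] that root_rows_less[OF \<alpha> i] by (simp add: row_trivial_def USp_one_parts)
    from row_trivial_div[OF USp.one_closed a(1) root_rows_less[OF \<alpha> i] this]
    show ?thesis using a(1) by simp
  qed
  then show "inv\<^bsub>G\<^esub> a \<in> root_subgroup n \<alpha>"
    using a(1) by (simp add: mem_root_subgroup_iff[OF \<alpha>])
next
  fix a b :: "'a mat" assume "a \<in> root_subgroup n \<alpha>" "b \<in> root_subgroup n \<alpha>"
  then have ab: "a \<in> carrier G" "b \<in> carrier G"
    and triv: "\<And>i. i \<in> root_rows \<alpha> \<Longrightarrow> row_trivial n i a" "\<And>i. i \<in> root_rows \<alpha> \<Longrightarrow> row_trivial n i b"
    by (simp_all add: mem_root_subgroup_iff[OF \<alpha>])
  have "row_trivial n i (a \<otimes>\<^bsub>G\<^esub> b)" if i: "i \<in> root_rows \<alpha>" for i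
    using row_trivial_mult[OF ab root_rows_less[OF \<alpha> i] triv(1)[OF i]] triv(2)[OF i]
    by (simp add: row_trivial_def)
  then show "a \<otimes>\<^bsub>G\<^esub> b \<in> root_subgroup n \<alpha>"
    using ab by (simp add: mem_root_subgroup_iff[OF \<alpha>])
qed (simp add: mem_root_subgroup_iff[OF \<alpha>] subset_iff)

lemma root_character_eq:
  assumes \<alpha>: "\<alpha> \<in> Gamma n" and g: "g \<in> root_subgroup n \<alpha>"
  shows "root_character \<theta> n \<alpha> r g = \<theta> (r * SP g $$ root_index \<alpha>)"
proof -
  have gc: "g \<in> carrier G" and triv: "\<And>i. i \<in> root_rows \<alpha> \<Longrightarrow> row_trivial n i g"
    using g by (auto simp: mem_root_subgroup_iff[OF \<alpha>])
  have e: "entry n g (int (Suc i)) (- int (Suc j)) = SP g $$ (i, j)"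
    if ij: "i < n" "j < n" "j \<in> root_rows \<alpha>" for i j
  proof -
    have "pos n (- int (Suc j)) = 2 * n - 1 - j" "pos n (int (Suc i)) = i"
      using ij by (auto simp: pos_def)
    then have "entry n g (int (Suc i)) (- int (Suc j)) = upper_right n g $$ (i, j)"
      using ij by (simp only: entry_def upper_right_def) simp
    also have "\<dots> = SP g $$ (i, j)"
      using sym_part_eq_upper_right[OF gc ij(1,2)] triv[OF ij(3)] by (simp add: row_trivial_def)
    finally show ?thesis .
  qed
  from \<alpha> show ?thesis
  proof (cases rule: Gamma_cases)
    case (Double i)
    then have "\<alpha> \<in> Phi n" by (simp add: Phi_def)
    then show ?thesis using Double e[of i i] main_entry_simps(3)[of "Suc i" n]
      by (simp add: root_character_def)
  next
    case (Sum i)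
    then have "\<alpha> \<in> Phi n" by (simp add: Phi_def)
    then show ?thesis using Sum e[of i "Suc i"] main_entry_simps(2)[of "Suc i" "Suc (Suc i)" n]
      by (simp add: root_character_def)
  qed
qed

text \<open>By the product formula the entry \<open>(i, j)\<close> of \<open>b\<close> grows by that
  of \<open>x b' x^T\<close>. This is \<open>b'_ij\<close>, because rows \<open>i\<close> and
  \<open>j\<close> of \<open>x\<close> are trivial on \<open>U_\<alpha>\<close>.\<close>

lemma root_character_mult:
  assumes \<alpha>: "\<alpha> \<in> Gamma n" and a: "a \<in> root_subgroup n \<alpha>" and b: "b \<in> root_subgroup n \<alpha>"
  shows "root_character \<theta> n \<alpha> r (a \<otimes>\<^bsub>G\<^esub> b) = root_character \<theta> n \<alpha> r a * root_character \<theta> n \<alpha> r b"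
proof -
  have c: "a \<in> carrier G" "b \<in> carrier G" and triv: "\<And>i. i \<in> root_rows \<alpha> \<Longrightarrow> row_trivial n i a"
    using a b by (auto simp: mem_root_subgroup_iff[OF \<alpha>])
  obtain i j where ij: "root_index \<alpha> = (i, j)" by fastforce
  then have rows: "i \<in> root_rows \<alpha>" "j \<in> root_rows \<alpha>" using root_index_rows[OF \<alpha>] by auto
  then have l: "i < n" "j < n" using root_rows_less[OF \<alpha>] by auto
  define M where "M = SP b * transpose_mat (UL a)"
  note ac = UL_carrier[OF c(1)] and bc = SP_carrier[OF c(2)]
  have M: "M \<in> carrier_mat n n" using ac bc by (simp add: M_def)
  have "(UL a * SP b * transpose_mat (UL a)) $$ (i, j) = (UL a * M) $$ (i, j)"
    unfolding M_def using ac bc by (simp add: assoc_mult_mat[of _ n n _ n _ n])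
  also have "\<dots> = (\<Sum>k<n. UL a $$ (i, k) * M $$ (k, j))"
    using ac M l by (simp add: scalar_prod_def atLeast0LessThan)
  also have "\<dots> = (\<Sum>k<n. if k = i then M $$ (i, j) else 0)"
    by (rule sum.cong) (use triv[OF rows(1)] in \<open>auto simp: row_trivial_def\<close>)
  also have "\<dots> = M $$ (i, j)" using l by simp
  also have "\<dots> = (\<Sum>k<n. SP b $$ (i, k) * UL a $$ (j, k))"
    using ac bc l by (simp add: M_def scalar_prod_def atLeast0LessThan)
  also have "\<dots> = (\<Sum>k<n. if k = j then SP b $$ (i, j) else 0)"
    by (rule sum.cong) (use triv[OF rows(2)] in \<open>auto simp: row_trivial_def\<close>)
  also have "\<dots> = SP b $$ (i, j)" using l by simp
  finally have "SP (a \<otimes>\<^bsub>G\<^esub> b) $$ (i, j) = SP a $$ (i, j) + SP b $$ (i, j)"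
    using ac bc SP_carrier[OF c(1)] l c by (simp add: USp_mult_parts del: assoc_mult_mat)
  then show ?thesis
    using root_character_eq[OF \<alpha>] a b subgroup.m_closed[OF subgroup_root_subgroup[OF \<alpha>] a b]
    by (simp add: ij distrib_left additive_character_add[OF \<theta>])
qed

lemma root_character_one:
  assumes \<alpha>: "\<alpha> \<in> Gamma n"
  shows "root_character \<theta> n \<alpha> r \<one>\<^bsub>G\<^esub> = 1"
proof -
  obtain i j where ij: "root_index \<alpha> = (i, j)" by fastforce
  then have "i < n" "j < n" using root_index_rows[OF \<alpha>] root_rows_less[OF \<alpha>] by auto
  then show ?thesis
    using root_character_eq[OF \<alpha> subgroup.one_closed[OF subgroup_root_subgroup[OF \<alpha>]]]
    by (simp add: ij USp_one_parts additive_character_zero[OF \<theta>])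
qed

lemma supercharacter_eq_induced:
  assumes D: "D \<subseteq> Gamma n" and disj: "disjoint_rows D"
    and cover: "\<And>i. Suc i < n \<Longrightarrow> \<exists>\<alpha>\<in>D. i \<in> root_rows \<alpha>" and g: "g \<in> carrier G"
  shows "supercharacter \<theta> n D \<phi> g =
    induced_character G A (\<lambda>h. \<Prod>\<alpha>\<in>D. root_character \<theta> n \<alpha> (\<phi> \<alpha>) h) g"
proof -
  have inter: "{h \<in> carrier G. \<forall>\<alpha>\<in>D. h \<in> root_subgroup n \<alpha>} = A"
  proof (intro equalityI subsetI)
    fix h assume "h \<in> {h \<in> carrier G. \<forall>\<alpha>\<in>D. h \<in> root_subgroup n \<alpha>}"
    then have h: "h \<in> carrier G" and hD: "\<And>\<alpha>. \<alpha> \<in> D \<Longrightarrow> h \<in> root_subgroup n \<alpha>" by simp_all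
    have K: "row_trivial n i h" if "\<alpha> \<in> D" "i \<in> root_rows \<alpha>" for \<alpha> i
      using hD[OF that(1)] mem_root_subgroup_iff[OF subsetD[OF D that(1)]] that(2) by simp
    have "UL h = 1\<^sub>m n"
    proof (rule eq_matI)
      fix i k assume "i < dim_row (1\<^sub>m n)" "k < dim_col (1\<^sub>m n)"
      then have ik: "i < n" "k < n" by auto
      show "UL h $$ (i, k) = (1\<^sub>m n :: 'a mat) $$ (i, k)"
      proof (cases "Suc i < n")
        case True
        then show ?thesis using cover[OF True] K ik unfolding row_trivial_def by auto
      next
        case False
        \<comment> \<open>The last row, which no root in \<open>D\<close> has to cover:
          unitriangularity alone fixes its entries.\<close>
        then have "k \<le> i" using ik by simp
        then show ?thesis using upper_left_unitriangular[OF h] ik unfolding unitriangular_iff by auto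
      qed
    qed (use UL_carrier[OF h] in auto)
    with h show "h \<in> A" by (simp add: siegel_def)
  next
    fix h assume "h \<in> A"
    then have h: "h \<in> carrier G" "UL h = 1\<^sub>m n" by (auto simp: siegel_def)
    then have "row_trivial n i h" if "i < n" for i using that by (auto simp: row_trivial_def)
    then show "h \<in> {h \<in> carrier G. \<forall>\<alpha>\<in>D. h \<in> root_subgroup n \<alpha>}"
      using h(1) D root_rows_less by (auto simp: subset_iff mem_root_subgroup_iff)
  qed
  have lift: "\<exists>y\<in>carrier G. \<forall>\<alpha>\<in>D. y \<otimes>\<^bsub>G\<^esub> inv\<^bsub>G\<^esub> (x \<alpha>) \<in> root_subgroup n \<alpha>"
    if x: "x \<in> D \<rightarrow> carrier G" for x
  proof -
    \<comment> \<open>Assembled row by row: row \<open>i\<close> is taken from the element attached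
      to the root that occupies \<open>i\<close>, unique by disjointness, and is trivial if there is
      none. Any element with this upper left block lies in all the prescribed cosets.\<close>
    define u where "u = mat n n (\<lambda>(i, k). if \<exists>\<alpha>\<in>D. i \<in> root_rows \<alpha>
      then UL (x (SOME \<alpha>. \<alpha> \<in> D \<and> i \<in> root_rows \<alpha>)) $$ (i, k) else if k = i then 1 else 0)"
    have u: "u $$ (i, k) = UL (x \<alpha>) $$ (i, k)" if "\<alpha> \<in> D" "i \<in> root_rows \<alpha>" "k < n" for \<alpha> i k
    proof -
      have "(SOME \<alpha>. \<alpha> \<in> D \<and> i \<in> root_rows \<alpha>) = \<alpha>"
        by (rule some_equality) (use that disj in \<open>auto simp: disjoint_rows_def\<close>)
      moreover have "i < n" using root_rows_less D that by blast
      moreover have "\<exists>\<alpha>\<in>D. i \<in> root_rows \<alpha>" using that by blast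
      ultimately show ?thesis using that(3) by (simp add: u_def)
    qed
    have "u \<in> unitriangular n" unfolding unitriangular_iff
    proof (intro conjI allI impI)
      show "u \<in> carrier_mat n n" by (simp add: u_def)
      fix i k assume ik: "i < n" "k \<le> i"
      show "u $$ (i, k) = (if i = k then 1 else 0)"
      proof (cases "\<exists>\<alpha>\<in>D. i \<in> root_rows \<alpha>")
        case True
        then obtain \<alpha> where a: "\<alpha> \<in> D" "i \<in> root_rows \<alpha>" by blast
        then have "UL (x \<alpha>) \<in> unitriangular n" using x upper_left_unitriangular by blast
        then show ?thesis using u[OF a, of k] ik unfolding unitriangular_iff by auto
      qed (use ik in \<open>auto simp: u_def\<close>)
    qed
    note y = usp_elem[OF this symmetric_mats_zero]
    show ?thesis
    proof (intro bexI[OF _ y(1)] ballI)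
      fix \<alpha> assume a: "\<alpha> \<in> D"
      then have xc: "x \<alpha> \<in> carrier G" and aG: "\<alpha> \<in> Gamma n" using x D by auto
      have "row_trivial n i (usp_elem n u (0\<^sub>m n n) \<otimes>\<^bsub>G\<^esub> inv\<^bsub>G\<^esub> (x \<alpha>))" if "i \<in> root_rows \<alpha>" for i
        by (rule row_trivial_div[OF y(1) xc root_rows_less[OF aG that]])
           (use u[OF a that] y(2) in auto)
      then show "usp_elem n u (0\<^sub>m n n) \<otimes>\<^bsub>G\<^esub> inv\<^bsub>G\<^esub> (x \<alpha>) \<in> root_subgroup n \<alpha>"
        using y(1) xc by (simp add: mem_root_subgroup_iff[OF aG])
    qed
  qed
  have "supercharacter \<theta> n D \<phi> g =
      (\<Prod>\<alpha>\<in>D. induced_character G (root_subgroup n \<alpha>) (root_character \<theta> n \<alpha> (\<phi> \<alpha>)) g)"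
    by (simp add: supercharacter_def elementary_supercharacter_def)
  also have "\<dots> = induced_character G {h \<in> carrier G. \<forall>\<alpha>\<in>D. h \<in> root_subgroup n \<alpha>}
      (\<lambda>h. \<Prod>\<alpha>\<in>D. root_character \<theta> n \<alpha> (\<phi> \<alpha>) h) g"
  proof (rule USp.prod_induced_character[OF finite_carrier_USp finite_subset[OF D finite_Gamma] _ _ _ lift g])
    show "subgroup (root_subgroup n \<alpha>) G" if "\<alpha> \<in> D" for \<alpha>
      using subgroup_root_subgroup D that by blast
    show "root_character \<theta> n \<alpha> (\<phi> \<alpha>) (a \<otimes>\<^bsub>G\<^esub> b) =
        root_character \<theta> n \<alpha> (\<phi> \<alpha>) a * root_character \<theta> n \<alpha> (\<phi> \<alpha>) b"
      if "\<alpha> \<in> D" "a \<in> root_subgroup n \<alpha>" "b \<in> root_subgroup n \<alpha>" for \<alpha> a b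
      using root_character_mult D that by blast
    show "root_character \<theta> n \<alpha> (\<phi> \<alpha>) \<one>\<^bsub>G\<^esub> = 1" if "\<alpha> \<in> D" for \<alpha>
      using root_character_one D that by blast
  qed
  finally show ?thesis by (simp only: inter)
qed

lemma supercharacter_degree:
  assumes D: "D \<subseteq> Gamma n" and "disjoint_rows D"
    and "\<And>i. Suc i < n \<Longrightarrow> \<exists>\<alpha>\<in>D. i \<in> root_rows \<alpha>"
  shows "supercharacter \<theta> n D \<phi> \<one>\<^bsub>G\<^esub> = of_nat N"
proof -
  have "supercharacter \<theta> n D \<phi> \<one>\<^bsub>G\<^esub> =
      induced_character G A (\<lambda>h. \<Prod>\<alpha>\<in>D. root_character \<theta> n \<alpha> (\<phi> \<alpha>) h) \<one>\<^bsub>G\<^esub>"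
    by (rule supercharacter_eq_induced[OF assms USp.one_closed])
  also have "\<dots> = of_nat N"
  proof (rule induced_degree)
    show "(\<Prod>\<alpha>\<in>D. root_character \<theta> n \<alpha> (\<phi> \<alpha>) \<one>\<^bsub>G\<^esub>) = 1"
      using root_character_one D by (intro prod.neutral) blast
  qed
  finally show ?thesis .
qed

end

section \<open>From reduced forms to pairs of a basic set and a coefficient map\<close>

definition roots_of_form :: "nat \<Rightarrow> 'a::zero mat \<Rightarrow> root set" where
  "roots_of_form n T = {Eps_Double (Suc i) | i. i < n \<and> T $$ (i, i) \<noteq> 0}
     \<union> {Eps_Sum (Suc i) (Suc (Suc i)) | i. Suc i < n \<and> T $$ (i, Suc i) \<noteq> 0}"

text \<open>The factor 2 collects the two symmetric entries \<open>(i, i + 1)\<close> and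
  \<open>(i + 1, i)\<close>, of which the linear character reads only the first. The value at
  \<open>Eps_Diff\<close> is a dummy.\<close>

fun root_coeff :: "'a::semiring_1 mat \<Rightarrow> root \<Rightarrow> 'a" where
  "root_coeff T (Eps_Diff i j) = 0"
| "root_coeff T (Eps_Sum i j) = (1 + 1) * T $$ (i - 1, j - 1)"
| "root_coeff T (Eps_Double i) = T $$ (i - 1, i - 1)"

lemma roots_of_form_subset: "roots_of_form n T \<subseteq> Gamma n"
  by (auto simp: roots_of_form_def Gamma_def)

text \<open>A root that occupies row \<open>i\<close> can be recovered from a nonzero entry of
  \<open>T\<close> in that row. As a reduced form has at most one such entry, two roots never share
  a row.\<close>

lemma mem_roots_of_form_rowD:
  assumes T: "reduced_form n T" and "\<alpha> \<in> roots_of_form n T" "i \<in> root_rows \<alpha>"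
  shows "\<exists>j<n. T $$ (i, j) \<noteq> 0 \<and> \<alpha> = (if i = j then Eps_Double (Suc i)
    else Eps_Sum (Suc (min i j)) (Suc (Suc (min i j))))"
proof -
  have s: "T $$ (Suc k, k) = T $$ (k, Suc k)" if "Suc k < n" for k
    using T that transpose_eq_imp_index[of T n "Suc k" k] unfolding reduced_form_def by simp
  from assms(2) consider k where "\<alpha> = Eps_Double (Suc k)" "k < n" "T $$ (k, k) \<noteq> 0"
    | k where "\<alpha> = Eps_Sum (Suc k) (Suc (Suc k))" "Suc k < n" "T $$ (k, Suc k) \<noteq> 0"
    by (auto simp: roots_of_form_def)
  then show ?thesis
  proof cases
    case 1
    then show ?thesis using assms(3) by (intro exI[of _ k]) auto
  next
    case 2
    then consider "i = k" | "i = Suc k" using assms(3) by auto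
    then show ?thesis
    proof cases
      case 1
      then show ?thesis using 2 by (intro exI[of _ "Suc k"]) auto
    next
      case 2
      then show ?thesis using \<open>\<alpha> = _\<close> \<open>Suc k < n\<close> \<open>T $$ (k, Suc k) \<noteq> 0\<close> s by (intro exI[of _ k]) auto
    qed
  qed
qed

lemma disjoint_rows_roots_of_form:
  assumes T: "reduced_form n T"
  shows "disjoint_rows (roots_of_form n T)"
  unfolding disjoint_rows_def
proof (intro ballI impI equals0I)
  fix \<alpha> \<beta> i assume ab: "\<alpha> \<in> roots_of_form n T" "\<beta> \<in> roots_of_form n T" "\<alpha> \<noteq> \<beta>"
    and "i \<in> root_rows \<alpha> \<inter> root_rows \<beta>"
  then have i: "i \<in> root_rows \<alpha>" "i \<in> root_rows \<beta>" by auto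
  have "i < n" using root_rows_less i(1) ab(1) roots_of_form_subset by blast
  from mem_roots_of_form_rowD[OF T ab(1) i(1)] mem_roots_of_form_rowD[OF T ab(2) i(2)]
  obtain j k where jk: "j < n" "T $$ (i, j) \<noteq> 0" "k < n" "T $$ (i, k) \<noteq> 0"
    "\<alpha> = (if i = j then Eps_Double (Suc i) else Eps_Sum (Suc (min i j)) (Suc (Suc (min i j))))"
    "\<beta> = (if i = k then Eps_Double (Suc i) else Eps_Sum (Suc (min i k)) (Suc (Suc (min i k))))"
    by blast
  then have "j = k" using T \<open>i < n\<close> unfolding reduced_form_def by blast
  then have "\<alpha> = \<beta>" by (simp only: jk(5,6))
  then show False using ab(3) by simp
qed

lemma cover_roots_of_form:
  assumes T: "reduced_form n T" and i: "Suc i < n"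
  shows "\<exists>\<alpha>\<in>roots_of_form n T. i \<in> root_rows \<alpha>"
proof -
  obtain j where j: "j < n" "T $$ (i, j) \<noteq> 0" using T i unfolding reduced_form_def by blast
  then have "j \<le> Suc i" "i \<le> Suc j" using T i unfolding reduced_form_def by auto
  then consider "j = i" | "j = Suc i" | "i = Suc j" by linarith
  then show ?thesis
  proof cases
    case 1
    then have "Eps_Double (Suc i) \<in> roots_of_form n T" using j by (auto simp: roots_of_form_def)
    then show ?thesis by force
  next
    case 2
    then have "Eps_Sum (Suc i) (Suc (Suc i)) \<in> roots_of_form n T" using j by (auto simp: roots_of_form_def)
    then show ?thesis by force
  next
    case 3
    have "T $$ (j, i) = T $$ (i, j)"
      using T i j transpose_eq_imp_index[of T n j i] unfolding reduced_form_def by simp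
    then have "Eps_Sum (Suc j) (Suc (Suc j)) \<in> roots_of_form n T"
      using 3 i j by (auto simp: roots_of_form_def)
    then show ?thesis using 3 by force
  qed
qed

text \<open>Passing from \<open>n\<close> to \<open>n + 1\<close> adds a last row and a last column,
  of which only the corner and its two neighbours survive.\<close>

lemma sum_tridiagonal:
  fixes f :: "nat \<Rightarrow> nat \<Rightarrow> 'a::comm_monoid_add"
  assumes "\<And>i j. i < n \<Longrightarrow> j < n \<Longrightarrow> f i j \<noteq> 0 \<Longrightarrow> j \<le> Suc i \<and> i \<le> Suc j"
  shows "(\<Sum>i<n. \<Sum>j<n. f i j) = (\<Sum>i<n. f i i) + (\<Sum>i<n - 1. f i (Suc i) + f (Suc i) i)"
  using assms
proof (induction n)
  case (Suc n)
  have IH: "(\<Sum>i<n. \<Sum>j<n. f i j) = (\<Sum>i<n. f i i) + (\<Sum>i<n - 1. f i (Suc i) + f (Suc i) i)"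
    by (rule Suc.IH) (use Suc.prems in auto)
  have "(\<Sum>i<Suc n. \<Sum>j<Suc n. f i j) = (\<Sum>i<n. \<Sum>j<n. f i j) + f n n + ((\<Sum>i<n. f i n) + (\<Sum>j<n. f n j))"
    by (simp add: sum.distrib ac_simps)
  also have "(\<Sum>i<n. f i n) + (\<Sum>j<n. f n j) = (if n = 0 then 0 else f (n - 1) n + f n (n - 1))"
  proof (cases n)
    case (Suc m)
    have "f i n = 0" "f n i = 0" if "i < m" for i
      using Suc.prems[of i n] Suc.prems[of n i] that \<open>n = Suc m\<close> by force+
    then show ?thesis by (simp add: Suc)
  qed simp
  also have "(\<Sum>i<n. \<Sum>j<n. f i j) + f n n + (if n = 0 then 0 else f (n - 1) n + f n (n - 1)) =
      (\<Sum>i<Suc n. f i i) + (\<Sum>i<Suc n - 1. f i (Suc i) + f (Suc i) i)"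
    unfolding IH by (cases n) (simp_all add: ac_simps)
  finally show ?case .
qed simp

text \<open>Applying \<theta> to both sides identifies \<open>\<lambda>_T\<close> on
  \<open>A\<close> with the product of the linear characters of the roots read off from
  \<open>T\<close>.\<close>

lemma sum_roots_of_form:
  assumes T: "reduced_form n T" and b: "b \<in> symmetric_mats n"
  shows "(\<Sum>\<alpha>\<in>roots_of_form n T. root_coeff T \<alpha> * b $$ root_index \<alpha>) = pairing n T b"
proof -
  let ?A = "{i \<in> {..<n}. T $$ (i, i) \<noteq> 0}" and ?B = "{i \<in> {..<n - 1}. T $$ (i, Suc i) \<noteq> 0}"
  let ?f = "\<lambda>i. Eps_Double (Suc i)" and ?g = "\<lambda>i. Eps_Sum (Suc i) (Suc (Suc i))"
  let ?h = "\<lambda>\<alpha>. root_coeff T \<alpha> * b $$ root_index \<alpha>"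
  have eq: "roots_of_form n T = ?f ` ?A \<union> ?g ` ?B" by (auto simp: roots_of_form_def)
  have "(\<Sum>\<alpha>\<in>roots_of_form n T. ?h \<alpha>) = (\<Sum>\<alpha>\<in>?f ` ?A. ?h \<alpha>) + (\<Sum>\<alpha>\<in>?g ` ?B. ?h \<alpha>)"
    unfolding eq by (rule sum.union_disjoint) auto
  also have "(\<Sum>\<alpha>\<in>?f ` ?A. ?h \<alpha>) = (\<Sum>i\<in>?A. T $$ (i, i) * b $$ (i, i))"
    by (subst sum.reindex) (auto simp: inj_on_def)
  also have "\<dots> = (\<Sum>i<n. T $$ (i, i) * b $$ (i, i))"
    by (rule sum.mono_neutral_left) auto
  also have "(\<Sum>\<alpha>\<in>?g ` ?B. ?h \<alpha>) = (\<Sum>i\<in>?B. (1 + 1) * T $$ (i, Suc i) * b $$ (i, Suc i))"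
    by (subst sum.reindex) (auto simp: inj_on_def)
  also have "\<dots> = (\<Sum>i<n - 1. (1 + 1) * T $$ (i, Suc i) * b $$ (i, Suc i))"
    by (rule sum.mono_neutral_left) auto
  also have "\<dots> = (\<Sum>i<n - 1. T $$ (i, Suc i) * b $$ (i, Suc i) + T $$ (Suc i, i) * b $$ (Suc i, i))"
  proof (rule sum.cong)
    fix i assume "i \<in> {..<n - 1}"
    then have i: "i < n" "Suc i < n" by auto
    have "T $$ (Suc i, i) = T $$ (i, Suc i)" "b $$ (Suc i, i) = b $$ (i, Suc i)"
      using T symmetric_matsD[OF b] transpose_eq_imp_index[of T n "Suc i" i]
        transpose_eq_imp_index[of b n "Suc i" i] i
      unfolding reduced_form_def by simp_all
    then show "(1 + 1) * T $$ (i, Suc i) * b $$ (i, Suc i) =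
        T $$ (i, Suc i) * b $$ (i, Suc i) + T $$ (Suc i, i) * b $$ (Suc i, i)"
      by (simp add: algebra_simps)
  qed simp
  also have "(\<Sum>i<n. T $$ (i, i) * b $$ (i, i)) + \<dots> = pairing n T b"
    unfolding pairing_def
    by (rule sum_tridiagonal[symmetric]) (use T in \<open>auto simp: reduced_form_def\<close>)
  finally show ?thesis .
qed

text \<open>The sum of all field elements is invariant under the shift by 1, so \<open>q\<close> is
  zero in the field. If 2 were zero too, an odd \<open>q\<close> would give
  \<open>1 = 0\<close>.\<close>

lemma odd_card_imp_two_nonzero:
  assumes "odd CARD('a::{field,finite})"
  shows "(2::'a) \<noteq> 0"
proof
  assume two: "(2::'a) = 0"
  have "(\<Sum>x\<in>(UNIV :: 'a set). x) = (\<Sum>x\<in>UNIV. x + 1)"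
    by (rule sum.reindex_bij_betw[symmetric]) (rule bij_betw_byWitness[where f' = "\<lambda>x. x - 1"], auto)
  also have "\<dots> = (\<Sum>x\<in>UNIV. x) + of_nat CARD('a)" by (simp add: sum.distrib)
  finally have "of_nat CARD('a) = (0::'a)" by simp
  moreover obtain k where "CARD('a) = 2 * k + 1" using assms by (rule oddE)
  ultimately show False using two by simp
qed

theorem theorem7p1:
  fixes p e n :: nat
    and \<theta> :: "'a::{field,finite} \<Rightarrow> complex"
    and \<chi> :: "'a mat \<Rightarrow> complex"
  assumes "prime p" and "3 \<le> p" and "1 \<le> e" and "CARD('a) = p ^ e" and "1 \<le> n"
    and "nontrivial_additive_character \<theta>"
    and "irreducible_character (USp n) \<chi>"
  shows "(\<forall>\<psi> :: 'a mat \<Rightarrow> complex. irreducible_character (USp n) \<psi> \<longrightarrow>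
            character_degree (USp n) \<psi> \<le> character_degree (USp n) \<chi>)
     \<longleftrightarrow>
     (\<exists>D \<phi>. D \<subseteq> Gamma n \<and> basic D \<and>
        (maximal_basic (Gamma n) D \<or> maximal_basic (Gamma n) (D \<union> {Eps_Double n})) \<and>
        (\<forall>\<alpha>\<in>D. \<phi> \<alpha> \<noteq> 0) \<and>
        (\<forall>x\<in>carrier (USp n). \<chi> x = supercharacter \<theta> n D \<phi> x))"
    (is "?max \<longleftrightarrow> ?super")
proof -
  let ?G = "USp n :: 'a mat monoid"
  have "odd p" using assms(1,2) prime_odd_nat by simp
  then have "odd CARD('a)" using assms(4) by simp
  then have two: "(2::'a) \<noteq> 0" by (rule odd_card_imp_two_nonzero)
  define N where "N = card (unitriangular n :: 'a mat set)"
  interpret usp_characters n N \<theta>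
    by unfold_locales (use two assms(6) N_def in auto)
  interpret USp: group ?G by (rule group_USp)
  have degree: "character_degree ?G \<psi> = real d"
    if "irreducible_representation ?G d \<rho>" "\<forall>g\<in>carrier ?G. \<psi> g = mat_trace (\<rho> g)" for d \<rho> \<psi>
    using character_degree_eq_dim[OF group_USp, of n d \<rho> \<psi>] that
    by (simp add: character_degree_def irreducible_representation_def)
  have le: "character_degree ?G \<psi> \<le> N" if irr: "irreducible_character ?G \<psi>" for \<psi>
  proof -
    obtain d \<rho> where "irreducible_representation ?G d \<rho>" "\<forall>g\<in>carrier ?G. \<psi> g = mat_trace (\<rho> g)"
      using irr unfolding irreducible_character_def by blast
    then show ?thesis using degree irreducible_dim_le by simp
  qed
  obtain d \<rho> where rho: "irreducible_representation ?G d \<rho>" "\<forall>g\<in>carrier ?G. \<chi> g = mat_trace (\<rho> g)"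
    using assms(7) unfolding irreducible_character_def by blast
  show ?thesis
  proof
    assume max: ?max
    obtain \<sigma> where \<sigma>: "irreducible_representation ?G N \<sigma>" using ex_irreducible_degree_N by blast
    then have "irreducible_character ?G (\<lambda>g. mat_trace (\<sigma> g))"
      unfolding irreducible_character_def by blast
    then have "real N \<le> real d" using max degree[OF \<sigma>] degree[OF rho] by fastforce
    then have dN: "d = N" using irreducible_dim_le[OF rho(1)] by simp
    obtain T where T: "reduced_form n T" and
      ind: "\<forall>g\<in>carrier ?G. mat_trace (\<rho> g) = induced_character ?G (siegel n) (siegel_character \<theta> n T) g"
      using max_degree_imp_reduced_form rho(1) unfolding dN by blast
    let ?D = "roots_of_form n T"
    have cond: "?D \<subseteq> Gamma n" "disjoint_rows ?D" "\<And>i. Suc i < n \<Longrightarrow> \<exists>\<alpha>\<in>?D. i \<in> root_rows \<alpha>"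
      using roots_of_form_subset disjoint_rows_roots_of_form[OF T] cover_roots_of_form[OF T] by auto
    have "basic ?D \<and> (maximal_basic (Gamma n) ?D \<or> maximal_basic (Gamma n) (?D \<union> {Eps_Double n}))"
      unfolding maximal_basic_up_to_last_iff[OF cond(1) assms(5)] using cond by blast
    moreover have "\<forall>\<alpha>\<in>?D. root_coeff T \<alpha> \<noteq> 0" using two by (auto simp: roots_of_form_def)
    moreover have "\<chi> g = supercharacter \<theta> n ?D (root_coeff T) g" if g: "g \<in> carrier ?G" for g
    proof -
      have "(\<Prod>\<alpha>\<in>?D. root_character \<theta> n \<alpha> (root_coeff T \<alpha>) h) = siegel_character \<theta> n T h"
        if h: "h \<in> siegel n" for h
      proof -
        have hc: "h \<in> carrier ?G" "upper_left n h = 1\<^sub>m n" using h by (auto simp: siegel_def)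
        have "row_trivial n i h" if "i < n" for i using that hc(2) by (auto simp: row_trivial_def)
        then have K: "h \<in> root_subgroup n \<alpha>" if "\<alpha> \<in> Gamma n" for \<alpha>
          using that hc(1) root_rows_less by (auto simp: mem_root_subgroup_iff)
        have "(\<Prod>\<alpha>\<in>?D. root_character \<theta> n \<alpha> (root_coeff T \<alpha>) h) =
            (\<Prod>\<alpha>\<in>?D. \<theta> (root_coeff T \<alpha> * sym_part n h $$ root_index \<alpha>))"
          by (rule prod.cong) (use cond(1) K root_character_eq in auto)
        also have "\<dots> = \<theta> (\<Sum>\<alpha>\<in>?D. root_coeff T \<alpha> * sym_part n h $$ root_index \<alpha>)"
          by (rule additive_character_sum[OF \<theta> finite_subset[OF cond(1) finite_Gamma], symmetric])
        also have "\<dots> = siegel_character \<theta> n T h"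
          using sum_roots_of_form[OF T sym_part_symmetric[OF hc(1)]] by (simp add: siegel_character_def)
        finally show ?thesis .
      qed
      then show ?thesis
        using supercharacter_eq_induced[OF cond g] rho(2) ind g
          induced_character_cong[of "siegel n" "\<lambda>h. \<Prod>\<alpha>\<in>?D. root_character \<theta> n \<alpha> (root_coeff T \<alpha>) h"
            "siegel_character \<theta> n T" ?G g]
        by simp
    qed
    ultimately show ?super using cond(1) by blast
  next
    assume ?super
    then obtain D \<phi> where D: "D \<subseteq> Gamma n" and
      b: "basic D \<and> (maximal_basic (Gamma n) D \<or> maximal_basic (Gamma n) (D \<union> {Eps_Double n}))" and
      \<chi>: "\<forall>x\<in>carrier ?G. \<chi> x = supercharacter \<theta> n D \<phi> x" by blast
    have "disjoint_rows D" "\<And>i. Suc i < n \<Longrightarrow> \<exists>\<alpha>\<in>D. i \<in> root_rows \<alpha>"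
      using b unfolding maximal_basic_up_to_last_iff[OF D assms(5)] by blast+
    then have "character_degree ?G \<chi> = N"
      using supercharacter_degree[OF D] \<chi> by (simp add: character_degree_def)
    then show ?max using le by simp
  qed
qed

end
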